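(* Let $\alpha\in\mathbb{N}$, $1<p<\infty$, $a>0$ and $b\ge 0$. Assume that for every real $m\ge 1$ there is a quadrature $I_m(f)=\sum_{i=1}^{\lfloor m\rfloor}\lambda_i f(\boldsymbol{x}_i)$ with nodes $\boldsymbol{x}_1,\ldots,\boldsymbol{x}_{\lfloor m\rfloor}\in\mathbb{I}^d=[-\tfrac12,\tfrac12]^d$ (nodes and weights may depend on $\lfloor m\rfloor$) such that $$\Big|\int_{\mathbb{I}^d} f(\boldsymbol{x})\,\mathrm{d}\boldsymbol{x}-I_m(f)\Big|\le C\,m^{-a}\,\ell(m)^b\,\|f\|_{W^\alpha_p(\mathbb{I}^d)}\qquad\text{for all } f\in W^\alpha_p(\mathbb{I}^d),$$ with a constant $C$ independent of $m$ and $f$. For real $n\ge 1$ let $I_n^{\mathrm{asm}}$ be the assembled quadrature on $\mathbb{R}^d$ built from the $I_m$ as described in the context (it has at most $n$ nodes). Then there is a constant $C'>0$ independent of $n$ and $f$ such that for all real $n\ge 1$ $$\Big|\int_{\mathbb{R}^d} f(\boldsymbol{x})\,\gamma(\mathrm{d}\boldsymbol{x})-I_n^{\mathrm{asm}}(f)\Big|\le C'\,n^{-a}\,\ell(n)^b\,\|f\|_{W^\alpha_p(\mathbb{R}^d,\gamma)}\qquad\text{for all } f\in W^\alpha_p(\mathbb{R}^d,\gamma).$$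
   Context: Notation: $\log$ is the natural logarithm and $\ell(t):=\max\{1,\log t\}$ for $t\ge 1$. $\gamma(\mathrm{d}\boldsymbol{x})=g(\boldsymbol{x})\,\mathrm{d}\boldsymbol{x}$ is the standard Gaussian measure on $\mathbb{R}^d$, $g(\boldsymbol{x})=(2\pi)^{-d/2}\exp(-|\boldsymbol{x}|^2/2)$, $|\cdot|$ the Euclidean norm. Weighted spaces: for measurable $\Omega\subset\mathbb{R}^d$, $\|f\|_{L_p(\Omega,\gamma)}=(\int_\Omega|f|^p g\,\mathrm{d}\boldsymbol{x})^{1/p}$. For $\alpha\in\mathbb{N}$, $W^\alpha_p(\Omega,\gamma)$ is the space of $f\in L_p(\Omega,\gamma)$ whose weak derivatives $D^{\boldsymbol{r}}f$ lie in $L_p(\Omega,\gamma)$ for all $\boldsymbol{r}\in\mathbb{N}_0^d$ with $|\boldsymbol{r}|_\infty\le\alpha$, with norm $\|f\|_{W^\alpha_p(\Omega,\gamma)}=\big(\sum_{|\boldsymbol{r}|_\infty\le\alpha}\|D^{\boldsymbol{r}}f\|_{L_p(\Omega,\gamma)}^p\big)^{1/p}$. $W^\alpha_p(\Omega)$ is defined in the same way with the unweighted $L_p(\Omega)$. Point values refer to continuous representatives. Assembled quadrature: for $x\in\mathbb{R}$ put $\operatorname{sign}x=1$ if $x\ge0$ and $-1$ otherwise, and $\operatorname{sign}\boldsymbol{k}=(\operatorname{sign}k_1,\ldots,\operatorname{sign}k_d)$. Fix $\tau$ with $1<\tau<p$ and fix $\delta>0$ such that, for some constant $C$ and all $\boldsymbol{k}\in\mathbb{Z}^d$,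 $$\max\Big\{e^{-\frac{|\boldsymbol{k}-(\operatorname{sign}\boldsymbol{k})/2|^2}{2}(1-\frac1p)},\;e^{\frac{|\boldsymbol{k}+(\operatorname{sign}\boldsymbol{k})/2|^2}{2p}-\frac{|\boldsymbol{k}|^2}{2\tau}}\Big\}\le C e^{-\delta|\boldsymbol{k}|^2}.$$ For real $n\ge1$ put $\xi_n=\sqrt{2a\delta^{-1}\log n}$, and $n_{\boldsymbol{k}}=\varrho\, n\, e^{-\frac{\delta}{2a}|\boldsymbol{k}|^2}$ if $|\boldsymbol{k}|<\xi_n$, $n_{\boldsymbol{k}}=0$ if $|\boldsymbol{k}|\ge\xi_n$, where $\varrho=2^{-d}(1-e^{-\delta/(2a)})^d$ (so that $\sum_{\boldsymbol{k}}n_{\boldsymbol{k}}\le n$). With the conventions $I_t=I_{\lfloor t\rfloor}$ for real $t\geq 0$ and $I_0=0$, define $$I_n^{\mathrm{asm}}(f)=\sum_{|\boldsymbol{k}|<\xi_n}I_{n_{\boldsymbol{k}}}\big(f(\cdot+\boldsymbol{k})\,g(\cdot+\boldsymbol{k})\big)=\sum_{|\boldsymbol{k}|<\xi_n}\sum_{j=1}^{\lfloor n_{\boldsymbol{k}}\rfloor}\lambda_j\,g(\boldsymbol{x}_j+\boldsymbol{k})\,f(\boldsymbol{x}_j+\boldsymbol{k}),$$ where $\boldsymbol{k}$ ranges over $\mathbb{Z}^d$ and, in the summand for $\boldsymbol{k}$, $\boldsymbol{x}_j,\lambda_j$ are the nodes and weights of $I_{\lfloor n_{\boldsymbol{k}}\rfloor}$.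 *)

theory Defs
  imports "HOL-Analysis.Analysis"
begin

section \<open>Weak derivatives\<close>

definition partial_deriv :: "'d \<Rightarrow> (real ^ 'd \<Rightarrow> real) \<Rightarrow> real ^ 'd \<Rightarrow> real" where
  "partial_deriv i \<phi> x = deriv (\<lambda>t. \<phi> (x + t *\<^sub>R axis i 1)) 0"

primrec partial_derivs :: "'d list \<Rightarrow> (real ^ 'd \<Rightarrow> real) \<Rightarrow> real ^ 'd \<Rightarrow> real" where
  "partial_derivs [] \<phi> = \<phi>"
| "partial_derivs (i # is) \<phi> = partial_deriv i (partial_derivs is \<phi>)"

text \<open>Total differentiability of every iterated partial derivative makes all of them continuous,
  so this is \<open>C\<^sup>\<infinity>\<close> on the whole space.\<close>

definition smooth :: "(real ^ 'd \<Rightarrow> real) \<Rightarrow> bool" where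
  "smooth \<phi> \<longleftrightarrow> (\<forall>is x. partial_derivs is \<phi> differentiable (at x))"

definition test_function :: "(real ^ 'd) set \<Rightarrow> (real ^ 'd \<Rightarrow> real) \<Rightarrow> bool" where
  "test_function U \<phi> \<longleftrightarrow>
     smooth \<phi> \<and> compact (closure {x. \<phi> x \<noteq> 0}) \<and> closure {x. \<phi> x \<noteq> 0} \<subseteq> U"

text \<open>A multi-index is a function \<open>r :: 'd \<Rightarrow> nat\<close>. The list \<open>is\<close> ranges over all orders in which the
  classical derivative \<open>D\<^sup>r \<phi>\<close> can be taken; they all give the same function.\<close>

definition has_weak_deriv ::
    "(real ^ 'd) set \<Rightarrow> ('d \<Rightarrow> nat) \<Rightarrow> (real ^ 'd \<Rightarrow> real) \<Rightarrow> (real ^ 'd \<Rightarrow> real) \<Rightarrow> bool" where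
  "has_weak_deriv U r f h \<longleftrightarrow>
     (\<forall>K. compact K \<and> K \<subseteq> U \<longrightarrow> f absolutely_integrable_on K \<and> h absolutely_integrable_on K) \<and>
     (\<forall>\<phi> is. test_function U \<phi> \<and> (\<forall>i. count_list is i = r i) \<longrightarrow>
        (LINT x|lebesgue_on U. f x * partial_derivs is \<phi> x) =
        (-1) ^ (\<Sum>i\<in>UNIV. r i) * (LINT x|lebesgue_on U. h x * \<phi> x))"

text \<open>Determined only up to null sets. For a domain that is not open (such as the closed cube),
  weak derivatives are those on its interior.\<close>

definition weak_deriv ::
    "(real ^ 'd) set \<Rightarrow> ('d \<Rightarrow> nat) \<Rightarrow> (real ^ 'd \<Rightarrow> real) \<Rightarrow> real ^ 'd \<Rightarrow> real" where
  "weak_deriv \<Omega> r f = (SOME h. has_weak_deriv (interior \<Omega>) r f h)"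


section \<open>Weighted spaces\<close>

definition gauss_density :: "real ^ 'd \<Rightarrow> real" where
  "gauss_density x = (2 * pi) powr (- real CARD('d) / 2) * exp (- (norm x)\<^sup>2 / 2)"

definition gauss_measure :: "(real ^ 'd) measure" where
  "gauss_measure = density lebesgue (\<lambda>x. ennreal (gauss_density x))"

text \<open>Below \<open>\<mu>\<close> is a measure on the whole space: \<open>lebesgue\<close> gives the unweighted spaces on \<open>\<Omega>\<close>,
  \<open>gauss_measure\<close> the Gaussian ones.\<close>

definition Lp_space ::
    "real \<Rightarrow> (real ^ 'd) measure \<Rightarrow> (real ^ 'd) set \<Rightarrow> (real ^ 'd \<Rightarrow> real) set" where
  "Lp_space p \<mu> \<Omega> =
     {f \<in> borel_measurable (restrict_space \<mu> \<Omega>).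
        integrable (restrict_space \<mu> \<Omega>) (\<lambda>x. \<bar>f x\<bar> powr p)}"

definition Lp_norm ::
    "real \<Rightarrow> (real ^ 'd) measure \<Rightarrow> (real ^ 'd) set \<Rightarrow> (real ^ 'd \<Rightarrow> real) \<Rightarrow> real" where
  "Lp_norm p \<mu> \<Omega> f = (LINT x|restrict_space \<mu> \<Omega>. \<bar>f x\<bar> powr p) powr (1 / p)"

text \<open>The condition \<open>\<forall>i. r i \<le> \<alpha>\<close> is \<open>|r|\<^sub>\<infinity> \<le> \<alpha>\<close> (dominating mixed smoothness).\<close>

definition sobolev_space ::
    "nat \<Rightarrow> real \<Rightarrow> (real ^ 'd) measure \<Rightarrow> (real ^ 'd) set \<Rightarrow> (real ^ 'd \<Rightarrow> real) set" where
  "sobolev_space \<alpha> p \<mu> \<Omega> =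
     {f \<in> Lp_space p \<mu> \<Omega>. \<forall>r. (\<forall>i. r i \<le> \<alpha>) \<longrightarrow>
        (\<exists>h. has_weak_deriv (interior \<Omega>) r f h) \<and> weak_deriv \<Omega> r f \<in> Lp_space p \<mu> \<Omega>}"

definition sobolev_norm ::
    "nat \<Rightarrow> real \<Rightarrow> (real ^ 'd) measure \<Rightarrow> (real ^ 'd) set \<Rightarrow> (real ^ 'd \<Rightarrow> real) \<Rightarrow> real" where
  "sobolev_norm \<alpha> p \<mu> \<Omega> f =
     (\<Sum>r | \<forall>i. r i \<le> \<alpha>. Lp_norm p \<mu> \<Omega> (weak_deriv \<Omega> r f) powr p) powr (1 / p)"

text \<open>Functions in these spaces are only given up to null sets; they are evaluated through their
  continuous representative.\<close>

definition cont_rep :: "(real ^ 'd) set \<Rightarrow> (real ^ 'd \<Rightarrow> real) \<Rightarrow> real ^ 'd \<Rightarrow> real" where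
  "cont_rep \<Omega> f = (SOME h. continuous_on \<Omega> h \<and> (AE x in lebesgue_on \<Omega>. h x = f x))"


section \<open>Quadratures\<close>

definition ell :: "real \<Rightarrow> real" where
  "ell t = max 1 (ln t)"

definition unit_cube :: "(real ^ 'd) set" where
  "unit_cube = cbox (\<chi> i. - 1 / 2) (\<chi> i. 1 / 2)"

text \<open>A family of quadratures is given by the weights \<open>\<lambda> N j\<close> and nodes \<open>x N j\<close> (\<open>1 \<le> j \<le> N\<close>) of
  the \<open>N\<close>-point rule, and \<open>I\<^sub>t\<close> for real \<open>t \<ge> 0\<close> is the rule with \<open>N = \<lfloor>t\<rfloor>\<close>. The sum is empty for
  \<open>t < 1\<close>. The argument \<open>f\<close> is evaluated pointwise, so a continuous representative has to be
  passed.\<close>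

definition quadrature ::
    "(nat \<Rightarrow> nat \<Rightarrow> real) \<Rightarrow> (nat \<Rightarrow> nat \<Rightarrow> real ^ 'd) \<Rightarrow> real \<Rightarrow> (real ^ 'd \<Rightarrow> real) \<Rightarrow> real" where
  "quadrature wt nd t f = (\<Sum>j = 1..nat \<lfloor>t\<rfloor>. wt (nat \<lfloor>t\<rfloor>) j * f (nd (nat \<lfloor>t\<rfloor>) j))"

definition int_vec :: "int ^ 'd \<Rightarrow> real ^ 'd" where
  "int_vec k = (\<chi> i. real_of_int (k $ i))"

text \<open>Unlike \<open>sgn\<close>, this sign takes the value 1 at 0.\<close>

definition sign_vec :: "int ^ 'd \<Rightarrow> real ^ 'd" where
  "sign_vec k = (\<chi> i. if k $ i \<ge> 0 then 1 else - 1)"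

definition admissible_delta :: "'d::finite itself \<Rightarrow> real \<Rightarrow> real \<Rightarrow> real \<Rightarrow> bool" where
  "admissible_delta _ p \<tau> \<delta> \<longleftrightarrow>
     (\<exists>C. \<forall>k :: int ^ 'd.
        max (exp (- (norm (int_vec k - (1 / 2) *\<^sub>R sign_vec k))\<^sup>2 / 2 * (1 - 1 / p)))
            (exp ((norm (int_vec k + (1 / 2) *\<^sub>R sign_vec k))\<^sup>2 / (2 * p)
                   - (norm (int_vec k))\<^sup>2 / (2 * \<tau>)))
        \<le> C * exp (- \<delta> * (norm (int_vec k))\<^sup>2))"

definition xi :: "real \<Rightarrow> real \<Rightarrow> real \<Rightarrow> real" where
  "xi a \<delta> n = sqrt (2 * a * inverse \<delta> * ln n)"

definition local_size :: "real \<Rightarrow> real \<Rightarrow> real \<Rightarrow> int ^ 'd \<Rightarrow> real" where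
  "local_size a \<delta> n k =
     (if norm (int_vec k) < xi a \<delta> n
      then (1 / 2) ^ CARD('d) * (1 - exp (- \<delta> / (2 * a))) ^ CARD('d)
             * n * exp (- \<delta> / (2 * a) * (norm (int_vec k))\<^sup>2)
      else 0)"

definition assembled_quadrature ::
    "(nat \<Rightarrow> nat \<Rightarrow> real) \<Rightarrow> (nat \<Rightarrow> nat \<Rightarrow> real ^ 'd) \<Rightarrow> real \<Rightarrow> real \<Rightarrow> real
       \<Rightarrow> (real ^ 'd \<Rightarrow> real) \<Rightarrow> real" where
  "assembled_quadrature wt nd a \<delta> n f =
     (\<Sum>k :: int ^ 'd | norm (int_vec k) < xi a \<delta> n.
        quadrature wt nd (local_size a \<delta> n k)
          (\<lambda>x. f (x + int_vec k) * gauss_density (x + int_vec k)))"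

text \<open>The number of sample points, counted with multiplicity.\<close>

definition assembled_size :: "'d::finite itself \<Rightarrow> real \<Rightarrow> real \<Rightarrow> real \<Rightarrow> nat" where
  "assembled_size _ a \<delta> n =
     (\<Sum>k :: int ^ 'd | norm (int_vec k) < xi a \<delta> n. nat \<lfloor>local_size a \<delta> n k\<rfloor>)"

end

theory Submission
  imports Defs "HOL-Probability.Distributions"
begin

text \<open>
  Up to a null set, \<open>\<real>\<^sup>d\<close> is the disjoint union of the unit cubes centred at the lattice points \<open>k\<close>.
  So \<open>\<integral> f d\<gamma>\<close> is the sum over \<open>k\<close> of the integrals over the central cube of the pieces
  \<open>f\<^sub>k x = f (x + k) * g (x + k)\<close>, and the assembled quadrature applies a cube rule to each piece.
  Everything rests on the estimate (\<open>sobolev_gauss_piece\<close>)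
  \<open>\<parallel>f\<^sub>k\<parallel> \<le> C * exp (- \<delta> |k|\<^sup>2) * \<parallel>f\<parallel>\<close> between the unweighted norm on the cube and the Gaussian norm.
  By the Leibniz rule \<open>D\<^sup>r f\<^sub>k\<close> is a sum of products of a \<open>D\<^sup>s f\<close> with a derivative of \<open>g\<close>, and a derivative
  of \<open>g\<close> is \<open>g\<close> times a polynomial. A factor \<open>g\<^bsup>1/p\<^esup>\<close> is spent on turning the unweighted \<open>L\<^sub>p\<close> norm of
  \<open>D\<^sup>s f\<close> into the weighted one. What is left is \<open>exp (- (1 - 1/p) |x|\<^sup>2 / 2)\<close> times a polynomial, and it
  is \<open>O(exp (- \<delta> |k|\<^sup>2))\<close> on the cube around \<open>k\<close> as soon as \<open>\<delta> < (1 - 1/p) / 2\<close>: polynomials and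
  shifts by a bounded vector cost an arbitrarily small part of the exponent. An admissible \<open>\<delta>\<close> is that
  small (\<open>admissible_delta_less\<close>), since it is at most \<open>1/(2\<tau>) - 1/(2p)\<close> and \<open>\<tau> > 1\<close>.

  The sizes \<open>n\<^sub>k\<close> are chosen so that \<open>n\<^sub>k\<^bsup>-a\<^esup>\<close> gives back half of this decay: the error on the
  \<open>k\<close>-th cube is at most a constant times \<open>n\<^bsup>-a\<^esup> \<ell>(n)\<^sup>b exp (- \<delta> |k|\<^sup>2 / 2) \<parallel>f\<parallel>\<close> (\<open>piece_error_bound\<close>).
  Where the piece is dropped because \<open>|k| \<ge> \<xi>\<^sub>n\<close>, half of the decay is already below \<open>n\<^bsup>-a\<^esup>\<close>. The sum
  over \<open>k\<close> converges because a Gaussian sum over the lattice is a product of sums dominated by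
  geometric series (\<open>lattice_gaussian_sum_le\<close>), which also bounds the number of nodes.

  Two facts give the definitions their meaning. Weak derivatives are unique almost everywhere
  (\<open>has_weak_deriv_unique\<close>), because bumps approximate indicators of boxes. And a function whose mixed
  weak derivatives of order at most one in each variable exist has a continuous representative
  (\<open>continuous_representative\<close>): after multiplication by a tensor product \<open>\<eta>\<close> of bumps it is the
  iterated antiderivative \<open>x \<mapsto> \<integral> y \<le> x. w y\<close> of an integrable function \<open>w\<close>, namely of the mixed
  derivative of the product. Tensor products of functions of one variable serve as test functions in
  both arguments.\<close>

section \<open>Smooth functions of one variable\<close>

coinductive smooth1 :: "(real \<Rightarrow> real) \<Rightarrow> bool" where
  smooth1I: "(\<And>x. (u has_real_derivative u' x) (at x)) \<Longrightarrow> smooth1 u' \<Longrightarrow> smooth1 u"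

text \<open>Coinduction in the form used throughout: to show that a function is smooth it suffices to exhibit
  a family that contains it and is closed under differentiation.\<close>
lemma smooth1_closed_family:
  assumes "u \<in> S" "\<And>u. u \<in> S \<Longrightarrow> \<exists>u'\<in>S. \<forall>x. (u has_real_derivative u' x) (at x)"
  shows "smooth1 u"
  using assms(1) by (coinduction arbitrary: u) (use assms(2) in blast)

lemma smooth1_deriv: assumes "smooth1 u" shows "smooth1 (deriv u)"
proof -
  obtain u' where u': "\<And>x. (u has_real_derivative u' x) (at x)" "smooth1 u'"
    using assms by (metis smooth1.cases)
  then have "deriv u = u'" by (auto intro!: ext DERIV_imp_deriv)
  then show ?thesis using u' by simp
qed

lemma smooth1_DERIV: assumes "smooth1 u" shows "(u has_real_derivative deriv u x) (at x)"
  using assms by (metis DERIV_imp_deriv smooth1.cases)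

lemma smooth1_higher_deriv: "smooth1 u \<Longrightarrow> smooth1 ((deriv ^^ n) u)"
  by (induction n) (auto intro: smooth1_deriv)

lemma smooth1_continuous_on: "smooth1 u \<Longrightarrow> continuous_on S u"
  by (meson DERIV_continuous_on has_field_derivative_at_within smooth1_DERIV)

text \<open>The family that closes products under differentiation: by the product rule sums are needed.\<close>
inductive_set product_sums :: "(real \<Rightarrow> real) set" where
  prod: "smooth1 u \<Longrightarrow> smooth1 v \<Longrightarrow> (\<lambda>x. u x * v x) \<in> product_sums"
| sum: "u \<in> product_sums \<Longrightarrow> v \<in> product_sums \<Longrightarrow> (\<lambda>x. u x + v x) \<in> product_sums"

lemma smooth1_mult:
  assumes "smooth1 u" "smooth1 v"
  shows "smooth1 (\<lambda>x. u x * v x)"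
proof (rule smooth1_closed_family)
  show "(\<lambda>x. u x * v x) \<in> product_sums" using assms by (rule product_sums.prod)
  fix w assume "w \<in> product_sums"
  then show "\<exists>w'\<in>product_sums. \<forall>x. (w has_real_derivative w' x) (at x)"
  proof induction
    case (prod u v)
    have "\<forall>x. ((\<lambda>x. u x * v x) has_real_derivative (deriv u x * v x + u x * deriv v x)) (at x)"
      using prod by (auto intro!: derivative_eq_intros smooth1_DERIV)
    moreover have "(\<lambda>x. deriv u x * v x + u x * deriv v x) \<in> product_sums"
      using prod by (intro product_sums.intros smooth1_deriv)
    ultimately show ?case by (rule bexI)
  next
    case (sum u v)
    then obtain u' v' where "u' \<in> product_sums" "\<forall>x. (u has_real_derivative u' x) (at x)"
      "v' \<in> product_sums" "\<forall>x. (v has_real_derivative v' x) (at x)" by blast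
    then show ?case
      by (intro bexI[of _ "\<lambda>x. u' x + v' x"]) (auto intro!: derivative_eq_intros product_sums.sum)
  qed
qed

lemma smooth1_affine:
  assumes "smooth1 u" shows "smooth1 (\<lambda>x. u (m * x + c))"
proof (rule smooth1_closed_family)
  let ?S = "{(\<lambda>x. r * v (m * x + c)) | r v. smooth1 v}"
  have "(\<lambda>x. u (m * x + c)) = (\<lambda>x. 1 * u (m * x + c))" by simp
  then show "(\<lambda>x. u (m * x + c)) \<in> ?S" using assms by blast
  fix w assume "w \<in> ?S"
  then obtain r v where w: "w = (\<lambda>x. r * v (m * x + c))" and v: "smooth1 v" by blast
  have "(w has_real_derivative (r * m) * deriv v (m * x + c)) (at x)" for x
    unfolding w
    by (rule derivative_eq_intros DERIV_chain2[OF smooth1_DERIV[OF v]] refl | simp)+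
  moreover have "(\<lambda>x. (r * m) * deriv v (m * x + c)) \<in> ?S"
    using smooth1_deriv[OF v] by blast
  ultimately show "\<exists>w'\<in>?S. \<forall>x. (w has_real_derivative w' x) (at x)" by (intro bexI allI)
qed

lemma smooth1_const: "smooth1 (\<lambda>x. c)"
  by (rule smooth1_closed_family[of _ "range (\<lambda>c x. c)"]) (auto intro!: exI[of _ 0])

text \<open>The classical smooth function that vanishes on a half-line and is not analytic at the end point.\<close>
definition flat :: "real \<Rightarrow> real" where
  "flat x = (if x > 0 then exp (- inverse x) else 0)"

lemma flat_bounds: "0 \<le> flat x" "flat x \<le> 1"
  by (auto simp: flat_def)

lemma poly_exp_tendsto_0: "((\<lambda>t. poly q t * exp (- t)) \<longlongrightarrow> 0) (at_top :: real filter)"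
proof -
  have "((\<lambda>t. \<Sum>i\<le>degree q. coeff q i * (t ^ i / exp t)) \<longlongrightarrow> (\<Sum>i\<le>degree q. coeff q i * 0)) (at_top :: real filter)"
    by (intro tendsto_intros tendsto_power_div_exp_0)
  moreover have "(\<lambda>t. \<Sum>i\<le>degree q. coeff q i * (t ^ i / exp t)) = (\<lambda>t. poly q t * exp (- t))"
    by (auto simp: poly_altdef sum_distrib_right exp_minus divide_inverse mult.assoc)
  ultimately show ?thesis by simp
qed

text \<open>All derivatives have the form \<open>q (1/x) exp (- 1/x)\<close> for \<open>x > 0\<close>, with a polynomial \<open>q\<close>, continued by
  zero. At the origin the difference quotient tends to zero because the exponential beats every power
  of \<open>1/x\<close>.\<close>
lemma smooth1_flat: "smooth1 flat"
proof (rule smooth1_closed_family)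
  let ?w = "\<lambda>q x::real. if x > 0 then poly q (inverse x) * exp (- inverse x) else 0"
  show "flat \<in> range ?w"
    by (rule range_eqI[of _ _ 1]) (auto simp: flat_def)
  fix w assume "w \<in> range ?w"
  then obtain q where w: "w = ?w q" by blast
  \<comment> \<open>by the chain rule, since \<open>- 1/x\<close> and \<open>1/x\<close> have the derivatives \<open>(1/x)\<^sup>2\<close> and \<open>- (1/x)\<^sup>2\<close>\<close>
  define q' where "q' = (q - pderiv q) * [:0, 0, 1:]"
  have "(w has_real_derivative ?w q' x) (at x)" for x
  proof -
    consider "x < 0" | "x > 0" | "x = 0" by linarith
    then show ?thesis
    proof cases
      case 1
      have "((\<lambda>_. 0) has_real_derivative 0) (at x)" by simp
      moreover have "eventually (\<lambda>y. 0 = w y) (nhds x)"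
        unfolding eventually_nhds w using 1 by (intro exI[of _ "{..<0}"]) auto
      ultimately have "(w has_real_derivative 0) (at x)"
        by (subst DERIV_cong_ev[of x x w "\<lambda>_. 0" 0 0]) (auto elim: eventually_mono)
      then show ?thesis using 1 by simp
    next
      case 2
      have "((\<lambda>x. poly q (inverse x) * exp (- inverse x)) has_real_derivative
         (poly (pderiv q) (inverse x) * (- (inverse x * inverse x))) * exp (- inverse x)
         + exp (- inverse x) * (inverse x * inverse x) * poly q (inverse x)) (at x)"
        using 2 by (auto intro!: derivative_eq_intros DERIV_chain2[OF poly_DERIV])
      also have "(poly (pderiv q) (inverse x) * (- (inverse x * inverse x))) * exp (- inverse x)
         + exp (- inverse x) * (inverse x * inverse x) * poly q (inverse x) = ?w q' x"
        using 2 by (simp add: q'_def algebra_simps)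
      finally have "((\<lambda>x. poly q (inverse x) * exp (- inverse x)) has_real_derivative ?w q' x) (at x)" .
      moreover have "eventually (\<lambda>y. poly q (inverse y) * exp (- inverse y) = w y) (nhds x)"
        unfolding eventually_nhds w using 2 by (intro exI[of _ "{0<..}"]) auto
      ultimately show ?thesis
        using DERIV_cong_ev[of x x w "\<lambda>x. poly q (inverse x) * exp (- inverse x)" "?w q' x" "?w q' x"]
        by (simp add: eq_commute)
    next
      case 3
      have "((\<lambda>h. w h / h) \<longlongrightarrow> 0) (at_right 0)"
      proof (rule Lim_transform_eventually)
        show "((\<lambda>h. poly (q * [:0, 1:]) (inverse h) * exp (- inverse h)) \<longlongrightarrow> 0) (at_right 0)"
          by (rule filterlim_compose[OF poly_exp_tendsto_0 filterlim_inverse_at_top_right])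
        show "eventually (\<lambda>h. poly (q * [:0, 1:]) (inverse h) * exp (- inverse h) = w h / h) (at_right 0)"
          unfolding eventually_at_right_field
          by (intro exI[of _ 1]) (auto simp: w field_simps)
      qed
      moreover have "((\<lambda>h. w h / h) \<longlongrightarrow> 0) (at_left 0)"
        by (rule tendsto_eventually, unfold eventually_at_left_field, intro exI[of _ "-1"]) (auto simp: w)
      ultimately have "((\<lambda>h. w h / h) \<longlongrightarrow> 0) (at 0)"
        by (simp add: filterlim_split_at)
      then have "(w has_real_derivative 0) (at 0)"
        unfolding DERIV_def by (rule Lim_transform_eventually) (auto simp: w eventually_at intro!: exI[of _ 1])
      then show ?thesis using 3 by simp
    qed
  qed
  then show "\<exists>w'\<in>range ?w. \<forall>x. (w has_real_derivative w' x) (at x)"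
    by (intro bexI[OF _ rangeI[of _ q']] allI)
qed

text \<open>The parameter \<open>n\<close> steepens the flanks: \<open>flat (n t) = (flat t)\<^bsup>1/n\<^esup>\<close> for \<open>n > 0\<close>, so that the bumps
  on \<open>(a, b)\<close> converge to the indicator of that interval.\<close>
definition bump :: "nat \<Rightarrow> real \<Rightarrow> real \<Rightarrow> real \<Rightarrow> real" where
  "bump n a b x = flat (real n * (x - a)) * flat (real n * (b - x))"

lemma bump_bounds: "0 \<le> bump n a b x" "bump n a b x \<le> 1"
  by (auto simp: bump_def flat_bounds intro!: mult_le_one)

lemma bump_eq_0: "x \<le> a \<or> b \<le> x \<Longrightarrow> bump n a b x = 0"
  by (auto simp: bump_def flat_def zero_less_mult_iff)

lemma bump_pos: "0 < n \<Longrightarrow> a < x \<Longrightarrow> x < b \<Longrightarrow> 0 < bump n a b x"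
  by (auto simp: bump_def flat_def zero_less_mult_iff)

lemma smooth1_bump: "smooth1 (bump n a b)"
proof -
  have "smooth1 (\<lambda>x. flat (real n * x + (- real n * a)) * flat (- real n * x + real n * b))"
    by (intro smooth1_mult smooth1_affine smooth1_flat)
  also have "(\<lambda>x. flat (real n * x + (- real n * a)) * flat (- real n * x + real n * b)) = bump n a b"
    by (auto simp: bump_def algebra_simps)
  finally show ?thesis .
qed

lemma flat_scaled_tendsto: "(\<lambda>n. flat (real n * t)) \<longlonglongrightarrow> (if t > 0 then 1 else 0)"
proof (cases "t > 0")
  case True
  have "(\<lambda>n. exp (- (inverse t * inverse (real n)))) \<longlonglongrightarrow> exp (- (inverse t * 0))"
    by (intro tendsto_intros lim_inverse_n)
  moreover have "\<forall>\<^sub>F n in sequentially. exp (- (inverse t * inverse (real n))) = flat (real n * t)"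
    using eventually_gt_at_top[of 0] by eventually_elim (use True in \<open>auto simp: flat_def field_simps\<close>)
  ultimately show ?thesis using True by (auto intro: Lim_transform_eventually)
next
  case False
  then have "flat (real n * t) = 0" for n by (auto simp: flat_def zero_less_mult_iff)
  then show ?thesis using False by simp
qed

lemma bump_tendsto_indicator: "(\<lambda>n. bump n a b x) \<longlonglongrightarrow> indicator {a<..<b} x"
proof -
  have "(\<lambda>n. bump n a b x) \<longlonglongrightarrow> (if x - a > 0 then 1 else 0) * (if b - x > 0 then 1 else 0)"
    unfolding bump_def by (intro tendsto_mult flat_scaled_tendsto)
  then show ?thesis by (simp add: indicator_def split: if_splits)
qed

definition gauss1 :: "real \<Rightarrow> real" where "gauss1 x = inverse (sqrt (2 * pi)) * exp (- x\<^sup>2 / 2)"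

lemma poly_gauss1_DERIV:
  "((\<lambda>x. poly q x * gauss1 x) has_real_derivative poly (pderiv q - [:0, 1:] * q) x * gauss1 x) (at x)"
proof -
  have "(gauss1 has_real_derivative - x * gauss1 x) (at x)"
    unfolding gauss1_def[abs_def] by (rule derivative_eq_intros | simp)+
  then show ?thesis
    by (auto intro!: derivative_eq_intros poly_DERIV simp: algebra_simps)
qed

text \<open>The polynomials are, up to sign, the Hermite polynomials.\<close>
lemma gauss1_higher_deriv: "\<exists>q. (deriv ^^ n) gauss1 = (\<lambda>x. poly q x * gauss1 x)"
proof (induction n)
  case 0
  show ?case by (auto intro!: exI[of _ 1])
next
  case (Suc n)
  then obtain q where q: "(deriv ^^ n) gauss1 = (\<lambda>x. poly q x * gauss1 x)" by blast
  from poly_gauss1_DERIV have "deriv (\<lambda>x. poly q x * gauss1 x) = (\<lambda>x. poly (pderiv q - [:0, 1:] * q) x * gauss1 x)"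
    by (intro ext DERIV_imp_deriv)
  then show ?case unfolding funpow.simps o_def q by blast
qed

lemma smooth1_gauss1: "smooth1 gauss1"
proof (rule smooth1_closed_family)
  show "gauss1 \<in> range (\<lambda>q x. poly q x * gauss1 x)" by (rule range_eqI[of _ _ 1]) auto
  fix w assume "w \<in> range (\<lambda>q x. poly q x * gauss1 x)"
  then obtain q where w: "w = (\<lambda>x. poly q x * gauss1 x)" by blast
  from poly_gauss1_DERIV[of q] show "\<exists>w'\<in>range (\<lambda>q x. poly q x * gauss1 x). \<forall>x. (w has_real_derivative w' x) (at x)"
    unfolding w by (intro bexI[OF _ rangeI[of _ "pderiv q - [:0, 1:] * q"]] allI)
qed

text \<open>Each power \<open>x\<^sup>2\<^sup>i\<close> is controlled by a single term of the exponential series of \<open>e x\<^sup>2\<close>; for \<open>|x| > 1\<close> it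
  dominates \<open>|x|\<^sup>i\<close>.\<close>
lemma poly_le_exp_square:
  assumes "e > 0"
  shows "\<exists>C. \<forall>x::real. \<bar>poly q x\<bar> \<le> C * exp (e * x\<^sup>2)"
proof -
  have "\<exists>C. \<forall>x::real. \<bar>x ^ i\<bar> \<le> C * exp (e * x\<^sup>2)" for i
  proof -
    have "\<bar>x ^ i\<bar> \<le> (1 + fact i / e ^ i) * exp (e * x\<^sup>2)" for x :: real
    proof (cases "\<bar>x\<bar> \<le> 1")
      case True
      then have "\<bar>x ^ i\<bar> \<le> 1" by (simp add: power_abs power_le_one)
      also have "1 \<le> (1 + fact i / e ^ i) * exp (e * x\<^sup>2)"
        using mult_mono[of 1 "1 + fact i / e ^ i" 1 "exp (e * x\<^sup>2)"] assms by (simp add: )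
      finally show ?thesis .
    next
      case False
      have "\<bar>x ^ i\<bar> = \<bar>x\<bar> ^ i" by (simp add: power_abs)
      also have "\<dots> \<le> \<bar>x\<bar> ^ (2 * i)" using False by (intro power_increasing) auto
      also have "\<dots> = (x\<^sup>2) ^ i" by (simp add: power_mult)
      also have "(x\<^sup>2) ^ i = (fact i / e ^ i) * ((e * x\<^sup>2) ^ i / fact i)"
        using assms by (simp add: power_mult_distrib)
      also have "\<dots> \<le> (fact i / e ^ i) * exp (e * x\<^sup>2)"
      proof (rule mult_left_mono)
        have "(\<Sum>j\<in>{i}. (e * x\<^sup>2) ^ j /\<^sub>R fact j) \<le> exp (e * x\<^sup>2)"
          unfolding exp_def using assms
          by (intro sum_le_suminf summable_exp_generic) auto
        then show "(e * x\<^sup>2) ^ i / fact i \<le> exp (e * x\<^sup>2)" by (simp add: divide_inverse mult.commute)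
        show "0 \<le> fact i / e ^ i" using assms by simp
      qed
      also have "\<dots> \<le> (1 + fact i / e ^ i) * exp (e * x\<^sup>2)"
        by (intro mult_right_mono) auto
      finally show ?thesis .
    qed
    then show ?thesis by blast
  qed
  then obtain C where C: "\<And>i x. \<bar>x ^ i\<bar> \<le> C i * exp (e * x\<^sup>2)" for x :: real by metis
  have "\<bar>poly q x\<bar> \<le> (\<Sum>i\<le>degree q. \<bar>coeff q i\<bar> * C i) * exp (e * x\<^sup>2)" for x
  proof -
    have "\<bar>poly q x\<bar> \<le> (\<Sum>i\<le>degree q. \<bar>coeff q i * x ^ i\<bar>)"
      unfolding poly_altdef by (rule sum_abs)
    also have "\<dots> \<le> (\<Sum>i\<le>degree q. \<bar>coeff q i\<bar> * (C i * exp (e * x\<^sup>2)))"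
      using C by (intro sum_mono) (simp add: abs_mult mult_left_mono del: power_abs)
    finally show ?thesis by (simp add: sum_distrib_right mult.assoc)
  qed
  then show ?thesis by blast
qed

text \<open>An arbitrarily small part of the exponent absorbs the polynomial factor.\<close>
lemma gauss1_higher_deriv_bound:
  assumes "e > 0"
  shows "\<exists>C. \<forall>x. \<bar>(deriv ^^ n) gauss1 x\<bar> \<le> C * exp (- (1 / 2 - e) * x\<^sup>2)"
proof -
  obtain q where q: "(deriv ^^ n) gauss1 = (\<lambda>x. poly q x * gauss1 x)" using gauss1_higher_deriv by blast
  obtain C where C: "\<And>x. \<bar>poly q x\<bar> \<le> C * exp (e * x\<^sup>2)" using poly_le_exp_square[OF assms] by blast
  have "\<bar>(deriv ^^ n) gauss1 x\<bar> \<le> C * exp (- (1 / 2 - e) * x\<^sup>2)" for x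
  proof -
    have "\<bar>(deriv ^^ n) gauss1 x\<bar> \<le> (C * exp (e * x\<^sup>2)) * gauss1 x"
      using C[of x] by (simp add: q abs_mult gauss1_def mult_right_mono divide_right_mono)
    also have "gauss1 x \<le> exp (- x\<^sup>2 / 2)"
    proof -
      have "1 \<le> sqrt (2 * pi)" using pi_gt3 by simp
      then have "inverse (sqrt (2 * pi)) \<le> 1" by (rule inverse_le_1_iff[THEN iffD2, OF disjI2])
      then show ?thesis unfolding gauss1_def by (intro mult_left_le_one_le) auto
    qed
    finally have "\<bar>(deriv ^^ n) gauss1 x\<bar> \<le> C * (exp (e * x\<^sup>2) * exp (- x\<^sup>2 / 2))"
      using C[of 0] by (simp add: mult_left_mono mult.assoc)
    also have "exp (e * x\<^sup>2) * exp (- x\<^sup>2 / 2) = exp (- (1 / 2 - e) * x\<^sup>2)"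
      by (simp add: algebra_simps flip: exp_add)
    finally show ?thesis .
  qed
  then show ?thesis by blast
qed

section \<open>Smooth functions of several variables\<close>

lemma partial_deriv_eq:
  assumes "(f has_derivative f') (at x)"
  shows "partial_deriv i f x = f' (axis i 1)"
proof -
  have "((\<lambda>t. f (x + t *\<^sub>R axis i 1)) has_derivative (\<lambda>t. f' (t *\<^sub>R axis i 1))) (at 0)"
    by (rule has_derivative_compose[of "\<lambda>t. x + t *\<^sub>R axis i 1" "\<lambda>t. t *\<^sub>R axis i 1"])
       (use assms in \<open>auto intro!: derivative_eq_intros\<close>)
  moreover have "(\<lambda>t. f' (t *\<^sub>R axis i 1)) = (\<lambda>t. f' (axis i 1) * t)"
    using has_derivative_linear[OF assms] by (auto simp: linear_cmul)
  ultimately show ?thesis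
    unfolding partial_deriv_def by (intro DERIV_imp_deriv) (simp add: has_field_derivative_def)
qed

lemma partial_derivs_append: "partial_derivs (is @ js) f = partial_derivs is (partial_derivs js f)"
  by (induction "is") auto

text \<open>The analogue of \<open>smooth1_closed_family\<close>, now with all partial derivatives.\<close>
lemma smooth_closed_family:
  assumes "f \<in> S" "\<And>f x. f \<in> S \<Longrightarrow> f differentiable (at x)" "\<And>f i. f \<in> S \<Longrightarrow> partial_deriv i f \<in> S"
  shows "smooth f"
proof -
  have "partial_derivs is f \<in> S" for "is"
    by (induction "is") (use assms in auto)
  then show ?thesis using assms(2) by (auto simp: smooth_def)
qed

lemma smooth_differentiable: "smooth f \<Longrightarrow> f differentiable (at x)"
  unfolding smooth_def by (metis partial_derivs.simps(1))

lemma smooth_partial_derivs: "smooth f \<Longrightarrow> smooth (partial_derivs is f)"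
  unfolding smooth_def by (metis partial_derivs_append)

lemma smooth_partial_deriv: "smooth f \<Longrightarrow> smooth (partial_deriv i f)"
  using smooth_partial_derivs[of f "[i]"] by simp

lemma smooth_continuous_on: "smooth f \<Longrightarrow> continuous_on S f"
  by (meson continuous_at_imp_continuous_on differentiable_imp_continuous_within smooth_differentiable)

lemma partial_deriv_add:
  "f differentiable (at x) \<Longrightarrow> g differentiable (at x) \<Longrightarrow>
    partial_deriv i (\<lambda>x. f x + g x) x = partial_deriv i f x + partial_deriv i g x"
proof -
  assume "f differentiable (at x)" "g differentiable (at x)"
  then obtain f' g' where d: "(f has_derivative f') (at x)" "(g has_derivative g') (at x)"
    by (auto simp: differentiable_def)
  show ?thesis
    using partial_deriv_eq[OF has_derivative_add[OF d], of i] partial_deriv_eq[OF d(1), of i] partial_deriv_eq[OF d(2), of i]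
    by simp
qed

lemma partial_deriv_mult:
  assumes "f differentiable (at x)" "g differentiable (at x)"
  shows "partial_deriv i (\<lambda>x. f x * g x) x = partial_deriv i f x * g x + f x * partial_deriv i g x"
proof -
  obtain f' g' where d: "(f has_derivative f') (at x)" "(g has_derivative g') (at x)"
    using assms by (auto simp: differentiable_def)
  show ?thesis
    using partial_deriv_eq[OF has_derivative_mult[OF d], of i] partial_deriv_eq[OF d(1), of i] partial_deriv_eq[OF d(2), of i]
    by simp
qed

lemma smooth_const: "smooth (\<lambda>x. c)"
proof (rule smooth_closed_family)
  show "(\<lambda>x. c) \<in> range (\<lambda>c x. c)" by simp
next
  fix f :: "real ^ 'a \<Rightarrow> real" and i assume "f \<in> range (\<lambda>c x. c)"
  then obtain c where "f = (\<lambda>x. c)" by blast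
  then have "partial_deriv i f = (\<lambda>x. 0)"
    using partial_deriv_eq[OF has_derivative_const[of c]] by auto
  then show "partial_deriv i f \<in> range (\<lambda>c x. c)" by simp
qed auto

inductive_set smooth_product_sums :: "(real ^ 'd \<Rightarrow> real) set" where
  prod: "smooth u \<Longrightarrow> smooth v \<Longrightarrow> (\<lambda>x. u x * v x) \<in> smooth_product_sums"
| sum: "u \<in> smooth_product_sums \<Longrightarrow> v \<in> smooth_product_sums \<Longrightarrow> (\<lambda>x. u x + v x) \<in> smooth_product_sums"

lemma smooth_product_sums_differentiable:
  "f \<in> smooth_product_sums \<Longrightarrow> f differentiable (at x)"
proof (induction rule: smooth_product_sums.induct)
  case (prod u v)
  then show ?case by (intro differentiable_mult smooth_differentiable)
next
  case (sum u v)
  then show ?case by (intro differentiable_add)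
qed

lemma smooth_product_sums: assumes "f \<in> smooth_product_sums" shows "smooth f"
proof (rule smooth_closed_family[OF assms])
  fix f :: "real ^ 'a \<Rightarrow> real" and i assume "f \<in> smooth_product_sums"
  then show "partial_deriv i f \<in> smooth_product_sums"
  proof induction
    case (prod u v)
    then have "partial_deriv i (\<lambda>x. u x * v x) = (\<lambda>x. partial_deriv i u x * v x + u x * partial_deriv i v x)"
      by (intro ext partial_deriv_mult smooth_differentiable)
    then show ?case using prod by (auto intro!: smooth_product_sums.intros smooth_partial_deriv)
  next
    case (sum u v)
    then have "partial_deriv i (\<lambda>x. u x + v x) = (\<lambda>x. partial_deriv i u x + partial_deriv i v x)"
      by (intro ext partial_deriv_add smooth_product_sums_differentiable)
    then show ?case using sum by (auto intro!: smooth_product_sums.intros)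
  qed
qed (rule smooth_product_sums_differentiable)

lemma smooth_mult: "smooth u \<Longrightarrow> smooth v \<Longrightarrow> smooth (\<lambda>x. u x * v x)"
  by (intro smooth_product_sums(1)[OF smooth_product_sums.prod])

lemma smooth_add: assumes "smooth u" "smooth v" shows "smooth (\<lambda>x. u x + v x)"
proof -
  have "smooth (\<lambda>x. u x * 1 + v x * 1)"
    by (intro smooth_product_sums smooth_product_sums.intros assms smooth_const)
  then show ?thesis by simp
qed

lemma smooth_sum_list: "(\<And>y. y \<in> set ys \<Longrightarrow> smooth (F y)) \<Longrightarrow> smooth (\<lambda>x. \<Sum>y\<leftarrow>ys. F y x)"
  by (induction ys) (auto intro: smooth_add smooth_const)

lemma partial_deriv_sum_list:
  "(\<And>y. y \<in> set ys \<Longrightarrow> smooth (F y)) \<Longrightarrow>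
    partial_deriv i (\<lambda>x. \<Sum>y\<leftarrow>ys. F y x) x = (\<Sum>y\<leftarrow>ys. partial_deriv i (F y) x)"
proof (induction ys)
  case Nil
  then show ?case using partial_deriv_eq[OF has_derivative_const[of 0 "at x"]] by simp
next
  case (Cons y ys)
  have "partial_deriv i (\<lambda>x. F y x + (\<Sum>y\<leftarrow>ys. F y x)) x
     = partial_deriv i (F y) x + partial_deriv i (\<lambda>x. \<Sum>y\<leftarrow>ys. F y x) x"
    by (intro partial_deriv_add smooth_differentiable smooth_sum_list Cons.prems) auto
  then show ?case using Cons by simp
qed

lemma partial_derivs_shift:
  "partial_derivs is (\<lambda>x. \<phi> (x + c)) = (\<lambda>x. partial_derivs is \<phi> (x + c))"
  by (induction "is") (auto simp: partial_deriv_def add_ac)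

lemma smooth_shift: assumes "smooth \<phi>" shows "smooth (\<lambda>x. \<phi> (x + c))"
  unfolding smooth_def partial_derivs_shift
proof (intro allI)
  fix "is" x
  have "partial_derivs is \<phi> differentiable (at (x + c))" using assms by (simp add: smooth_def)
  then have "(partial_derivs is \<phi> \<circ> (\<lambda>x. x + c)) differentiable (at x)"
    by (intro differentiable_chain_at) auto
  then show "(\<lambda>x. partial_derivs is \<phi> (x + c)) differentiable (at x)" by (simp add: o_def)
qed

text \<open>Derivatives are local, so those of a test function live on its support.\<close>
lemma partial_derivs_zero_on_open:
  assumes "open S" "\<And>x. x \<in> S \<Longrightarrow> \<phi> x = 0" "x \<in> S"
  shows "partial_derivs is \<phi> x = 0"
  using assms(3)
proof (induction "is" arbitrary: x)
  case (Cons i "is")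
  have "(partial_derivs is \<phi> has_derivative (\<lambda>_. 0)) (at x)"
    by (rule has_derivative_transform_within_open[OF has_derivative_const[of 0] assms(1)])
       (use Cons in auto)
  then show ?case using partial_deriv_eq by fastforce
qed (use assms in auto)

lemma test_functionI:
  assumes "smooth \<phi>" "compact K" "K \<subseteq> U" "\<And>x. x \<notin> K \<Longrightarrow> \<phi> x = 0"
  shows "test_function U \<phi>"
proof -
  have "closure {x. \<phi> x \<noteq> 0} \<subseteq> K"
    using assms by (intro closure_minimal compact_imp_closed) auto
  then show ?thesis
    using assms compact_Int_closed[OF assms(2) closed_closure, of "{x. \<phi> x \<noteq> 0}"]
    by (auto simp: test_function_def inf_absorb2)
qed

lemma partial_derivs_zero_outside_support:
  assumes "test_function U \<phi>" "x \<notin> closure {x. \<phi> x \<noteq> 0}"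
  shows "partial_derivs is \<phi> x = 0"
  by (rule partial_derivs_zero_on_open[of "- closure {x. \<phi> x \<noteq> 0}"])
     (use assms(2) closure_subset[of "{x. \<phi> x \<noteq> 0}"] in auto)

lemma test_function_mult:
  assumes "test_function U \<phi>" "smooth g"
  shows "test_function U (\<lambda>x. \<phi> x * g x)"
proof (rule test_functionI)
  show "smooth (\<lambda>x. \<phi> x * g x)" using assms by (auto simp: test_function_def intro: smooth_mult)
  show "compact (closure {x. \<phi> x \<noteq> 0})" "closure {x. \<phi> x \<noteq> 0} \<subseteq> U"
    using assms by (auto simp: test_function_def)
qed (use closure_subset[of "{x. \<phi> x \<noteq> 0}"] in auto)

section \<open>Tensor products\<close>

definition tensor :: "('d \<Rightarrow> real \<Rightarrow> real) \<Rightarrow> real ^ 'd \<Rightarrow> real" where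
  "tensor \<psi> x = (\<Prod>i\<in>UNIV. \<psi> i (x $ i))"

lemma tensor_has_derivative:
  assumes "\<And>i. smooth1 (\<psi> i)"
  shows "(tensor \<psi> has_derivative (\<lambda>y. \<Sum>i\<in>UNIV. deriv (\<psi> i) (x $ i) * y $ i * (\<Prod>j\<in>UNIV - {i}. \<psi> j (x $ j)))) (at x)"
proof -
  have "((\<lambda>x. \<psi> i (x $ i)) has_derivative (\<lambda>y. deriv (\<psi> i) (x $ i) * y $ i)) (at x)" for i
    using has_derivative_compose[OF bounded_linear_imp_has_derivative[OF bounded_linear_vec_nth]
        smooth1_DERIV[OF assms, unfolded has_field_derivative_def]] .
  then show ?thesis unfolding tensor_def[abs_def] by (intro has_derivative_prod)
qed

lemma partial_deriv_tensor:
  assumes "\<And>i. smooth1 (\<psi> i)"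
  shows "partial_deriv i (tensor \<psi>) = tensor (\<psi>(i := deriv (\<psi> i)))"
proof
  fix x
  have "partial_deriv i (tensor \<psi>) x = (\<Sum>k\<in>UNIV. (if k = i then deriv (\<psi> k) (x $ k) * (\<Prod>j\<in>UNIV - {k}. \<psi> j (x $ j)) else 0))"
    unfolding partial_deriv_eq[OF tensor_has_derivative[OF assms]]
    by (intro sum.cong) (auto simp: axis_def)
  also have "\<dots> = deriv (\<psi> i) (x $ i) * (\<Prod>j\<in>UNIV - {i}. \<psi> j (x $ j))" by simp
  also have "\<dots> = tensor (\<psi>(i := deriv (\<psi> i))) x"
    unfolding tensor_def by (subst (2) prod.remove[of _ i]) (auto intro!: prod.cong)
  finally show "partial_deriv i (tensor \<psi>) x = tensor (\<psi>(i := deriv (\<psi> i))) x" .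
qed

lemma smooth_tensor:
  assumes "\<And>i. smooth1 (\<psi> i)"
  shows "smooth (tensor \<psi>)"
proof (rule smooth_closed_family)
  let ?S = "{tensor \<psi> | \<psi>. \<forall>i. smooth1 (\<psi> i)}"
  show "tensor \<psi> \<in> ?S" using assms by blast
  fix f i x assume "f \<in> ?S"
  then obtain \<psi> where f: "f = tensor \<psi>" "\<And>i. smooth1 (\<psi> i)" by blast
  show "f differentiable (at x)"
    using tensor_has_derivative[of \<psi> x] f by (auto simp: differentiable_def)
  have "\<forall>j. smooth1 ((\<psi>(i := deriv (\<psi> i))) j)" using f by (auto intro: smooth1_deriv)
  then show "partial_deriv i f \<in> ?S" unfolding f(1) partial_deriv_tensor[OF f(2)] by blast
qed

text \<open>On tensor products the order of differentiation is irrelevant: only the number of derivatives taken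
  in each variable enters.\<close>
lemma partial_derivs_tensor:
  assumes "\<And>i. smooth1 (\<psi> i)"
  shows "partial_derivs is (tensor \<psi>) = tensor (\<lambda>i. (deriv ^^ count_list is i) (\<psi> i))"
proof (induction "is")
  case (Cons i "is")
  show ?case unfolding partial_derivs.simps Cons
    by (subst partial_deriv_tensor) (auto intro!: smooth1_higher_deriv assms arg_cong[of _ _ tensor])
qed simp

lemma test_function_tensor:
  assumes "\<And>i. smooth1 (\<psi> i)" "\<And>i t. t < a $ i \<or> b $ i < t \<Longrightarrow> \<psi> i t = 0" "cbox a b \<subseteq> U"
  shows "test_function U (tensor \<psi>)"
proof (rule test_functionI[OF smooth_tensor compact_cbox])
  fix x assume "x \<notin> cbox a b"
  then obtain i where "x $ i < a $ i \<or> b $ i < x $ i" by (auto simp: mem_box_cart not_le)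
  then show "tensor \<psi> x = 0" using assms(2) by (auto simp: tensor_def)
qed (use assms in auto)

section \<open>The Leibniz formula with outer derivatives\<close>

text \<open>All ways to distribute a list of derivatives over two factors. The head of the list is appended at
  the end of the second component because it is the derivative that acts first on that factor, see
  \<open>mult_partial_derivs_expand\<close>.\<close>
fun splits :: "'d list \<Rightarrow> ('d list \<times> 'd list) list" where
  "splits [] = [([], [])]"
| "splits (i # is) = map (\<lambda>(as, bs). (i # as, bs)) (splits is) @ map (\<lambda>(as, bs). (as, bs @ [i])) (splits is)"

lemma splits_count: "(as, bs) \<in> set (splits is) \<Longrightarrow> count_list as i + count_list bs i = count_list is i"
  by (induction "is" arbitrary: as bs) (auto split: if_splits)

lemma splits_length: "(as, bs) \<in> set (splits is) \<Longrightarrow> length as + length bs = length is"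
  by (induction "is" arbitrary: as bs) auto

text \<open>Iterating \<open>g \<partial>\<^sub>i\<psi> = \<partial>\<^sub>i(g \<psi>) - (\<partial>\<^sub>ig) \<psi>\<close> moves the factor \<open>g\<close> inside the derivatives. In this form every
  summand is a derivative of a test function \<open>\<phi> \<partial>\<^sup>bg\<close>, so a weak derivative can be applied to it.\<close>
lemma mult_partial_derivs_expand:
  assumes "smooth \<phi>" "smooth g"
  shows "g x * partial_derivs is \<phi> x =
    (\<Sum>(as, bs)\<leftarrow>splits is. (-1) ^ length bs * partial_derivs as (\<lambda>x. \<phi> x * partial_derivs bs g x) x)"
  using assms(2)
proof (induction "is" arbitrary: g x)
  case Nil
  then show ?case by simp
next
  case (Cons i "is")
  define E where "E g = (\<lambda>(as, bs) x. (-1) ^ length bs * partial_derivs as (\<lambda>x. \<phi> x * partial_derivs bs g x) x)" for g :: "real ^ 'a \<Rightarrow> real"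
  have smE: "smooth (E g y)" for y
    unfolding E_def by (cases y) (auto intro!: smooth_mult smooth_const smooth_partial_derivs assms Cons.prems)
  have IH: "g x * partial_derivs is \<phi> x = (\<Sum>y\<leftarrow>splits is. E g y x)" if "smooth g" for g x
    using Cons.IH[OF that, of x] by (simp add: E_def case_prod_beta)
  have "partial_deriv i (\<lambda>x. g x * partial_derivs is \<phi> x) x
      = partial_deriv i g x * partial_derivs is \<phi> x + g x * partial_derivs (i # is) \<phi> x"
    using Cons.prems assms by (subst partial_deriv_mult) (auto intro: smooth_differentiable smooth_partial_derivs)
  then have "g x * partial_derivs (i # is) \<phi> x
     = partial_deriv i (\<lambda>x. \<Sum>y\<leftarrow>splits is. E g y x) x - (\<Sum>y\<leftarrow>splits is. E (partial_deriv i g) y x)"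
    using IH[OF Cons.prems] IH[OF smooth_partial_deriv[OF Cons.prems]] by (simp add: fun_eq_iff)
  also have "\<dots> = (\<Sum>y\<leftarrow>splits is. partial_deriv i (E g y) x) + (\<Sum>y\<leftarrow>splits is. - E (partial_deriv i g) y x)"
    by (subst partial_deriv_sum_list) (auto simp: smE uminus_sum_list_map o_def)
  also have "(\<lambda>y. partial_deriv i (E g y) x) = (\<lambda>(as, bs). E g (i # as, bs) x)"
  proof (intro ext, clarify)
    fix as bs
    have "(\<lambda>x. \<phi> x * partial_derivs bs g x) differentiable at x" "partial_derivs as (\<lambda>x. \<phi> x * partial_derivs bs g x) differentiable at x" for x
      by (auto intro!: smooth_differentiable smooth_mult smooth_partial_derivs assms Cons.prems)
    moreover have "partial_deriv i (\<lambda>x. (-1) ^ length bs) x = (0::real)" for x :: "real ^ 'a"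
      using partial_deriv_eq[OF has_derivative_const] by blast
    ultimately show "partial_deriv i (E g (as, bs)) x = E g (i # as, bs) x"
      unfolding E_def by (simp add: partial_deriv_mult)
  qed
  also have "(\<lambda>y. - E (partial_deriv i g) y x) = (\<lambda>(as, bs). E g (as, bs @ [i]) x)"
    by (auto simp: E_def partial_derivs_append)
  finally show ?case by (simp add: E_def case_prod_beta o_def)
qed

text \<open>The weak derivative must not depend on the order of differentiation. Prepending an element to the list
  acts on \<open>G\<close> by an operator \<open>T i\<close>, and these operators commute.\<close>
lemma splits_sum_perm:
  fixes G :: "('d \<Rightarrow> nat) \<Rightarrow> ('d \<Rightarrow> nat) \<Rightarrow> 'b::comm_monoid_add"
  assumes "mset is = mset js"
  shows "(\<Sum>(as, bs)\<leftarrow>splits is. G (count_list as) (count_list bs)) =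
         (\<Sum>(as, bs)\<leftarrow>splits js. G (count_list as) (count_list bs))"
proof -
  define T :: "'d \<Rightarrow> (('d \<Rightarrow> nat) \<Rightarrow> ('d \<Rightarrow> nat) \<Rightarrow> 'b) \<Rightarrow> (('d \<Rightarrow> nat) \<Rightarrow> ('d \<Rightarrow> nat) \<Rightarrow> 'b)"
    where "T i G = (\<lambda>a b. G (a(i := Suc (a i))) b + G a (b(i := Suc (b i))))" for i G
  have comm: "T i \<circ> T j = T j \<circ> T i" for i j
    by (cases "i = j") (auto simp: T_def fun_eq_iff fun_upd_twist add_ac)
  have *: "(\<Sum>(as, bs)\<leftarrow>splits is. G (count_list as) (count_list bs)) = fold T is G (\<lambda>_. 0) (\<lambda>_. 0)" for "is" G
  proof (induction "is" arbitrary: G)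
    case Nil
    have "count_list [] = (\<lambda>_. 0)" by (rule ext) simp
    from arg_cong2[OF this this, of G] show ?case by simp
  next
    case (Cons i "is")
    have c1: "count_list (i # as) = (count_list as)(i := Suc (count_list as i))" for as by (rule ext) simp
    have c2: "count_list (bs @ [i]) = (count_list bs)(i := Suc (count_list bs i))" for bs by (rule ext) simp
    show ?case
      unfolding fold_simps Cons.IH[symmetric]
      by (simp add: o_def split_def c1 c2 T_def sum_list_addf del: count_list.simps count_list_append)
  qed
  have "fold T is = fold T js"
    by (rule fold_multiset_equiv[OF _ assms]) (rule comm)
  then show ?thesis unfolding * by simp
qed

lemma sum_count_list: "(\<Sum>i\<in>(UNIV :: 'd :: finite set). count_list is i) = length is"
  by (intro sum_count_set) auto

section \<open>Weak derivatives and test functions\<close>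

lemma absolutely_integrable_mult_continuous:
  fixes h \<psi> :: "real ^ 'd \<Rightarrow> real"
  assumes "h absolutely_integrable_on K" "compact K" "continuous_on UNIV \<psi>"
  shows "(\<lambda>x. h x * \<psi> x) absolutely_integrable_on K"
proof -
  have K: "K \<in> sets lebesgue" using assms(2) by (simp add: compact_imp_closed borel_closed)
  have "(\<lambda>x. \<psi> x * h x) absolutely_integrable_on K"
  proof (rule absolutely_integrable_bounded_measurable_product[OF bilinear_times])
    show "\<psi> \<in> borel_measurable (lebesgue_on K)"
      by (metis assms(3) continuous_imp_measurable_on_sets_lebesgue continuous_on_subset K subset_UNIV)
    show "bounded (\<psi> ` K)"
      by (metis assms(2,3) compact_continuous_image compact_imp_bounded continuous_on_subset subset_UNIV)
  qed (use assms K in auto)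
  then show ?thesis by (simp add: mult.commute)
qed

lemma integrable_mult_compact_support:
  fixes h \<psi> :: "real ^ 'd \<Rightarrow> real"
  assumes "h absolutely_integrable_on K" "compact K" "continuous_on UNIV \<psi>" "\<And>x. x \<notin> K \<Longrightarrow> \<psi> x = 0"
  shows "integrable lebesgue (\<lambda>x. h x * \<psi> x)"
proof -
  have "integrable lebesgue (\<lambda>x. indicator K x *\<^sub>R (h x * \<psi> x))"
    using absolutely_integrable_mult_continuous[OF assms(1-3)] by (simp add: set_integrable_def)
  also have "(\<lambda>x. indicator K x *\<^sub>R (h x * \<psi> x)) = (\<lambda>x. h x * \<psi> x)"
    using assms(4) by (intro ext) (auto split: split_indicator)
  finally show ?thesis .
qed

lemma integral_lebesgue_on_support:
  fixes u :: "real ^ 'd \<Rightarrow> real"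
  assumes "open U" "\<And>x. x \<notin> U \<Longrightarrow> u x = 0"
  shows "(LINT x|lebesgue_on U. u x) = (LINT x|lebesgue. u x)"
proof -
  have "(LINT x|lebesgue_on U. u x) = (LINT x|lebesgue. indicator U x *\<^sub>R u x)"
    using assms by (intro integral_restrict_space) auto
  also have "(\<lambda>x. indicator U x *\<^sub>R u x) = u" using assms(2) by (force simp: indicator_def)
  finally show ?thesis .
qed

lemma test_functionD:
  assumes "test_function U \<phi>"
  obtains K where "compact K" "K \<subseteq> U" "\<And>x is. x \<notin> K \<Longrightarrow> partial_derivs is \<phi> x = 0"
    "\<And>x. x \<notin> K \<Longrightarrow> \<phi> x = 0" "\<And>is. continuous_on UNIV (partial_derivs is \<phi>)"
    "continuous_on UNIV \<phi>"
proof (rule that[of "closure {x. \<phi> x \<noteq> 0}"])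
  fix x assume "x \<notin> closure {x. \<phi> x \<noteq> 0}"
  then show "\<phi> x = 0" using closure_subset[of "{x. \<phi> x \<noteq> 0}"] by auto
next
  have "smooth \<phi>" using assms by (simp add: test_function_def)
  then show "continuous_on UNIV (partial_derivs is \<phi>)" "continuous_on UNIV \<phi>" for "is"
    by (intro smooth_continuous_on smooth_partial_derivs; assumption)+
qed (use assms partial_derivs_zero_outside_support[OF assms] in \<open>auto simp: test_function_def\<close>)

text \<open>Test functions and their derivatives vanish outside the domain, so the defining identity may be read
  over the whole space.\<close>
lemma has_weak_deriv_iff:
  assumes U: "open U"
  shows "has_weak_deriv U r f h \<longleftrightarrow>
     (\<forall>K. compact K \<and> K \<subseteq> U \<longrightarrow> f absolutely_integrable_on K \<and> h absolutely_integrable_on K) \<and>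
     (\<forall>\<phi> is. test_function U \<phi> \<and> count_list is = r \<longrightarrow>
        (LINT x|lebesgue. f x * partial_derivs is \<phi> x) =
        (-1) ^ length is * (LINT x|lebesgue. h x * \<phi> x))"
proof -
  have "(LINT x|lebesgue_on U. f x * partial_derivs is \<phi> x) = (LINT x|lebesgue. f x * partial_derivs is \<phi> x)"
    "(LINT x|lebesgue_on U. h x * \<phi> x) = (LINT x|lebesgue. h x * \<phi> x)"
    if \<phi>: "test_function U \<phi>" for \<phi> "is"
  proof -
    obtain K where K: "K \<subseteq> U" "\<And>x is. x \<notin> K \<Longrightarrow> partial_derivs is \<phi> x = 0"
      "\<And>x. x \<notin> K \<Longrightarrow> \<phi> x = 0" using test_functionD[OF \<phi>] by metis
    show "(LINT x|lebesgue_on U. f x * partial_derivs is \<phi> x) = (LINT x|lebesgue. f x * partial_derivs is \<phi> x)"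
      "(LINT x|lebesgue_on U. h x * \<phi> x) = (LINT x|lebesgue. h x * \<phi> x)"
      by (rule integral_lebesgue_on_support[OF U], use K in force)+
  qed
  moreover have "(\<forall>i. count_list is i = r i) \<longleftrightarrow> count_list is = r" for "is" by (simp add: fun_eq_iff)
  moreover have "(\<Sum>i\<in>UNIV. r i) = length is" if "count_list is = r" for "is"
    using sum_count_list[of "is"] that by simp
  ultimately show ?thesis
    unfolding has_weak_deriv_def
    by (intro arg_cong2[where f = "(\<and>)"] refl iff_allI imp_cong) auto
qed

section \<open>Functions whose integrals against bumps vanish\<close>

text \<open>The positive and the negative part of \<open>v\<close> are densities of two measures that agree on boxes. Boxes are
  stable under intersection and generate the Borel sets, so the measures and their densities agree.\<close>
lemma AE_zero_if_box_integrals_zero_lborel: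
  fixes v :: "'a::euclidean_space \<Rightarrow> real"
  assumes v: "integrable lborel v" and 0: "\<And>a b. (LINT x|lborel. indicator (box a b) x * v x) = 0"
  shows "AE x in lborel. v x = 0"
proof -
  have [measurable]: "v \<in> borel_measurable borel" using v by simp
  let ?p = "\<lambda>x. ennreal (v x)" and ?n = "\<lambda>x. ennreal (- v x)"
  have "density lborel ?p = density lborel ?n"
  proof (rule measure_eqI_generator_eq)
    let ?E = "range (\<lambda>(a, b). box a b::'a set)"
    show "Int_stable ?E"
      by (auto simp: Int_stable_def box_Int_box)
    show "?E \<subseteq> Pow UNIV" "sets (density lborel ?p) = sigma_sets UNIV ?E" "sets (density lborel ?n) = sigma_sets UNIV ?E"
      by (simp_all add: borel_eq_box)
    let ?A = "\<lambda>n::nat. box (- (real n *\<^sub>R One)) (real n *\<^sub>R One) :: 'a set"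
    show "range ?A \<subseteq> ?E" by auto
    show "(\<Union>i. ?A i) = UNIV"
      by (rule UN_box_eq_UNIV)
    have eq: "emeasure (density lborel ?p) (box a b) = emeasure (density lborel ?n) (box a b)
            \<and> emeasure (density lborel ?p) (box a b) \<noteq> \<infinity>" for a b
    proof -
      have i: "integrable lborel (\<lambda>x. indicator (box a b) x * v x)"
        by (rule Bochner_Integration.integrable_bound[OF v]) (auto simp: indicator_def)
      have "emeasure (density lborel ?p) (box a b) = (\<integral>\<^sup>+x. ennreal (indicator (box a b) x * v x) \<partial>lborel)"
        by (subst emeasure_density) (auto intro!: nn_integral_cong simp: indicator_def)
      moreover have "emeasure (density lborel ?n) (box a b) = (\<integral>\<^sup>+x. ennreal (- (indicator (box a b) x * v x)) \<partial>lborel)"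
        by (subst emeasure_density) (auto intro!: nn_integral_cong simp: indicator_def)
      moreover have "(\<integral>\<^sup>+x. ennreal (indicator (box a b) x * v x) \<partial>lborel) \<noteq> \<infinity>"
        "(\<integral>\<^sup>+x. ennreal (- (indicator (box a b) x * v x)) \<partial>lborel) \<noteq> \<infinity>"
        using i by (auto simp: real_integrable_def)
      moreover have "enn2real (\<integral>\<^sup>+x. ennreal (indicator (box a b) x * v x) \<partial>lborel)
          = enn2real (\<integral>\<^sup>+x. ennreal (- (indicator (box a b) x * v x)) \<partial>lborel)"
        using real_lebesgue_integral_def[OF i] 0[of a b] by simp
      ultimately show ?thesis
        by (metis ennreal_enn2real infinity_ennreal_def less_top)
    qed
    show "emeasure (density lborel ?p) (?A i) \<noteq> \<infinity>" for i
      using eq by blast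
    show "emeasure (density lborel ?p) X = emeasure (density lborel ?n) X" if "X \<in> ?E" for X
      using that eq by auto
  qed
  then have "AE x in lborel. ?p x = ?n x"
    by (intro sigma_finite_measure.density_unique[OF lborel.sigma_finite_measure_axioms]) auto
  then show ?thesis
  proof eventually_elim
    case (elim x)
    then show ?case
      by (cases "v x \<ge> 0") (auto simp: ennreal_neg)
  qed
qed

text \<open>The preceding lemma, localised to a closed box and transferred to Lebesgue measurable functions.\<close>
lemma AE_zero_if_box_integrals_zero:
  fixes h :: "'a::euclidean_space \<Rightarrow> real"
  assumes h: "h absolutely_integrable_on cbox c d"
    and 0: "\<And>a b. cbox a b \<subseteq> cbox c d \<Longrightarrow> (LINT x|lebesgue. indicator (box a b) x * h x) = 0"
  shows "AE x in lebesgue. x \<in> cbox c d \<longrightarrow> h x = 0"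
proof -
  define u where "u = (\<lambda>x. indicator (cbox c d) x * h x)"
  have u: "integrable lebesgue u" using h by (simp add: u_def set_integrable_def)
  then obtain v where v: "v \<in> borel_measurable lborel" and ae: "AE x in lborel. u x = v x"
    using completion_ex_borel_measurable_real[of u lborel] by auto
  have ae': "AE x in lebesgue. u x = v x" using ae by (rule AE_completion)
  have v': "v \<in> borel_measurable lebesgue" using v by (rule measurable_completion)
  have "integrable lebesgue v"
    using integrable_cong_AE[of u lebesgue v] u ae' v' by auto
  then have iv: "integrable lborel v" using v integrable_completion by blast
  have [measurable]: "v \<in> borel_measurable borel" using v by simp
  have "(LINT x|lborel. indicator (box a b) x * v x) = 0" for a b
  proof -
    let ?a = "\<Sum>i\<in>Basis. max (a \<bullet> i) (c \<bullet> i) *\<^sub>R i" and ?b = "\<Sum>i\<in>Basis. min (b \<bullet> i) (d \<bullet> i) *\<^sub>R i"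
    have "(LINT x|lborel. indicator (box a b) x * v x) = (LINT x|lebesgue. indicator (box a b) x * v x)"
      by (intro integral_completion[symmetric]) simp
    also have "\<dots> = (LINT x|lebesgue. indicator (box ?a ?b) x * h x)"
    proof (rule integral_cong_AE)
      show "(\<lambda>x. indicator (box a b) x * v x) \<in> borel_measurable lebesgue"
        using v' by (intro borel_measurable_times borel_measurable_indicator) auto
      have "(\<lambda>x. indicator (box ?a ?b) x * u x) = (\<lambda>x. indicator (box ?a ?b) x * h x)"
        using box_subset_cbox[of c d] unfolding box_Int_box[symmetric] u_def
        by (intro ext) (auto split: split_indicator)
      moreover have "(\<lambda>x. indicator (box ?a ?b) x * u x) \<in> borel_measurable lebesgue"
        using borel_measurable_integrable[OF u] by (intro borel_measurable_times borel_measurable_indicator) auto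
      ultimately show "(\<lambda>x. indicator (box ?a ?b) x * h x) \<in> borel_measurable lebesgue" by simp
      have "AE x in lebesgue. x \<notin> cbox c d - box c d"
        using negligible_frontier_interval[of c d] by (intro AE_not_in) (simp add: negligible_iff_null_sets)
      with ae' show "AE x in lebesgue. indicator (box a b) x * v x = indicator (box ?a ?b) x * h x"
        unfolding box_Int_box[symmetric]
        by eventually_elim (use box_subset_cbox[of c d] in \<open>auto simp: u_def split: split_indicator_asm split_indicator\<close>)
    qed
    also have "\<dots> = 0"
      by (rule 0) (simp flip: Int_interval)
    finally show ?thesis .
  qed
  from AE_zero_if_box_integrals_zero_lborel[OF iv this] have "AE x in lebesgue. v x = 0"
    by (rule AE_completion)
  with ae' show ?thesis
    by eventually_elim (auto simp: u_def indicator_def)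
qed

text \<open>An open set is a countable union of closed boxes.\<close>
lemma AE_on_open_if_AE_on_cboxes:
  fixes U :: "'a::euclidean_space set"
  assumes "open U" "\<And>c d. cbox c d \<subseteq> U \<Longrightarrow> AE x in lebesgue. x \<in> cbox c d \<longrightarrow> P x"
  shows "AE x in lebesgue. x \<in> U \<longrightarrow> P x"
proof -
  obtain \<D> where D: "countable \<D>" "\<D> \<subseteq> Pow U" "\<And>X. X \<in> \<D> \<Longrightarrow> \<exists>a b. X = cbox a b" "\<Union>\<D> = U"
    using open_countable_Union_open_cbox[OF assms(1)] by blast
  have "AE x in lebesgue. \<forall>X\<in>\<D>. x \<in> X \<longrightarrow> P x"
  proof (rule AE_ball_countable'[OF _ D(1)])
    fix X assume "X \<in> \<D>"
    then obtain a b where "X = cbox a b" "cbox a b \<subseteq> U" using D(2,3) by blast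
    then show "AE x in lebesgue. x \<in> X \<longrightarrow> P x" using assms(2) by simp
  qed
  then show ?thesis by eventually_elim (use D(4) in blast)
qed

abbreviation box_bump :: "nat \<Rightarrow> real ^ 'd \<Rightarrow> real ^ 'd \<Rightarrow> real ^ 'd \<Rightarrow> real" where
  "box_bump n a b \<equiv> tensor (\<lambda>i. bump n (a $ i) (b $ i))"

lemma tensor_continuous_on:
  "(\<And>i. smooth1 (\<psi> i)) \<Longrightarrow> continuous_on S (tensor \<psi>)"
  by (intro smooth_continuous_on smooth_tensor)

lemma box_bump_outside: "x \<notin> box a b \<Longrightarrow> box_bump n a b x = 0"
  unfolding mem_box_cart tensor_def by (metis UNIV_I bump_eq_0 finite not_less prod_zero)

lemma box_bump_tendsto: "(\<lambda>n. box_bump n a b x) \<longlonglongrightarrow> indicator (box a b) x"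
proof -
  have "(\<lambda>n. box_bump n a b x) \<longlonglongrightarrow> (\<Prod>i\<in>UNIV. indicator {a $ i<..<b $ i} (x $ i))"
    unfolding tensor_def by (intro tendsto_prod bump_tendsto_indicator)
  also have "(\<Prod>i\<in>UNIV. indicator {a $ i<..<b $ i} (x $ i)) = (indicator (box a b) x :: real)"
    by (auto simp: indicator_def mem_box_cart intro: prod_zero)
  finally show ?thesis .
qed

lemma box_bump_bounds: "0 \<le> box_bump n a b x" "box_bump n a b x \<le> 1"
  unfolding tensor_def by (auto intro!: prod_nonneg prod_le_1 simp: bump_bounds)

text \<open>The fundamental lemma of the calculus of variations. Steepening the bumps turns them into indicators
  of boxes, by dominated convergence.\<close>
lemma AE_zero_if_bump_integrals_zero:
  fixes h :: "real ^ 'd \<Rightarrow> real"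
  assumes U: "open U" and loc: "\<And>K. compact K \<Longrightarrow> K \<subseteq> U \<Longrightarrow> h absolutely_integrable_on K"
    and 0: "\<And>n a b. cbox a b \<subseteq> U \<Longrightarrow> (LINT x|lebesgue. h x * box_bump n a b x) = 0"
  shows "AE x in lebesgue. x \<in> U \<longrightarrow> h x = 0"
proof (rule AE_on_open_if_AE_on_cboxes[OF U])
  fix c d assume cd: "cbox c d \<subseteq> U"
  show "AE x in lebesgue. x \<in> cbox c d \<longrightarrow> h x = 0"
  proof (rule AE_zero_if_box_integrals_zero)
    show "h absolutely_integrable_on cbox c d" using loc cd by simp
    fix a b :: "real ^ 'd" assume "cbox a b \<subseteq> cbox c d"
    then have ab: "cbox a b \<subseteq> U" using cd by blast
    let ?u = "\<lambda>x. indicator (cbox a b) x * h x"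
    have u: "integrable lebesgue ?u"
      using loc[OF compact_cbox ab] by (simp add: set_integrable_def)
    have eq: "h x * box_bump n a b x = ?u x * box_bump n a b x" for x n
      using box_bump_outside[of x a b n] box_subset_cbox[of a b] by (auto simp: indicator_def)
    have [measurable]: "box_bump n a b \<in> borel_measurable lebesgue" for n
      by (intro measurable_completion) (auto intro!: borel_measurable_continuous_onI tensor_continuous_on smooth1_bump)
    have "(\<lambda>n. LINT x|lebesgue. ?u x * box_bump n a b x) \<longlonglongrightarrow> (LINT x|lebesgue. ?u x * indicator (box a b) x)"
    proof (rule integral_dominated_convergence[where w = "\<lambda>x. \<bar>?u x\<bar>"])
      show "AE x in lebesgue. (\<lambda>n. ?u x * box_bump n a b x) \<longlonglongrightarrow> ?u x * indicator (box a b) x"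
        by (intro AE_I2 tendsto_mult_left box_bump_tendsto)
      show "AE x in lebesgue. norm (?u x * box_bump n a b x) \<le> \<bar>?u x\<bar>" for n
        using box_bump_bounds[of n a b] by (intro AE_I2) (auto simp: abs_mult intro!: mult_left_le)
      show "(\<lambda>x. ?u x * indicator (box a b) x) \<in> borel_measurable lebesgue"
        "(\<lambda>x. ?u x * box_bump n a b x) \<in> borel_measurable lebesgue" for n
        using borel_measurable_times[OF borel_measurable_integrable[OF u], of "indicator (box a b)"]
          borel_measurable_times[OF borel_measurable_integrable[OF u], of "box_bump n a b"]
        by (simp_all add: borel_measurable_indicator)
      show "integrable lebesgue (\<lambda>x. \<bar>?u x\<bar>)" using u by (rule integrable_abs)
    qed
    moreover have "(\<lambda>x. ?u x * indicator (box a b) x) = (\<lambda>x. indicator (box a b) x * h x)"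
      using box_subset_cbox[of a b] by (intro ext) (auto split: split_indicator)
    ultimately show "(LINT x|lebesgue. indicator (box a b) x * h x) = 0"
      using 0[OF ab] by (simp add: eq[symmetric] LIMSEQ_const_iff)
  qed
qed

lemma test_function_box_bump: "cbox a b \<subseteq> U \<Longrightarrow> test_function U (box_bump n a b)"
  by (intro test_function_tensor[of _ a b]) (auto simp: smooth1_bump bump_eq_0)

lemma exists_list_with_counts:
  fixes r :: "'d::finite \<Rightarrow> nat"
  shows "\<exists>is. count_list is = r"
proof -
  obtain xs where xs: "set xs = (UNIV :: 'd set)" "distinct xs" using finite_distinct_list[OF finite] by metis
  have rep: "count_list (replicate n i) j = (if i = j then n else 0)" for n and i j :: 'd
    by (induction n) auto
  have "count_list (concat (map (\<lambda>i. replicate (r i) i) ys)) j = (if j \<in> set ys then r j else 0)"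
    if "distinct ys" for ys j
    using that by (induction ys) (auto simp: rep)
  then have "count_list (concat (map (\<lambda>i. replicate (r i) i) xs)) = r"
    using xs by (intro ext) simp
  then show ?thesis by blast
qed

lemma has_weak_deriv_absolutely_integrable:
  assumes "has_weak_deriv U r f h" "compact K" "K \<subseteq> U"
  shows "f absolutely_integrable_on K" "h absolutely_integrable_on K"
  using assms by (auto simp: has_weak_deriv_def)

lemma integrable_mult_test_function:
  assumes "\<And>K. compact K \<Longrightarrow> K \<subseteq> U \<Longrightarrow> h absolutely_integrable_on K" "test_function U \<phi>"
  shows "integrable lebesgue (\<lambda>x. h x * partial_derivs is \<phi> x)"
proof -
  obtain K where "compact K" "K \<subseteq> U" "\<And>x is. x \<notin> K \<Longrightarrow> partial_derivs is \<phi> x = 0"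
    "\<And>is. continuous_on UNIV (partial_derivs is \<phi>)"
    using test_functionD[OF assms(2)] by metis
  then show ?thesis using assms(1) by (intro integrable_mult_compact_support)
qed

lemma has_weak_derivD:
  assumes "open U" "has_weak_deriv U r f h" "test_function U \<phi>" "count_list is = r"
  shows "(LINT x|lebesgue. f x * partial_derivs is \<phi> x) = (-1) ^ length is * (LINT x|lebesgue. h x * \<phi> x)"
  using assms(2-) unfolding has_weak_deriv_iff[OF assms(1)] by blast

text \<open>\<open>weak_deriv\<close> selects some weak derivative; this lemma lets one compute with any other.\<close>
lemma has_weak_deriv_unique:
  fixes h h' :: "real ^ 'd \<Rightarrow> real"
  assumes U: "open U" and h: "has_weak_deriv U r f h" "has_weak_deriv U r f h'"
  shows "AE x in lebesgue. x \<in> U \<longrightarrow> h x = h' x"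
proof -
  obtain "is" where cnt: "count_list is = r" using exists_list_with_counts by blast
  have "AE x in lebesgue. x \<in> U \<longrightarrow> h x - h' x = 0"
  proof (rule AE_zero_if_bump_integrals_zero[OF U])
    show "(\<lambda>x. h x - h' x) absolutely_integrable_on K" if "compact K" "K \<subseteq> U" for K
      using that has_weak_deriv_absolutely_integrable[OF h(1)] has_weak_deriv_absolutely_integrable[OF h(2)]
      by (intro set_integral_diff) auto
    fix n and a b :: "real ^ 'd" assume ab: "cbox a b \<subseteq> U"
    let ?\<phi> = "box_bump n a b"
    have i: "integrable lebesgue (\<lambda>x. h x * ?\<phi> x)" "integrable lebesgue (\<lambda>x. h' x * ?\<phi> x)"
      using integrable_mult_test_function[OF _ test_function_box_bump[OF ab], of _ "[]" n]
        has_weak_deriv_absolutely_integrable[OF h(1)] has_weak_deriv_absolutely_integrable[OF h(2)] by auto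
    have "(-1) ^ length is * (LINT x|lebesgue. h x * ?\<phi> x) = (-1) ^ length is * (LINT x|lebesgue. h' x * ?\<phi> x)"
      unfolding has_weak_derivD[OF U h(1) test_function_box_bump[OF ab] cnt, symmetric]
      by (rule has_weak_derivD[OF U h(2) test_function_box_bump[OF ab] cnt])
    then have "(LINT x|lebesgue. h x * ?\<phi> x) = (LINT x|lebesgue. h' x * ?\<phi> x)" by simp
    then show "(LINT x|lebesgue. (h x - h' x) * ?\<phi> x) = 0"
      using i by (simp add: left_diff_distrib)
  qed
  then show ?thesis by simp
qed

section \<open>Bumps integrated over orthants\<close>

lemma prod_Basis_axis_index:
  "(\<Prod>b\<in>(Basis :: (real ^ 'd) set). m (axis_index b)) = prod m UNIV"
  by (simp add: Basis_vec_def UNION_singleton_eq_range prod.reindex axis_eq_axis inj_on_def)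

text \<open>Tonelli for tensor products.\<close>
lemma integral_tensor_nonneg:
  fixes \<psi> :: "'d::finite \<Rightarrow> real \<Rightarrow> real"
  assumes i: "\<And>i. integrable lborel (\<psi> i)" and nonneg: "\<And>i t. 0 \<le> \<psi> i t"
  shows "(LINT x|lborel. tensor \<psi> x) = (\<Prod>i\<in>UNIV. LINT t|lborel. \<psi> i t)"
    and "integrable lborel (tensor \<psi>)"
proof -
  have [measurable]: "\<psi> i \<in> borel_measurable borel" for i using i[of i] by simp
  have [measurable]: "tensor \<psi> \<in> borel_measurable borel"
    unfolding tensor_def[abs_def] by measurable
  have inner: "x \<bullet> b = x $ axis_index b" if "b \<in> Basis" for x b :: "real ^ 'd"
    using that by (auto simp: Basis_vec_def axis_index_axis cart_eq_inner_axis)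
  have "(\<integral>\<^sup>+x. ennreal (tensor \<psi> x) \<partial>lborel) = (\<integral>\<^sup>+x. (\<Prod>b\<in>(Basis :: (real ^ 'd) set). ennreal (\<psi> (axis_index b) (x \<bullet> b))) \<partial>lborel)"
  proof (rule nn_integral_cong)
    fix x :: "real ^ 'd"
    have "ennreal (tensor \<psi> x) = (\<Prod>i\<in>UNIV. ennreal (\<psi> i (x $ i)))"
      unfolding tensor_def by (simp add: prod_ennreal nonneg)
    also have "\<dots> = (\<Prod>b\<in>(Basis :: (real ^ 'd) set). ennreal (\<psi> (axis_index b) (x $ axis_index b)))"
      by (rule prod_Basis_axis_index[symmetric])
    finally show "ennreal (tensor \<psi> x) = (\<Prod>b\<in>(Basis :: (real ^ 'd) set). ennreal (\<psi> (axis_index b) (x \<bullet> b)))"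
      by (simp add: inner cong: prod.cong)
  qed
  also have "\<dots> = (\<Prod>b\<in>(Basis :: (real ^ 'd) set). \<integral>\<^sup>+t. ennreal (\<psi> (axis_index b) t) \<partial>lborel)"
    by (rule nn_integral_lborel_prod) auto
  also have "\<dots> = (\<Prod>i\<in>UNIV. \<integral>\<^sup>+t. ennreal (\<psi> i t) \<partial>lborel)"
    by (rule prod_Basis_axis_index)
  also have "\<dots> = (\<Prod>i\<in>UNIV. ennreal (LINT t|lborel. \<psi> i t))"
    using i nonneg by (intro prod.cong) (auto intro!: nn_integral_eq_integral)
  also have "\<dots> = ennreal (\<Prod>i\<in>UNIV. LINT t|lborel. \<psi> i t)"
    by (intro prod_ennreal integral_nonneg_AE) (simp add: nonneg)
  finally have *: "(\<integral>\<^sup>+x. ennreal (tensor \<psi> x) \<partial>lborel) = ennreal (\<Prod>i\<in>UNIV. LINT t|lborel. \<psi> i t)" .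
  have "(LINT x|lborel. tensor \<psi> x) = enn2real (\<integral>\<^sup>+x. ennreal (tensor \<psi> x) \<partial>lborel)"
    by (intro integral_eq_nn_integral) (auto simp: tensor_def intro!: prod_nonneg nonneg)
  then show "(LINT x|lborel. tensor \<psi> x) = (\<Prod>i\<in>UNIV. LINT t|lborel. \<psi> i t)"
    unfolding * by (simp add: prod_nonneg integral_nonneg_AE nonneg)
  show "integrable lborel (tensor \<psi>)"
    by (rule integrableI_nn_integral_finite[OF _ _ *]) (auto simp: tensor_def intro!: prod_nonneg nonneg)
qed

text \<open>Minus an antiderivative of the bump; it vanishes to the right of \<open>b\<close> and is constant to the left of \<open>a\<close>.\<close>
definition bump_tail :: "nat \<Rightarrow> real \<Rightarrow> real \<Rightarrow> real \<Rightarrow> real" where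
  "bump_tail n a b t = (LINT s|lborel. indicator {t..} s * bump n a b s)"

lemma bump_set_integrable: "set_integrable lborel {c..e} (bump n a b)"
  by (intro borel_integrable_atLeastAtMost' smooth1_continuous_on smooth1_bump)

lemma integrable_indicator_bump: "integrable lborel (\<lambda>s. indicator {t..} s * bump n a b s)"
proof -
  have "(\<lambda>s. indicator {t..} s * bump n a b s) = (\<lambda>s. indicator {t..max b t} s *\<^sub>R bump n a b s)"
    by (intro ext) (auto intro!: bump_eq_0 split: split_indicator)
  then show ?thesis using bump_set_integrable by (simp add: set_integrable_def)
qed

lemma bump_tail_eq:
  assumes "b \<le> e"
  shows "bump_tail n a b t = integral {t..e} (bump n a b)"
proof -
  have "bump_tail n a b t = (LINT s:{t..e}|lborel. bump n a b s)"
    unfolding bump_tail_def set_lebesgue_integral_def using assms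
    by (intro Bochner_Integration.integral_cong) (auto simp: bump_eq_0 split: split_indicator)
  then show ?thesis using set_borel_integral_eq_integral(2)[OF bump_set_integrable] by metis
qed

lemma bump_tail_DERIV: "(bump_tail n a b has_real_derivative - bump n a b t) (at t)"
proof -
  define c e where "c = t - 1" and "e = max b t + 1"
  have io: "bump n a b integrable_on {c..e}"
    by (intro integrable_continuous_real smooth1_continuous_on smooth1_bump)
  have "((\<lambda>u. integral {c..u} (bump n a b)) has_real_derivative bump n a b t) (at t within {c..e})"
    by (rule integral_has_real_derivative) (auto simp: c_def e_def intro: smooth1_continuous_on smooth1_bump)
  then have "((\<lambda>u. integral {c..u} (bump n a b)) has_real_derivative bump n a b t) (at t)"
    by (subst (asm) at_within_interior) (auto simp: c_def e_def)
  then have "((\<lambda>u. integral {c..e} (bump n a b) - integral {c..u} (bump n a b)) has_real_derivative - bump n a b t) (at t)"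
    by (auto intro!: derivative_eq_intros)
  moreover have "eventually (\<lambda>u. integral {c..e} (bump n a b) - integral {c..u} (bump n a b) = bump_tail n a b u) (nhds t)"
    unfolding eventually_nhds
  proof (intro exI[of _ "{c<..<e}"] conjI ballI)
    fix u assume "u \<in> {c<..<e}"
    then have "integral {c..u} (bump n a b) + integral {u..e} (bump n a b) = integral {c..e} (bump n a b)"
      using io by (intro Henstock_Kurzweil_Integration.integral_combine) auto
    moreover have "bump_tail n a b u = integral {u..e} (bump n a b)"
      by (rule bump_tail_eq) (auto simp: e_def)
    ultimately show "integral {c..e} (bump n a b) - integral {c..u} (bump n a b) = bump_tail n a b u" by simp
  qed (auto simp: c_def e_def)
  ultimately show ?thesis
    using DERIV_cong_ev[OF refl _ refl, where x = t and f = "\<lambda>u. integral {c..e} (bump n a b) - integral {c..u} (bump n a b)"]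
    by blast
qed

lemma smooth1_bump_tail: "smooth1 (bump_tail n a b)"
proof (rule smooth1I[OF bump_tail_DERIV])
  show "smooth1 (\<lambda>t. - bump n a b t)"
    using smooth1_mult[OF smooth1_const[of "-1"] smooth1_bump] by simp
qed

lemma integral_orthant_box_bump:
  "(LINT x|lborel. indicator {x. \<forall>i. y $ i \<le> x $ i} x * box_bump n a b x) = tensor (\<lambda>i. bump_tail n (a $ i) (b $ i)) y"
proof -
  have "(\<lambda>x. indicator {x. \<forall>i. y $ i \<le> x $ i} x * box_bump n a b x)
      = tensor (\<lambda>i t. indicator {y $ i..} t * bump n (a $ i) (b $ i) t)"
  proof
    fix x
    have "indicator {x. \<forall>i. y $ i \<le> x $ i} x = (\<Prod>i\<in>UNIV. indicator {y $ i..} (x $ i) :: real)"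
      by (auto simp: indicator_def intro: prod_zero)
    then show "indicator {x. \<forall>i. y $ i \<le> x $ i} x * box_bump n a b x
       = tensor (\<lambda>i t. indicator {y $ i..} t * bump n (a $ i) (b $ i) t) x"
      by (simp add: tensor_def prod.distrib)
  qed
  then show ?thesis
    by (simp add: integral_tensor_nonneg integrable_indicator_bump bump_bounds)
       (simp add: tensor_def bump_tail_def)
qed

section \<open>Continuous representatives\<close>

definition cumulative :: "(real ^ 'd \<Rightarrow> real) \<Rightarrow> real ^ 'd \<Rightarrow> real" where
  "cumulative v x = (LINT y|lborel. indicator {y. \<forall>i. y $ i \<le> x $ i} y * v y)"

lemma measurable_orthant [measurable]:
  "{y :: real ^ 'd. \<forall>i. y $ i \<le> x $ i} \<in> sets borel" "{x :: real ^ 'd. \<forall>i. y $ i \<le> x $ i} \<in> sets borel"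
  by measurable

text \<open>The indicators of the orthants below \<open>u n\<close> converge to that of the orthant below \<open>x\<close> except possibly on
  the hyperplanes through \<open>x\<close> parallel to the coordinate hyperplanes, which are null sets.\<close>
lemma continuous_cumulative:
  fixes v :: "real ^ 'd \<Rightarrow> real"
  assumes v: "integrable lborel v"
  shows "continuous_on UNIV (cumulative v)"
proof (rule continuous_on_sequentiallyI)
  fix u :: "nat \<Rightarrow> real ^ 'd" and x assume u: "u \<longlonglongrightarrow> x"
  have [measurable]: "v \<in> borel_measurable borel" using v by simp
  show "(\<lambda>n. cumulative v (u n)) \<longlonglongrightarrow> cumulative v x"
    unfolding cumulative_def
  proof (rule integral_dominated_convergence[where w = "\<lambda>y. \<bar>v y\<bar>"])
    have "AE y in lborel. \<forall>i\<in>UNIV. y $ i \<noteq> x $ i"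
    proof (rule AE_finite_allI)
      show "AE y in lborel. y $ i \<noteq> x $ i" for i
        using AE_lborel_inner_neq[of "axis i 1 :: real ^ 'd" "x $ i"] by (simp add: inner_axis)
    qed simp
    then show "AE y in lborel. (\<lambda>n. indicator {y. \<forall>i. y $ i \<le> u n $ i} y * v y) \<longlonglongrightarrow> indicator {y. \<forall>i. y $ i \<le> x $ i} y * v y"
    proof eventually_elim
      case (elim y)
      have comp: "(\<lambda>n. u n $ i) \<longlonglongrightarrow> x $ i" for i using u by (rule tendsto_vec_nth)
      have "\<forall>\<^sub>F n in sequentially. \<forall>i\<in>UNIV. (y $ i \<le> u n $ i \<longleftrightarrow> y $ i \<le> x $ i)"
      proof (intro eventually_ball_finite ballI)
        fix i
        consider "y $ i < x $ i" | "x $ i < y $ i" using elim by (meson UNIV_I linorder_neqE)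
        then show "\<forall>\<^sub>F n in sequentially. y $ i \<le> u n $ i \<longleftrightarrow> y $ i \<le> x $ i"
        proof cases
          case 1
          then show ?thesis using order_tendstoD(1)[OF comp 1] by (auto elim: eventually_mono)
        next
          case 2
          then show ?thesis using order_tendstoD(2)[OF comp 2] by (auto elim: eventually_mono)
        qed
      qed simp
      then have "\<forall>\<^sub>F n in sequentially. indicator {y. \<forall>i. y $ i \<le> u n $ i} y * v y = indicator {y. \<forall>i. y $ i \<le> x $ i} y * v y"
        by eventually_elim (simp add: indicator_def)
      then show ?case by (rule tendsto_eventually)
    qed
  qed (use v in \<open>auto split: split_indicator\<close>)
qed

text \<open>Fubini: integration over the orthant passes from \<open>v\<close> to the bump, as its adjoint.\<close>
lemma integral_cumulative_mult_box_bump: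
  fixes v :: "real ^ 'd \<Rightarrow> real"
  assumes v: "integrable lborel v"
  shows "(LINT x|lborel. cumulative v x * box_bump n a b x)
       = (LINT y|lborel. v y * tensor (\<lambda>i. bump_tail n (a $ i) (b $ i)) y)"
proof -
  have [measurable]: "v \<in> borel_measurable borel" using v by simp
  have [measurable]: "box_bump n a b \<in> borel_measurable borel"
    by (intro borel_measurable_continuous_onI tensor_continuous_on smooth1_bump)
  have b: "integrable lborel (box_bump n a b)"
  proof -
    have "set_integrable lborel (cbox a b) (box_bump n a b)"
      unfolding set_integrable_def
      by (intro borel_integrable_compact[OF compact_cbox] tensor_continuous_on smooth1_bump)
    moreover have "(\<lambda>x. indicator (cbox a b) x *\<^sub>R box_bump n a b x) = box_bump n a b"
      using box_subset_cbox[of a b] by (intro ext) (auto intro!: box_bump_outside[symmetric] box_bump_outside split: split_indicator)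
    ultimately show ?thesis by (simp add: set_integrable_def)
  qed
  let ?k = "\<lambda>x y. indicator {y. \<forall>i. y $ i \<le> x $ i} y * v y * box_bump n a b x"
  have meas: "(\<lambda>(x, y). ?k x y) \<in> borel_measurable (lborel \<Otimes>\<^sub>M lborel)"
  proof -
    have "closed {p :: (real ^ 'd) \<times> (real ^ 'd). \<forall>i. snd p $ i \<le> fst p $ i}"
      by (intro closed_Collect_all closed_Collect_le continuous_intros)
    then have [measurable]: "{p :: (real ^ 'd) \<times> (real ^ 'd). \<forall>i. snd p $ i \<le> fst p $ i} \<in> sets (borel \<Otimes>\<^sub>M borel)"
      unfolding borel_prod by (rule borel_closed)
    have "(\<lambda>(x, y). ?k x y) = (\<lambda>p. indicator {p. \<forall>i. snd p $ i \<le> fst p $ i} p * v (snd p) * box_bump n a b (fst p))"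
      by (auto simp: indicator_def)
    also have "\<dots> \<in> borel_measurable (borel \<Otimes>\<^sub>M borel)"
      by (intro borel_measurable_times borel_measurable_indicator) measurable
    finally show ?thesis by (simp cong: measurable_cong_sets sets_pair_measure_cong)
  qed
  have ub: "integrable (lborel \<Otimes>\<^sub>M lborel) (\<lambda>(x, y). v y * box_bump n a b x)"
  proof (rule lborel_pair.Fubini_integrable)
    show "integrable lborel (\<lambda>x. LINT y|lborel. norm (case (x, y) of (x, y) \<Rightarrow> v y * box_bump n a b x))"
      using b by (simp add: abs_mult)
    show "AE x in lborel. integrable lborel (\<lambda>y. case (x, y) of (x, y) \<Rightarrow> v y * box_bump n a b x)"
      using v by simp
  qed measurable
  have int: "integrable (lborel \<Otimes>\<^sub>M lborel) (\<lambda>(x, y). ?k x y)"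
    by (rule Bochner_Integration.integrable_bound[OF ub meas]) (auto split: split_indicator)
  have "(LINT x|lborel. cumulative v x * box_bump n a b x) = (LINT x|lborel. LINT y|lborel. ?k x y)"
    by (simp add: cumulative_def)
  also have "\<dots> = (LINT y|lborel. LINT x|lborel. ?k x y)"
    by (rule lborel_pair.Fubini_integral[OF int, symmetric])
  also have "\<dots> = (LINT y|lborel. v y * (LINT x|lborel. indicator {x. \<forall>i. y $ i \<le> x $ i} x * box_bump n a b x))"
  proof (rule Bochner_Integration.integral_cong[OF refl])
    fix y
    have "(\<lambda>x. ?k x y) = (\<lambda>x. v y * (indicator {x. \<forall>i. y $ i \<le> x $ i} x * box_bump n a b x))"
      by (auto split: split_indicator)
    then show "(LINT x|lborel. ?k x y) = v y * (LINT x|lborel. indicator {x. \<forall>i. y $ i \<le> x $ i} x * box_bump n a b x)"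
      by simp
  qed
  finally show ?thesis unfolding integral_orthant_box_bump .
qed

lemma deriv_bump_outside: "t < a \<or> b < t \<Longrightarrow> deriv (bump n a b) t = 0"
proof -
  assume t: "t < a \<or> b < t"
  have "((\<lambda>_. 0) has_real_derivative 0) (at t)" by simp
  moreover have "eventually (\<lambda>u. 0 = bump n a b u) (nhds t)"
    unfolding eventually_nhds using t
    by (intro exI[of _ "if t < a then {..<a} else {b<..}"]) (auto simp: bump_eq_0)
  ultimately have "(bump n a b has_real_derivative 0) (at t)"
    using DERIV_cong_ev[OF refl _ refl, where x = t and f = "\<lambda>_. 0" and g = "bump n a b"] by blast
  then show ?thesis by (rule DERIV_imp_deriv)
qed

lemma integrable_mult_test:
  assumes "\<And>K. compact K \<Longrightarrow> K \<subseteq> U \<Longrightarrow> h absolutely_integrable_on K" "test_function U \<phi>"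
  shows "integrable lebesgue (\<lambda>x. h x * \<phi> x)"
  using integrable_mult_test_function[OF assms(1) assms(2)] by (metis partial_derivs.simps(1))

text \<open>Write \<open>\<eta>\<close> for the product of the bumps \<open>\<eta>\<^sub>i\<close>. Formally \<open>f \<eta>\<close> is the iterated antiderivative \<open>F\<close> of its
  mixed derivative \<open>w = \<Sum>R. (D\<^sup>R f) (\<Prod>i\<notin>R. \<eta>\<^sub>i')\<Prod>i\<in>R. \<eta>\<^sub>i\<close>, where \<open>R\<close> ranges over the sets of variables.
  To prove \<open>F = f \<eta>\<close>, test with a product of bumps \<open>\<phi>\<^sub>i\<close> with tails \<open>\<Phi>\<^sub>i\<close>. By Fubini \<open>\<integral>F \<phi> = \<integral>w \<Phi>\<close>, and
  the weak derivatives turn the right-hand side into the integral of \<open>f\<close> against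
  \<open>\<Sum>R. (\<Prod>i\<in>R. - (\<eta>\<^sub>i \<Phi>\<^sub>i)') (\<Prod>i\<notin>R. \<eta>\<^sub>i' \<Phi>\<^sub>i) = \<Prod>i. (- (\<eta>\<^sub>i \<Phi>\<^sub>i)' + \<eta>\<^sub>i' \<Phi>\<^sub>i) = \<Prod>i. \<eta>\<^sub>i \<phi>\<^sub>i\<close>.\<close>
lemma local_continuous_representative:
  fixes f :: "real ^ 'd \<Rightarrow> real" and a b :: "real ^ 'd"
  assumes W: "\<And>r. (\<And>i. r i \<le> 1) \<Longrightarrow> has_weak_deriv UNIV r f (W r)"
  shows "\<exists>F. continuous_on UNIV F \<and> (AE x in lebesgue. F x = f x * box_bump 1 a b x)"
proof -
  define ind :: "'d set \<Rightarrow> 'd \<Rightarrow> nat" where "ind R i = (if i \<in> R then 1 else 0)" for R i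
  define cf where "cf R i = (if i \<in> R then bump 1 (a $ i) (b $ i) else deriv (bump 1 (a $ i) (b $ i)))" for R i
  define w where "w = (\<lambda>y. \<Sum>R\<in>Pow UNIV. W (ind R) y * tensor (cf R) y)"
  have WR: "has_weak_deriv UNIV (ind R) f (W (ind R))" for R
    by (rule W) (simp add: ind_def)
  note loc = has_weak_deriv_absolutely_integrable[OF WR]
  have cf: "smooth1 (cf R i)" "t < a $ i \<or> b $ i < t \<Longrightarrow> cf R i t = 0" for R i t
    by (auto simp: cf_def smooth1_bump smooth1_deriv bump_eq_0 deriv_bump_outside)
  have int_w: "integrable lebesgue (\<lambda>y. W (ind R) y * tensor (cf R) y)" for R
    using integrable_mult_test[OF loc(2) test_function_tensor[OF cf subset_UNIV]] by simp
  then have "integrable lebesgue w" unfolding w_def by (intro Bochner_Integration.integrable_sum)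
  then obtain v where v: "v \<in> borel_measurable lborel" and ae: "AE x in lborel. w x = v x"
    using completion_ex_borel_measurable_real[of w lborel] by auto
  have ae': "AE x in lebesgue. w x = v x" using ae by (rule AE_completion)
  have v': "v \<in> borel_measurable lebesgue" using v by (rule measurable_completion)
  have "integrable lebesgue v"
    using integrable_cong_AE[of w lebesgue v] \<open>integrable lebesgue w\<close> ae' v' by auto
  then have iv: "integrable lborel v" using v integrable_completion by blast
  define F where "F = cumulative v"
  have F: "continuous_on UNIV F" unfolding F_def by (rule continuous_cumulative[OF iv])
  have "AE x in lebesgue. x \<in> UNIV \<longrightarrow> F x - f x * box_bump 1 a b x = 0"
  proof (rule AE_zero_if_bump_integrals_zero)
    have prod_int: "(\<lambda>x. f x * box_bump 1 a b x) absolutely_integrable_on K" if "compact K" for K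
    proof -
      have "integrable lebesgue (\<lambda>x. f x * box_bump 1 a b x)"
        using integrable_mult_test[OF loc(1) test_function_box_bump[of a b UNIV 1]] by simp
      then have "(\<lambda>x. f x * box_bump 1 a b x) absolutely_integrable_on UNIV" by (simp add: set_integrable_def)
      then show ?thesis
        by (rule set_integrable_subset) (use that in \<open>auto simp: compact_imp_closed borel_closed\<close>)
    qed
    have F_int: "F absolutely_integrable_on K" if "compact K" for K
    proof -
      have "integrable lborel (\<lambda>x. indicator K x *\<^sub>R F x)"
        using that F by (intro borel_integrable_compact) (auto intro: continuous_on_subset)
      then show ?thesis
        unfolding set_integrable_def using integrable_completion[of "\<lambda>x. indicator K x *\<^sub>R F x" lborel] by auto
    qed
    show "(\<lambda>x. F x - f x * box_bump 1 a b x) absolutely_integrable_on K" if "compact K" for K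
      by (intro set_integral_diff(1) F_int prod_int that)
    fix n and c d :: "real ^ 'd"
    define \<Phi> where "\<Phi> i = bump_tail n (c $ i) (d $ i)" for i
    define \<tau> where "\<tau> R = (\<lambda>i t. cf R i t * \<Phi> i t)" for R
    have \<Phi>: "smooth1 (\<Phi> i)" for i by (simp add: \<Phi>_def smooth1_bump_tail)
    have \<tau>: "smooth1 (\<tau> R i)" "t < a $ i \<or> b $ i < t \<Longrightarrow> \<tau> R i t = 0" for R i t
      by (auto simp: \<tau>_def cf \<Phi> intro: smooth1_mult)
    have test: "test_function UNIV (tensor (\<tau> R))" for R
      by (rule test_function_tensor[OF \<tau>]) auto
    \<comment> \<open>expanding the product over \<open>i\<close> of \<open>?A i + ?B i\<close> gives the sum over \<open>R\<close>\<close>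
    let ?A = "\<lambda>i t. - deriv (\<lambda>t. bump 1 (a $ i) (b $ i) t * \<Phi> i t) t"
    let ?B = "\<lambda>i t. deriv (bump 1 (a $ i) (b $ i)) t * \<Phi> i t"
    have R: "(LINT y|lebesgue. W (ind R) y * tensor (\<tau> R) y)
        = (LINT y|lebesgue. f y * ((\<Prod>i\<in>R. ?A i (y $ i)) * (\<Prod>i\<in>UNIV - R. ?B i (y $ i))))"
     and Ri: "integrable lebesgue (\<lambda>y. f y * ((\<Prod>i\<in>R. ?A i (y $ i)) * (\<Prod>i\<in>UNIV - R. ?B i (y $ i))))" for R
    proof -
      obtain "is" where cnt: "count_list is = ind R" using exists_list_with_counts by blast
      have "length is = card R"
        using sum_count_list[of "is"] by (simp add: cnt ind_def sum.If_cases)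
      have "partial_derivs is (tensor (\<tau> R)) y * (-1) ^ card R
         = (\<Prod>i\<in>R. ?A i (y $ i)) * (\<Prod>i\<in>UNIV - R. ?B i (y $ i))" for y
      proof -
        have "partial_derivs is (tensor (\<tau> R)) y = (\<Prod>i\<in>UNIV. (deriv ^^ ind R i) (\<tau> R i) (y $ i))"
          by (subst partial_derivs_tensor[OF \<tau>(1)]) (simp add: tensor_def cnt)
        also have "\<dots> = (\<Prod>i\<in>R. (deriv ^^ ind R i) (\<tau> R i) (y $ i)) * (\<Prod>i\<in>UNIV - R. (deriv ^^ ind R i) (\<tau> R i) (y $ i))"
          by (subst prod.subset_diff[of R UNIV]) (auto simp: mult.commute)
        also have "(\<Prod>i\<in>R. (deriv ^^ ind R i) (\<tau> R i) (y $ i)) = (\<Prod>i\<in>R. (-1) * ?A i (y $ i))"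
          by (intro prod.cong) (auto simp: ind_def \<tau>_def cf_def)
        also have "\<dots> = (-1) ^ card R * (\<Prod>i\<in>R. ?A i (y $ i))" by (simp only: prod.distrib prod_constant)
        also have "(\<Prod>i\<in>UNIV - R. (deriv ^^ ind R i) (\<tau> R i) (y $ i)) = (\<Prod>i\<in>UNIV - R. ?B i (y $ i))"
          by (intro prod.cong) (auto simp: ind_def \<tau>_def cf_def)
        finally show ?thesis by (simp add: mult_ac flip: power_mult_distrib)
      qed
      then have eq: "f y * ((\<Prod>i\<in>R. ?A i (y $ i)) * (\<Prod>i\<in>UNIV - R. ?B i (y $ i)))
          = (-1) ^ card R * (f y * partial_derivs is (tensor (\<tau> R)) y)" for y
        by (metis (no_types, lifting) mult.assoc mult.commute)
      show "(LINT y|lebesgue. W (ind R) y * tensor (\<tau> R) y)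
        = (LINT y|lebesgue. f y * ((\<Prod>i\<in>R. ?A i (y $ i)) * (\<Prod>i\<in>UNIV - R. ?B i (y $ i))))"
      proof -
        have "(LINT y|lebesgue. f y * partial_derivs is (tensor (\<tau> R)) y)
            = (-1) ^ card R * (LINT y|lebesgue. W (ind R) y * tensor (\<tau> R) y)"
          using has_weak_derivD[OF open_UNIV WR test cnt] \<open>length is = card R\<close> by simp
        then show ?thesis
          unfolding eq integral_mult_right_zero by (simp flip: mult.assoc power_mult_distrib)
      qed
      show "integrable lebesgue (\<lambda>y. f y * ((\<Prod>i\<in>R. ?A i (y $ i)) * (\<Prod>i\<in>UNIV - R. ?B i (y $ i))))"
        unfolding eq using integrable_mult_test_function[OF loc(1) test] by simp
    qed
    have AB: "?A i t + ?B i t = bump 1 (a $ i) (b $ i) t * bump n (c $ i) (d $ i) t" for i t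
    proof -
      have "((\<lambda>t. bump 1 (a $ i) (b $ i) t * \<Phi> i t) has_real_derivative
         deriv (bump 1 (a $ i) (b $ i)) t * \<Phi> i t + - bump n (c $ i) (d $ i) t * bump 1 (a $ i) (b $ i) t) (at t)"
        unfolding \<Phi>_def by (rule DERIV_mult[OF smooth1_DERIV[OF smooth1_bump] bump_tail_DERIV])
      then show ?thesis by (simp add: DERIV_imp_deriv)
    qed
    have [measurable]: "tensor \<Phi> \<in> borel_measurable borel" "box_bump n c d \<in> borel_measurable borel"
      by (auto intro!: borel_measurable_continuous_onI tensor_continuous_on smooth1_bump \<Phi>)
    have [measurable]: "v \<in> borel_measurable borel" "F \<in> borel_measurable borel"
      using v F by (auto intro: borel_measurable_continuous_onI)
    have "(LINT x|lebesgue. F x * box_bump n c d x) = (LINT x|lborel. F x * box_bump n c d x)"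
      by (intro integral_completion) measurable
    also have "\<dots> = (LINT y|lborel. v y * tensor \<Phi> y)"
      unfolding F_def \<Phi>_def by (rule integral_cumulative_mult_box_bump[OF iv])
    also have "\<dots> = (LINT y|lebesgue. v y * tensor \<Phi> y)"
      by (intro integral_completion[symmetric]) measurable
    also have "\<dots> = (LINT y|lebesgue. w y * tensor \<Phi> y)"
    proof (rule integral_cong_AE)
      have "tensor \<Phi> \<in> borel_measurable lebesgue" by (intro measurable_completion) simp
      then show "(\<lambda>y. v y * tensor \<Phi> y) \<in> borel_measurable lebesgue" "(\<lambda>y. w y * tensor \<Phi> y) \<in> borel_measurable lebesgue"
        using v' borel_measurable_integrable[OF \<open>integrable lebesgue w\<close>] by (auto intro: borel_measurable_times)
    qed (use ae' in \<open>auto elim: eventually_mono\<close>)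
    also have "(\<lambda>y. w y * tensor \<Phi> y) = (\<lambda>y. \<Sum>R\<in>Pow UNIV. W (ind R) y * tensor (\<tau> R) y)"
      by (auto simp: w_def \<tau>_def tensor_def sum_distrib_right prod.distrib mult.assoc)
    also have "(LINT y|lebesgue. (\<Sum>R\<in>Pow UNIV. W (ind R) y * tensor (\<tau> R) y)) = (\<Sum>R\<in>Pow UNIV. LINT y|lebesgue. W (ind R) y * tensor (\<tau> R) y)"
      using integrable_mult_test[OF loc(2) test] by (intro Bochner_Integration.integral_sum) auto
    also have "\<dots> = (LINT y|lebesgue. (\<Sum>R\<in>Pow UNIV. f y * ((\<Prod>i\<in>R. ?A i (y $ i)) * (\<Prod>i\<in>UNIV - R. ?B i (y $ i)))))"
      unfolding R by (intro Bochner_Integration.integral_sum[symmetric] Ri)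
    also have "(\<lambda>y. \<Sum>R\<in>Pow UNIV. f y * ((\<Prod>i\<in>R. ?A i (y $ i)) * (\<Prod>i\<in>UNIV - R. ?B i (y $ i))))
       = (\<lambda>y. f y * box_bump 1 a b y * box_bump n c d y)"
      unfolding sum_distrib_left[symmetric]
      by (subst prod_add[symmetric]) (simp_all only: AB tensor_def prod.distrib mult.assoc finite)
    finally have eq: "(LINT x|lebesgue. F x * box_bump n c d x) = (LINT y|lebesgue. f y * box_bump 1 a b y * box_bump n c d y)" .
    have "integrable lebesgue (\<lambda>x. F x * box_bump n c d x)" "integrable lebesgue (\<lambda>y. f y * box_bump 1 a b y * box_bump n c d y)"
      by (rule integrable_mult_test[OF F_int test_function_box_bump[of c d UNIV n]]; simp)
         (rule integrable_mult_test[OF prod_int test_function_box_bump[of c d UNIV n]]; simp)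
    then show "(LINT x|lebesgue. (F x - f x * box_bump 1 a b x) * box_bump n c d x) = 0"
      using eq by (simp add: left_diff_distrib)
  qed simp
  then show ?thesis using F by (intro exI[of _ F]) (auto elim: eventually_mono)
qed

lemma continuous_AE_eq_imp_eq:
  fixes F G :: "real ^ 'd \<Rightarrow> real"
  assumes "open U" "continuous_on U F" "continuous_on U G" "AE x in lebesgue. x \<in> U \<longrightarrow> F x = G x" "x \<in> U"
  shows "F x = G x"
proof (rule ccontr)
  assume "F x \<noteq> G x"
  define S where "S = U \<inter> (\<lambda>x. F x - G x) -` (- {0})"
  have "open S" unfolding S_def
    using assms by (intro continuous_open_preimage continuous_intros) auto
  moreover have "x \<in> S" using assms \<open>F x \<noteq> G x\<close> by (simp add: S_def)
  moreover have "negligible S"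
  proof -
    have "AE x in lebesgue. x \<notin> S" using assms(4) by eventually_elim (auto simp: S_def)
    moreover have "S \<in> sets lebesgue" using \<open>open S\<close> by auto
    ultimately have "S \<in> null_sets lebesgue" by (simp add: AE_iff_null_sets)
    then show ?thesis by (simp add: negligible_iff_null_sets)
  qed
  ultimately show False using open_not_negligible by blast
qed

text \<open>On a box where the cut-off \<open>\<eta>\<close> is positive, division by it gives a continuous representative of \<open>f\<close>
  itself. Continuous functions that agree almost everywhere on an open set agree there, so the local
  representatives fit together.\<close>
theorem continuous_representative:
  fixes f :: "real ^ 'd \<Rightarrow> real"
  assumes W: "\<And>r. (\<And>i. r i \<le> 1) \<Longrightarrow> \<exists>h. has_weak_deriv UNIV r f h"
  shows "\<exists>F. continuous_on UNIV F \<and> (AE x in lebesgue. F x = f x)"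
proof -
  define B :: "nat \<Rightarrow> (real ^ 'd) set" where "B N = box (\<chi> i. - real N) (\<chi> i. real N)" for N
  have "\<exists>F. continuous_on (B N) F \<and> (AE x in lebesgue. x \<in> B N \<longrightarrow> F x = f x)" for N
  proof -
    let ?\<eta> = "box_bump 1 (\<chi> i. - real N) (\<chi> i. real N)"
    from W obtain W' where "\<And>r. (\<And>i. r i \<le> 1) \<Longrightarrow> has_weak_deriv UNIV r f (W' r)" by metis
    from local_continuous_representative[OF this] obtain F where F: "continuous_on UNIV F" "AE x in lebesgue. F x = f x * ?\<eta> x"
      by blast
    have pos: "?\<eta> x > 0" if "x \<in> B N" for x
      using that unfolding tensor_def B_def mem_box_cart by (intro prod_pos) (auto intro!: bump_pos)
    have "continuous_on (B N) (\<lambda>x. F x / ?\<eta> x)"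
      using F(1) pos by (intro continuous_on_divide tensor_continuous_on smooth1_bump) (auto intro: continuous_on_subset simp: less_le)
    moreover have "AE x in lebesgue. x \<in> B N \<longrightarrow> F x / ?\<eta> x = f x"
      using F(2) by eventually_elim (use pos in \<open>auto simp: less_le\<close>)
    ultimately show ?thesis by blast
  qed
  then obtain F where F: "\<And>N. continuous_on (B N) (F N)" "\<And>N. AE x in lebesgue. x \<in> B N \<longrightarrow> F N x = f x" by metis
  have opB: "open (B N)" for N unfolding B_def by (rule open_box)
  have mono: "B M \<subseteq> B N" if "M \<le> N" for M N
  proof
    fix x assume "x \<in> B M"
    then have x: "- real M < x $ i \<and> x $ i < real M" for i by (simp add: B_def mem_box_cart)
    have "- real N < x $ i \<and> x $ i < real N" for i using x[of i] that by linarith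
    then show "x \<in> B N" by (simp add: B_def mem_box_cart)
  qed
  have coh: "F M x = F N x" if "x \<in> B M" "M \<le> N" for M N x
  proof (rule continuous_AE_eq_imp_eq[OF opB[of M] F(1) _ _ that(1)])
    show "continuous_on (B M) (F N)" using F(1) mono[OF that(2)] continuous_on_subset by blast
    show "AE x in lebesgue. x \<in> B M \<longrightarrow> F M x = F N x"
      using F(2)[of M] F(2)[of N] by eventually_elim (use mono[OF that(2)] in auto)
  qed
  define N :: "real ^ 'd \<Rightarrow> nat" where "N x = nat \<lceil>norm x\<rceil> + 1" for x
  have inB: "x \<in> B (N x)" for x
  proof -
    have "norm x < real (N x)" unfolding N_def by linarith
    then have "\<bar>x $ i\<bar> < real (N x)" for i using component_le_norm_cart[of x i] by linarith
    then show ?thesis by (simp add: B_def mem_box_cart abs_less_iff) (metis minus_less_iff)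
  qed
  define G where "G x = F (N x) x" for x
  have G: "G x = F M x" if "x \<in> B M" for x M
    using coh[OF that, of "max M (N x)"] coh[OF inB, of x "max M (N x)"] by (simp add: G_def)
  have "continuous_on UNIV G"
  proof (rule continuous_at_imp_continuous_on, intro ballI)
    fix x
    have "continuous_on (B (N x)) G" using F(1) G by (metis continuous_on_cong)
    then show "isCont G x" using opB inB continuous_on_eq_continuous_at by blast
  qed
  moreover have "AE x in lebesgue. \<forall>M. x \<in> B M \<longrightarrow> F M x = f x"
    using F(2) by (subst AE_all_countable) auto
  then have "AE x in lebesgue. G x = f x"
    by eventually_elim (use inB in \<open>auto simp: G_def\<close>)
  ultimately show ?thesis by blast
qed

section \<open>Translations\<close>

lemma lebesgue_translation:
  fixes c :: "'a::euclidean_space"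
  shows "distr lebesgue lebesgue (\<lambda>x. x + c) = lebesgue" "(\<lambda>x. x + c) \<in> lebesgue \<rightarrow>\<^sub>M lebesgue"
proof -
  have T: "(\<lambda>x. c + (\<Sum>j\<in>Basis. (1 * (x \<bullet> j)) *\<^sub>R j)) = (\<lambda>x. x + c)"
    by (simp add: euclidean_representation add.commute)
  show "distr lebesgue lebesgue (\<lambda>x. x + c) = lebesgue"
    using lebesgue_affine_euclidean[of "\<lambda>_. 1" c] unfolding T by (simp add: density_1)
  show "(\<lambda>x. x + c) \<in> lebesgue \<rightarrow>\<^sub>M lebesgue"
    using lebesgue_affine_measurable[of "\<lambda>_. 1" c] unfolding T by simp
qed

lemma lebesgue_integral_translation:
  fixes F :: "'a::euclidean_space \<Rightarrow> real"
  assumes "F \<in> borel_measurable lebesgue"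
  shows "(LINT x|lebesgue. F (x + c)) = (LINT x|lebesgue. F x)"
  using integral_distr[OF lebesgue_translation(2) assms, of c] by (simp add: lebesgue_translation)

lemma lebesgue_integrable_translation:
  fixes F :: "'a::euclidean_space \<Rightarrow> real"
  assumes "integrable lebesgue F"
  shows "integrable lebesgue (\<lambda>x. F (x + c))"
  using integrable_distr_eq[OF lebesgue_translation(2), of F c] assms by (simp add: lebesgue_translation)

lemma AE_lebesgue_translation:
  fixes c :: "'a::euclidean_space"
  assumes "AE x in lebesgue. P x"
  shows "AE x in lebesgue. P (x + c)"
proof -
  have "AE x in distr lebesgue lebesgue (\<lambda>x. x + c). P x"
    by (subst lebesgue_translation(1)) (rule assms)
  then show ?thesis by (rule AE_distrD[OF lebesgue_translation(2)])
qed

lemma absolutely_integrable_on_translation: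
  fixes u :: "'a::euclidean_space \<Rightarrow> real"
  assumes "u absolutely_integrable_on ((\<lambda>x. x + c) ` K)"
  shows "(\<lambda>x. u (x + c)) absolutely_integrable_on K"
proof -
  have "integrable lebesgue (\<lambda>x. indicator ((\<lambda>x. x + c) ` K) (x + c) *\<^sub>R u (x + c))"
    using assms unfolding set_integrable_def by (rule lebesgue_integrable_translation)
  moreover have "indicator ((\<lambda>x. x + c) ` K) (x + c) = (indicator K x :: real)" for x
    by (auto simp: indicator_def)
  ultimately show ?thesis by (simp add: set_integrable_def)
qed

lemma has_weak_deriv_translation:
  fixes u h :: "real ^ 'd \<Rightarrow> real"
  assumes u: "has_weak_deriv UNIV r u h" and U: "open U"
  shows "has_weak_deriv U r (\<lambda>x. u (x + c)) (\<lambda>x. h (x + c))"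
  unfolding has_weak_deriv_iff[OF U]
proof (intro conjI allI impI; (elim conjE)?)
  note loc = has_weak_deriv_absolutely_integrable[OF u]
  fix K :: "(real ^ 'd) set" assume K: "compact K"
  then have "compact ((\<lambda>x. x + c) ` K)" by (intro compact_continuous_image continuous_intros)
  then show "(\<lambda>x. u (x + c)) absolutely_integrable_on K" "(\<lambda>x. h (x + c)) absolutely_integrable_on K"
    by (auto intro!: absolutely_integrable_on_translation loc)
next
  note loc = has_weak_deriv_absolutely_integrable[OF u]
  fix \<phi> "is" assume \<phi>: "test_function U \<phi>" and cnt: "count_list is = r"
  obtain K where K: "compact K" "\<And>x. x \<notin> K \<Longrightarrow> \<phi> x = 0" using test_functionD[OF \<phi>] by metis
  have \<phi>': "test_function UNIV (\<lambda>x. \<phi> (x - c))"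
  proof (rule test_functionI)
    show "smooth (\<lambda>x. \<phi> (x - c))" using smooth_shift[of \<phi> "- c"] \<phi> by (simp add: test_function_def)
    show "compact ((\<lambda>x. x + c) ` K)" using K(1) by (intro compact_continuous_image continuous_intros)
    fix x assume "x \<notin> (\<lambda>x. x + c) ` K"
    then have "x - c \<notin> K" by (metis diff_add_cancel image_eqI)
    then show "\<phi> (x - c) = 0" by (rule K(2))
  qed simp
  have pd: "partial_derivs is (\<lambda>x. \<phi> (x - c)) = (\<lambda>x. partial_derivs is \<phi> (x - c))"
    using partial_derivs_shift[of "is" \<phi> "- c"] by simp
  have "(LINT x|lebesgue. u (x + c) * partial_derivs is \<phi> x) = (LINT x|lebesgue. u x * partial_derivs is \<phi> (x - c))"
    using lebesgue_integral_translation[OF borel_measurable_integrable[OF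
        integrable_mult_test_function[OF loc(1) \<phi>', of "is"]], of c]
    by (simp add: pd)
  also have "\<dots> = (-1) ^ length is * (LINT x|lebesgue. h x * \<phi> (x - c))"
    using has_weak_derivD[OF open_UNIV u \<phi>' cnt] by (simp add: pd)
  also have "(LINT x|lebesgue. h x * \<phi> (x - c)) = (LINT x|lebesgue. h (x + c) * \<phi> x)"
    using lebesgue_integral_translation[OF borel_measurable_integrable[OF
        integrable_mult_test[OF loc(2) \<phi>']], of c] by simp
  finally show "(LINT x|lebesgue. u (x + c) * partial_derivs is \<phi> x)
      = (-1) ^ length is * (LINT x|lebesgue. h (x + c) * \<phi> x)" .
qed

section \<open>Multiplication by the Gaussian density\<close>

definition gauss_deriv :: "('d \<Rightarrow> nat) \<Rightarrow> real ^ 'd \<Rightarrow> real" where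
  "gauss_deriv r = tensor (\<lambda>i. (deriv ^^ r i) gauss1)"

lemma gauss_density_eq_tensor: "gauss_density = tensor (\<lambda>_. gauss1)"
proof
  fix x :: "real ^ 'd"
  have "inverse (sqrt (2 * pi)) ^ CARD('d) = (2 * pi) powr (- real CARD('d) / 2)"
  proof -
    have "inverse (sqrt (2 * pi)) = (2 * pi) powr (- (1 / 2))"
      by (simp add: powr_minus powr_half_sqrt)
    then have "inverse (sqrt (2 * pi)) ^ CARD('d) = ((2 * pi) powr (- (1 / 2))) powr real CARD('d)"
      by (simp add: powr_realpow)
    then show ?thesis by (simp add: powr_powr)
  qed
  moreover have "(norm x)\<^sup>2 = (\<Sum>i\<in>UNIV. (x $ i)\<^sup>2)"
    by (simp add: norm_vec_def L2_set_def sum_nonneg)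
  ultimately show "gauss_density x = tensor (\<lambda>_. gauss1) x"
    by (simp add: gauss_density_def tensor_def gauss1_def prod.distrib exp_sum[symmetric] sum_divide_distrib sum_negf)
qed

lemma partial_derivs_gauss: "partial_derivs is gauss_density = gauss_deriv (count_list is)"
  unfolding gauss_density_eq_tensor gauss_deriv_def by (rule partial_derivs_tensor) (rule smooth1_gauss1)

lemma smooth_gauss_density: "smooth gauss_density"
  unfolding gauss_density_eq_tensor by (rule smooth_tensor) (rule smooth1_gauss1)

lemma smooth_gauss_deriv: "smooth (gauss_deriv r)"
  unfolding gauss_deriv_def by (intro smooth_tensor smooth1_higher_deriv smooth1_gauss1)

lemma absolutely_integrable_sum_list:
  assumes "\<And>y. y \<in> set ys \<Longrightarrow> F y absolutely_integrable_on K"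
  shows "(\<lambda>x. \<Sum>y\<leftarrow>ys. F y x :: real) absolutely_integrable_on K"
  using assms by (induction ys) auto

lemma integral_sum_list:
  assumes "\<And>y. y \<in> set ys \<Longrightarrow> integrable M (F y)"
  shows "(LINT x|M. (\<Sum>y\<leftarrow>ys. F y x :: real)) = (\<Sum>y\<leftarrow>ys. LINT x|M. F y x)"
    and "integrable M (\<lambda>x. \<Sum>y\<leftarrow>ys. F y x)"
  using assms by (induction ys) auto

text \<open>After \<open>mult_partial_derivs_expand\<close>, the weak derivatives of \<open>f\<close> apply term by term. The signs combine to
  the same \<open>(-1)\<^bsup>|r|\<^esup>\<close> in every term because the two parts of a split have lengths adding up to \<open>|r|\<close>.
  The list \<open>js\<close> is one fixed enumeration of the multi-index \<open>r\<close>; by \<open>splits_sum_perm\<close> it stands for all.\<close>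
theorem weak_leibniz_gauss:
  fixes f :: "real ^ 'd \<Rightarrow> real"
  assumes U: "open U" and W: "\<And>s. (\<And>i. s i \<le> r i) \<Longrightarrow> has_weak_deriv U s f (W s)"
    and js: "count_list js = r"
  shows "has_weak_deriv U r (\<lambda>x. f x * gauss_density x)
     (\<lambda>x. \<Sum>(as, bs)\<leftarrow>splits js. W (count_list as) x * gauss_deriv (count_list bs) x)"
  unfolding has_weak_deriv_iff[OF U]
proof (intro conjI allI impI; (elim conjE)?)
  have Wa: "has_weak_deriv U (count_list as) f (W (count_list as))" if "(as, bs) \<in> set (splits is)" "count_list is = r" for as bs "is"
    using splits_count[OF that(1)] that(2) by (intro W) (metis le_add1)
  fix K :: "(real ^ 'd) set" assume K: "compact K" "K \<subseteq> U"
  have "f absolutely_integrable_on K"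
    using has_weak_deriv_absolutely_integrable(1)[OF W K, of r] by simp
  then show "(\<lambda>x. f x * gauss_density x) absolutely_integrable_on K"
    using K by (intro absolutely_integrable_mult_continuous smooth_continuous_on smooth_gauss_density)
  show "(\<lambda>x. \<Sum>(as, bs)\<leftarrow>splits js. W (count_list as) x * gauss_deriv (count_list bs) x) absolutely_integrable_on K"
    unfolding split_def
  proof (rule absolutely_integrable_sum_list)
    fix y assume "y \<in> set (splits js)"
    then have "W (count_list (fst y)) absolutely_integrable_on K"
      using has_weak_deriv_absolutely_integrable(2)[OF Wa K, of "fst y" "snd y" js] js by simp
    then show "(\<lambda>x. W (count_list (fst y)) x * gauss_deriv (count_list (snd y)) x) absolutely_integrable_on K"
      using K by (intro absolutely_integrable_mult_continuous smooth_continuous_on smooth_gauss_deriv)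
  qed
next
  have Wa: "has_weak_deriv U (count_list as) f (W (count_list as))" if "(as, bs) \<in> set (splits is)" "count_list is = r" for as bs "is"
    using splits_count[OF that(1)] that(2) by (intro W) (metis le_add1)
  fix \<phi> "is" assume \<phi>: "test_function U \<phi>" and cnt: "count_list is = r"
  have sm: "smooth \<phi>" using \<phi> by (simp add: test_function_def)
  have test: "test_function U (\<lambda>x. \<phi> x * gauss_deriv b x)" for b
    by (rule test_function_mult[OF \<phi> smooth_gauss_deriv])
  have floc: "f absolutely_integrable_on K" if "compact K" "K \<subseteq> U" for K
    using has_weak_deriv_absolutely_integrable(1)[OF W that, of r] by simp
  have "(LINT x|lebesgue. f x * gauss_density x * partial_derivs is \<phi> x)
     = (LINT x|lebesgue. (\<Sum>y\<leftarrow>splits is. (-1) ^ length (snd y) *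
          (f x * partial_derivs (fst y) (\<lambda>x. \<phi> x * gauss_deriv (count_list (snd y)) x) x)))"
    using mult_partial_derivs_expand[OF sm smooth_gauss_density, of _ "is"]
    by (simp add: mult.assoc partial_derivs_gauss split_def sum_list_const_mult[symmetric] mult.left_commute)
  also have "\<dots> = (\<Sum>y\<leftarrow>splits is. LINT x|lebesgue. (-1) ^ length (snd y) *
          (f x * partial_derivs (fst y) (\<lambda>x. \<phi> x * gauss_deriv (count_list (snd y)) x) x))"
    by (intro integral_sum_list integrable_mult_right integrable_mult_test_function[OF floc test])
  also have "\<dots> = (\<Sum>y\<leftarrow>splits is. (-1) ^ length is *
      (LINT x|lebesgue. W (count_list (fst y)) x * (\<phi> x * gauss_deriv (count_list (snd y)) x)))"
  proof (rule arg_cong[of _ _ sum_list], rule map_cong[OF refl])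
    fix y assume y: "y \<in> set (splits is)"
    have "(LINT x|lebesgue. f x * partial_derivs (fst y) (\<lambda>x. \<phi> x * gauss_deriv (count_list (snd y)) x) x)
       = (-1) ^ length (fst y) * (LINT x|lebesgue. W (count_list (fst y)) x * (\<phi> x * gauss_deriv (count_list (snd y)) x))"
      by (rule has_weak_derivD[OF U Wa[of "fst y" "snd y" "is"] test refl]) (use y cnt in auto)
    moreover have "length (fst y) + length (snd y) = length is"
      using splits_length[of "fst y" "snd y" "is"] y by simp
    ultimately show "(LINT x|lebesgue. (-1) ^ length (snd y) * (f x * partial_derivs (fst y) (\<lambda>x. \<phi> x * gauss_deriv (count_list (snd y)) x) x))
      = (-1) ^ length is * (LINT x|lebesgue. W (count_list (fst y)) x * (\<phi> x * gauss_deriv (count_list (snd y)) x))"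
      unfolding integral_mult_right_zero by (metis (no_types, lifting) add.commute mult.assoc power_add)
  qed
  also have "\<dots> = (-1) ^ length is * (\<Sum>y\<leftarrow>splits is. LINT x|lebesgue. W (count_list (fst y)) x * (\<phi> x * gauss_deriv (count_list (snd y)) x))"
    by (simp add: sum_list_const_mult)
  also have "(\<Sum>y\<leftarrow>splits is. LINT x|lebesgue. W (count_list (fst y)) x * (\<phi> x * gauss_deriv (count_list (snd y)) x))
    = (LINT x|lebesgue. (\<Sum>y\<leftarrow>splits is. W (count_list (fst y)) x * (\<phi> x * gauss_deriv (count_list (snd y)) x)))"
  proof (rule integral_sum_list(1)[symmetric])
    fix y assume y: "y \<in> set (splits is)"
    show "integrable lebesgue (\<lambda>x. W (count_list (fst y)) x * (\<phi> x * gauss_deriv (count_list (snd y)) x))"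
      by (rule integrable_mult_test[OF _ test], rule has_weak_deriv_absolutely_integrable(2)[OF Wa[of "fst y" "snd y" "is"]])
         (use y cnt in auto)
  qed
  also have "(\<lambda>x. \<Sum>y\<leftarrow>splits is. W (count_list (fst y)) x * (\<phi> x * gauss_deriv (count_list (snd y)) x))
     = (\<lambda>x. (\<Sum>(as, bs)\<leftarrow>splits js. W (count_list as) x * gauss_deriv (count_list bs) x) * \<phi> x)"
  proof
    fix x
    have "mset is = mset js"
      using cnt js by (metis count_mset multiset_eqI)
    from splits_sum_perm[OF this, of "\<lambda>a b. W a x * gauss_deriv b x"]
    show "(\<Sum>y\<leftarrow>splits is. W (count_list (fst y)) x * (\<phi> x * gauss_deriv (count_list (snd y)) x))
     = (\<Sum>(as, bs)\<leftarrow>splits js. W (count_list as) x * gauss_deriv (count_list bs) x) * \<phi> x"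
      by (simp add: split_def sum_list_const_mult mult.assoc mult.commute mult.left_commute)
  qed
  finally show "(LINT x|lebesgue. f x * gauss_density x * partial_derivs is \<phi> x) = (-1) ^ length is *
    (LINT x|lebesgue. (\<Sum>(as, bs)\<leftarrow>splits js. W (count_list as) x * gauss_deriv (count_list bs) x) * \<phi> x)" .
qed

lemma gauss_deriv_bound:
  assumes "e > 0"
  shows "\<exists>C. \<forall>x. \<bar>gauss_deriv r x\<bar> \<le> C * exp (- (1 / 2 - e) * (norm x)\<^sup>2)"
proof -
  obtain C where C: "\<And>n x. \<bar>(deriv ^^ n) gauss1 x\<bar> \<le> C n * exp (- (1 / 2 - e) * x\<^sup>2)"
    using gauss1_higher_deriv_bound[OF assms] by metis
  have "\<bar>gauss_deriv r x\<bar> \<le> (\<Prod>i\<in>UNIV. C (r i)) * exp (- (1 / 2 - e) * (norm x)\<^sup>2)" for x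
  proof -
    have "\<bar>gauss_deriv r x\<bar> = (\<Prod>i\<in>UNIV. \<bar>(deriv ^^ r i) gauss1 (x $ i)\<bar>)"
      by (simp add: gauss_deriv_def tensor_def abs_prod)
    also have "\<dots> \<le> (\<Prod>i\<in>UNIV. C (r i) * exp (- (1 / 2 - e) * (x $ i)\<^sup>2))"
      by (intro prod_mono conjI C abs_ge_zero)
    also have "\<dots> = (\<Prod>i\<in>UNIV. C (r i)) * exp (- (1 / 2 - e) * (\<Sum>i\<in>UNIV. (x $ i)\<^sup>2))"
      by (simp add: prod.distrib exp_sum[symmetric] sum_distrib_left)
    also have "(\<Sum>i\<in>UNIV. (x $ i)\<^sup>2) = (norm x)\<^sup>2"
      by (simp add: norm_vec_def L2_set_def sum_nonneg)
    finally show ?thesis .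
  qed
  then show ?thesis by blast
qed

section \<open>Weighted Lebesgue spaces\<close>

lemma gauss_density_pos: "gauss_density x > 0"
  by (simp add: gauss_density_def)

lemma gauss_density_le_1: "gauss_density x \<le> 1"
proof -
  have "(2 * pi) powr (- real CARD('a) / 2) \<le> (2 * pi) powr 0"
    using pi_gt3 by (intro powr_mono) auto
  then show ?thesis unfolding gauss_density_def by (intro mult_le_one) auto
qed

lemma gauss_density_measurable [measurable]: "gauss_density \<in> borel_measurable borel"
  by (intro borel_measurable_continuous_onI smooth_continuous_on smooth_gauss_density)

lemma gauss_density_measurable_lebesgue [measurable]: "gauss_density \<in> borel_measurable lebesgue"
  by (intro measurable_completion) simp

lemma sets_gauss_measure: "sets gauss_measure = sets lebesgue"
  by (simp add: gauss_measure_def)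

lemma borel_measurable_gauss_measure: "borel_measurable gauss_measure = borel_measurable lebesgue"
  by (intro measurable_cong_sets sets_gauss_measure refl)

lemma gauss_measure_integral:
  fixes u :: "real ^ 'd \<Rightarrow> real"
  assumes "u \<in> borel_measurable lebesgue"
  shows "integrable gauss_measure u \<longleftrightarrow> integrable lebesgue (\<lambda>x. u x * gauss_density x)"
    and "(LINT x|gauss_measure. u x) = (LINT x|lebesgue. u x * gauss_density x)"
  unfolding gauss_measure_def
  using assms by (simp_all add: integrable_density integral_density gauss_density_pos less_imp_le mult.commute)

lemma Lp_space_gauss_iff:
  fixes u :: "real ^ 'd \<Rightarrow> real"
  shows "u \<in> Lp_space p gauss_measure UNIV \<longleftrightarrow>
     u \<in> borel_measurable lebesgue \<and> integrable lebesgue (\<lambda>x. \<bar>u x\<bar> powr p * gauss_density x)"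
proof -
  have "u \<in> borel_measurable (restrict_space gauss_measure UNIV) \<longleftrightarrow> u \<in> borel_measurable lebesgue"
    by (subst borel_measurable_restrict_space_iff) (auto simp: borel_measurable_gauss_measure)
  then show ?thesis
    by (auto simp: Lp_space_def integrable_restrict_space gauss_measure_integral)
qed

lemma Lp_norm_gauss:
  fixes u :: "real ^ 'd \<Rightarrow> real"
  assumes "u \<in> borel_measurable lebesgue"
  shows "Lp_norm p gauss_measure UNIV u = (LINT x|lebesgue. \<bar>u x\<bar> powr p * gauss_density x) powr (1 / p)"
  using assms by (simp add: Lp_norm_def integral_restrict_space gauss_measure_integral)

lemma unit_cube_sets [measurable, simp]: "unit_cube \<in> sets lebesgue"
  by (simp add: unit_cube_def)

lemma interior_unit_cube: "interior unit_cube = box (\<chi> i. - 1 / 2) (\<chi> i. 1 / 2)"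
  by (simp add: unit_cube_def)

lemma AE_unit_cube_if_AE_interior:
  assumes "AE x in lebesgue. x \<in> interior unit_cube \<longrightarrow> P x"
  shows "AE x in lebesgue. x \<in> unit_cube \<longrightarrow> P (x :: real ^ 'd)"
proof -
  have "AE x in lebesgue. x \<notin> unit_cube - interior (unit_cube :: (real ^ 'd) set)"
    unfolding interior_unit_cube unit_cube_def
    by (intro AE_not_in) (simp add: negligible_frontier_interval flip: negligible_iff_null_sets)
  with assms show ?thesis by eventually_elim auto
qed

text \<open>Weak derivatives on the cube are known only almost everywhere in its interior; membership and norm
  are computed with a convenient representative \<open>h\<close>.\<close>
lemma Lp_unit_cube_AE:
  fixes v h :: "real ^ 'd \<Rightarrow> real"
  assumes eq: "AE x in lebesgue. x \<in> unit_cube \<longrightarrow> v x = h x" and h: "h \<in> borel_measurable lebesgue"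
    and i: "integrable lebesgue (\<lambda>x. indicator unit_cube x * \<bar>h x\<bar> powr p)"
  shows "v \<in> Lp_space p lebesgue unit_cube"
    and "Lp_norm p lebesgue unit_cube v = (LINT x|lebesgue. indicator unit_cube x * \<bar>h x\<bar> powr p) powr (1 / p)"
proof -
  have "(\<lambda>x. h x * indicator unit_cube x) \<in> borel_measurable lebesgue"
    using h by (intro borel_measurable_times borel_measurable_indicator) auto
  then have v: "(\<lambda>x. v x * indicator unit_cube x) \<in> borel_measurable lebesgue"
    by (rule borel_measurable_AE) (use eq in \<open>auto elim!: eventually_mono split: split_indicator\<close>)
  then have "v \<in> borel_measurable (lebesgue_on unit_cube)"
    by (subst borel_measurable_restrict_space_iff) (auto simp: mult.commute)
  have ae: "AE x in lebesgue. indicator unit_cube x * \<bar>h x\<bar> powr p = indicator unit_cube x * \<bar>v x\<bar> powr p"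
    using eq by eventually_elim (auto split: split_indicator)
  have m: "(\<lambda>x. indicator unit_cube x * \<bar>v x\<bar> powr p) \<in> borel_measurable lebesgue"
    by (rule borel_measurable_AE[OF borel_measurable_integrable[OF i] ae])
  have "integrable lebesgue (\<lambda>x. indicator unit_cube x * \<bar>v x\<bar> powr p)"
    using integrable_cong_AE[OF borel_measurable_integrable[OF i] m ae] i by simp
  then show "v \<in> Lp_space p lebesgue unit_cube"
    using \<open>v \<in> borel_measurable (lebesgue_on unit_cube)\<close> by (simp add: Lp_space_def integrable_restrict_space)
  show "Lp_norm p lebesgue unit_cube v = (LINT x|lebesgue. indicator unit_cube x * \<bar>h x\<bar> powr p) powr (1 / p)"
    using integral_cong_AE[OF borel_measurable_integrable[OF i] m ae]
    by (simp add: Lp_norm_def integral_restrict_space)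
qed

section \<open>Sobolev norms of the pieces\<close>

lemma sobolev_weak_deriv:
  assumes "f \<in> sobolev_space \<alpha> p \<mu> \<Omega>" "\<And>i. r i \<le> \<alpha>"
  shows "has_weak_deriv (interior \<Omega>) r f (weak_deriv \<Omega> r f)" "weak_deriv \<Omega> r f \<in> Lp_space p \<mu> \<Omega>"
proof -
  have ex: "\<exists>h. has_weak_deriv (interior \<Omega>) r f h" using assms by (simp add: sobolev_space_def)
  show "has_weak_deriv (interior \<Omega>) r f (weak_deriv \<Omega> r f)"
    unfolding weak_deriv_def by (rule someI_ex[OF ex])
  show "weak_deriv \<Omega> r f \<in> Lp_space p \<mu> \<Omega>" using assms by (simp add: sobolev_space_def)
qed

lemma powr_inverse_powr: "0 < p \<Longrightarrow> 0 \<le> x \<Longrightarrow> (x powr (1 / p)) powr p = (x::real)"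
  "0 < p \<Longrightarrow> 0 \<le> x \<Longrightarrow> (x powr p) powr (1 / p) = (x::real)"
  by (simp_all add: powr_powr)

lemma finite_multi_indices: "finite {r :: 'd::finite \<Rightarrow> nat. \<forall>i. r i \<le> \<alpha>}"
proof -
  have "{r :: 'd \<Rightarrow> nat. \<forall>i. r i \<le> \<alpha>} = (\<Pi>\<^sub>E i\<in>UNIV. {..\<alpha>})"
    by (auto simp: PiE_def Pi_def)
  then show ?thesis by (simp add: finite_PiE)
qed

lemma sobolev_norm_powr:
  "0 < p \<Longrightarrow> sobolev_norm \<alpha> p \<mu> \<Omega> f powr p = (\<Sum>r | \<forall>i. r i \<le> \<alpha>. Lp_norm p \<mu> \<Omega> (weak_deriv \<Omega> r f) powr p)"
  unfolding sobolev_norm_def by (intro powr_inverse_powr sum_nonneg) auto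

text \<open>\<open>|c| \<le> |x| + \<rho>\<close>, and the cross term in the square is absorbed by \<open>2 u v \<le> \<eta> u\<^sup>2 + v\<^sup>2 / \<eta>\<close> with
  \<open>\<eta> = \<delta>' - \<delta>\<close>.\<close>
lemma exp_square_shift_bound:
  assumes "0 < \<delta>" "\<delta> < \<delta>'"
  shows "\<exists>C. \<forall>c x :: real ^ 'd. norm (x - c) \<le> \<rho> \<longrightarrow> - \<delta>' * (norm x)\<^sup>2 \<le> C - \<delta> * (norm c)\<^sup>2"
proof (intro exI allI impI)
  fix c x :: "real ^ 'd" assume le: "norm (x - c) \<le> \<rho>"
  define \<eta> where "\<eta> = \<delta>' - \<delta>"
  have \<eta>: "\<eta> > 0" using assms by (simp add: \<eta>_def)
  have \<rho>: "0 \<le> \<rho>" using le norm_ge_zero order_trans by blast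
  have "norm c \<le> norm x + \<rho>" using le norm_triangle_sub[of c x] by (simp add: norm_minus_commute)
  then have "(norm c)\<^sup>2 \<le> (norm x + \<rho>)\<^sup>2" by (intro power_mono) auto
  then have "\<delta> * (norm c)\<^sup>2 \<le> \<delta> * (norm x + \<rho>)\<^sup>2" using assms by (intro mult_left_mono) auto
  also have "\<dots> = \<delta> * (norm x)\<^sup>2 + 2 * norm x * (\<delta> * \<rho>) + \<delta> * \<rho>\<^sup>2"
    by (simp add: power2_eq_square algebra_simps)
  also have "2 * norm x * (\<delta> * \<rho>) \<le> \<eta> * (norm x)\<^sup>2 + (\<delta> * \<rho>)\<^sup>2 / \<eta>"
  proof -
    have "0 \<le> (\<eta> * norm x - \<delta> * \<rho>)\<^sup>2 / \<eta>" using \<eta> by simp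
    also have "\<dots> = \<eta> * (norm x)\<^sup>2 + (\<delta> * \<rho>)\<^sup>2 / \<eta> - 2 * norm x * (\<delta> * \<rho>)"
      using \<eta> by (simp add: power2_eq_square field_simps)
    finally show ?thesis by simp
  qed
  finally show "- \<delta>' * (norm x)\<^sup>2 \<le> ((\<delta> * \<rho>)\<^sup>2 / \<eta> + \<delta> * \<rho>\<^sup>2) - \<delta> * (norm c)\<^sup>2"
    by (simp add: \<eta>_def algebra_simps)
qed

text \<open>Let \<open>Q = \<Sum>s. |D\<^sup>s f|\<^sup>p\<close>, whose integral against the Gaussian density is \<open>\<parallel>f\<parallel>\<^sup>p\<close>. Each \<open>|D\<^sup>s f|\<close> is at most
  \<open>Q\<^bsup>1/p\<^esup>\<close>, and each derivative of \<open>g\<close> is \<open>O(exp (- (1/2 - e) |x|\<^sup>2))\<close>. So the \<open>p\<close>-th power of any derivative of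
  \<open>f g\<close> is \<open>O(Q exp (- p (1/2 - e) |x|\<^sup>2))\<close>, which equals \<open>O(Q g exp (- p \<delta>' |x|\<^sup>2))\<close> with
  \<open>\<delta>' = (1 - 1/p)/2 - e\<close>. The number \<open>e\<close> is taken so small that \<open>\<delta>' > \<delta>\<close>; the gap pays for replacing \<open>|x|\<close>
  by the norm of the centre \<open>c\<close> of the cube.\<close>
theorem sobolev_gauss_piece:
  fixes \<alpha> :: nat and p \<delta> :: real
  assumes p: "1 < p" and \<delta>: "0 < \<delta>" "\<delta> < (1 - 1 / p) / 2"
  shows "\<exists>C\<ge>0. \<forall>f \<in> sobolev_space \<alpha> p gauss_measure UNIV. \<forall>c :: real ^ 'd.
     (\<lambda>x. f (x + c) * gauss_density (x + c)) \<in> sobolev_space \<alpha> p lebesgue unit_cube \<and>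
     sobolev_norm \<alpha> p lebesgue unit_cube (\<lambda>x. f (x + c) * gauss_density (x + c))
       \<le> C * exp (- \<delta> * (norm c)\<^sup>2) * sobolev_norm \<alpha> p gauss_measure UNIV f"
proof -
  define P where "P = {r :: 'd \<Rightarrow> nat. \<forall>i. r i \<le> \<alpha>}"
  have finP: "finite P" unfolding P_def by (rule finite_multi_indices)
  \<comment> \<open>the gap \<open>q - \<delta>\<close> is shared equally between \<open>e\<close> and \<open>\<delta>' - \<delta>\<close>\<close>
  define q where "q = (1 - 1 / p) / 2"
  define \<delta>' where "\<delta>' = (\<delta> + q) / 2"
  define e where "e = q - \<delta>'"
  have q: "\<delta> < q" "p * (1 / 2 - q) = 1 / 2" using p \<delta> by (auto simp: q_def field_simps)
  have \<delta>': "\<delta> < \<delta>'" and e: "e > 0"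
    using q(1) by (auto simp: e_def \<delta>'_def)
  have e_eq: "p * (1 / 2 - e) = 1 / 2 + p * \<delta>'"
    using q(2) unfolding e_def by (simp add: algebra_simps)
  obtain \<rho> where \<rho>: "\<And>x. x \<in> (unit_cube :: (real ^ 'd) set) \<Longrightarrow> norm x \<le> \<rho>"
    using bounded_cbox unfolding unit_cube_def bounded_iff by blast
  obtain C0 where C0: "\<And>c x :: real ^ 'd. norm (x - c) \<le> \<rho> \<Longrightarrow> - \<delta>' * (norm x)\<^sup>2 \<le> C0 - \<delta> * (norm c)\<^sup>2"
    using exp_square_shift_bound[OF \<delta>(1) \<delta>'] by metis
  obtain B where B: "\<And>r x. \<bar>gauss_deriv r (x :: real ^ 'd)\<bar> \<le> B r * exp (- (1 / 2 - e) * (norm x)\<^sup>2)"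
    using gauss_deriv_bound[OF e] by metis
  define K where "K = (\<Sum>r\<in>P. \<bar>B r\<bar>)"
  have K0: "0 \<le> K" by (simp add: K_def sum_nonneg)
  have K: "\<bar>gauss_deriv r x\<bar> \<le> K * exp (- (1 / 2 - e) * (norm x)\<^sup>2)" if "r \<in> P" for r x
  proof -
    have "B r \<le> K" unfolding K_def using member_le_sum[OF that, of "\<lambda>r. \<bar>B r\<bar>"] finP by fastforce
    then have "B r * exp (- (1 / 2 - e) * (norm x)\<^sup>2) \<le> K * exp (- (1 / 2 - e) * (norm x)\<^sup>2)"
      by (intro mult_right_mono) auto
    with B[of r x] show ?thesis by linarith
  qed
  obtain js :: "('d \<Rightarrow> nat) \<Rightarrow> 'd list" where js: "\<And>r. count_list (js r) = r"
    using exists_list_with_counts by metis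
  define N where "N = (\<Sum>r\<in>P. real (length (splits (js r))))"
  have N: "real (length (splits (js r))) \<le> N" if "r \<in> P" for r
    unfolding N_def using member_le_sum[OF that, of "\<lambda>r. real (length (splits (js r)))"] finP by simp
  have N0: "0 \<le> N" by (simp add: N_def sum_nonneg)
  define M where "M = (N * K) powr p * (2 * pi) powr (real CARD('d) / 2) * exp (p * C0)"
  have M0: "0 \<le> M" by (simp add: M_def)
  have splitsP: "count_list as \<in> P" "count_list bs \<in> P" if "(as, bs) \<in> set (splits (js r))" "r \<in> P" for as bs r
  proof -
    have "count_list as i + count_list bs i \<le> \<alpha>" for i
      using splits_count[OF that(1), of i] that(2) by (simp add: js P_def)
    then show "count_list as \<in> P" "count_list bs \<in> P"
      unfolding P_def by (auto intro: add_leD1 add_leD2)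
  qed

  show ?thesis
  proof (intro exI[of _ "(real (card P) * M) powr (1 / p)"] conjI ballI allI)
    show "0 \<le> (real (card P) * M) powr (1 / p)" by simp
    fix f :: "real ^ 'd \<Rightarrow> real" and c :: "real ^ 'd"
    assume f: "f \<in> sobolev_space \<alpha> p gauss_measure UNIV"
    define W where "W r = weak_deriv UNIV r f" for r
    have W: "has_weak_deriv UNIV r f (W r)" "W r \<in> borel_measurable lebesgue"
        "integrable lebesgue (\<lambda>x. \<bar>W r x\<bar> powr p * gauss_density x)" if "r \<in> P" for r
      using sobolev_weak_deriv[OF f, of r] that by (auto simp: W_def P_def Lp_space_gauss_iff)
    define Q where "Q x = (\<Sum>r\<in>P. \<bar>W r x\<bar> powr p)" for x
    have Q0: "0 \<le> Q x" for x by (simp add: Q_def sum_nonneg)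
    have WQ: "\<bar>W r x\<bar> \<le> Q x powr (1 / p)" if "r \<in> P" for r x
    proof -
      have "\<bar>W r x\<bar> powr p \<le> Q x" unfolding Q_def using that finP by (intro member_le_sum) auto
      then have "(\<bar>W r x\<bar> powr p) powr (1 / p) \<le> Q x powr (1 / p)" using p by (intro powr_mono2) auto
      then show ?thesis using p by (simp add: powr_inverse_powr)
    qed
    define S where "S = sobolev_norm \<alpha> p gauss_measure UNIV f"
    have S0: "0 \<le> S" by (simp add: S_def sobolev_norm_def)
    have Q_int: "integrable lebesgue (\<lambda>x. Q x * gauss_density x)"
      unfolding Q_def sum_distrib_right by (intro Bochner_Integration.integrable_sum W)
    have S: "(LINT x|lebesgue. Q x * gauss_density x) = S powr p"
    proof -
      have "S powr p = (\<Sum>r\<in>P. Lp_norm p gauss_measure UNIV (W r) powr p)"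
        unfolding S_def W_def P_def using p by (intro sobolev_norm_powr) auto
      also have "\<dots> = (\<Sum>r\<in>P. LINT x|lebesgue. \<bar>W r x\<bar> powr p * gauss_density x)"
        using p by (intro sum.cong refl)
          (simp add: Lp_norm_gauss W powr_inverse_powr integral_nonneg_AE gauss_density_pos less_imp_le)
      also have "\<dots> = (LINT x|lebesgue. Q x * gauss_density x)"
        unfolding Q_def sum_distrib_right by (intro Bochner_Integration.integral_sum[symmetric] W)
      finally show ?thesis ..
    qed

    define L where "L r x = (\<Sum>(as, bs)\<leftarrow>splits (js r). W (count_list as) x * gauss_deriv (count_list bs) x)" for r x
    have L: "has_weak_deriv UNIV r (\<lambda>x. f x * gauss_density x) (L r)" if "r \<in> P" for r
      unfolding L_def
    proof (rule weak_leibniz_gauss[OF open_UNIV _ js])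
      fix s assume "\<And>i. s i \<le> r i"
      then have "s \<in> P" using that by (auto simp: P_def intro: order_trans)
      then show "has_weak_deriv UNIV s f (W s)" by (rule W)
    qed
    have L_meas: "L r \<in> borel_measurable lebesgue" if "r \<in> P" for r
    proof -
      have "(\<lambda>x. \<Sum>(as, bs)\<leftarrow>ys. W (count_list as) x * gauss_deriv (count_list bs) x) \<in> borel_measurable lebesgue"
        if "\<And>as bs. (as, bs) \<in> set ys \<Longrightarrow> count_list as \<in> P" for ys
        using that
      proof (induction ys)
        case (Cons y ys)
        obtain as bs where y: "y = (as, bs)" by fastforce
        have "gauss_deriv (count_list bs) \<in> borel_measurable lebesgue"
          by (intro measurable_completion) (auto intro!: borel_measurable_continuous_onI smooth_continuous_on smooth_gauss_deriv)
        moreover have "W (count_list as) \<in> borel_measurable lebesgue"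
          using Cons.prems[of as bs] y by (intro W) auto
        ultimately show ?case using Cons y by (auto intro!: borel_measurable_add borel_measurable_times)
      qed simp
      from this[of "splits (js r)"] show ?thesis unfolding L_def using splitsP(1) that by blast
    qed
    have L_bound: "\<bar>L r (x + c)\<bar> powr p \<le> M * exp (- p * \<delta> * (norm c)\<^sup>2) * (Q (x + c) * gauss_density (x + c))"
      if r: "r \<in> P" and x: "x \<in> unit_cube" for r x
    proof -
      define z where "z = x + c"
      have "\<bar>L r z\<bar> \<le> (\<Sum>y\<leftarrow>splits (js r). \<bar>W (count_list (fst y)) z * gauss_deriv (count_list (snd y)) z\<bar>)"
        using sum_list_abs[of "map (\<lambda>y. W (count_list (fst y)) z * gauss_deriv (count_list (snd y)) z) (splits (js r))"]
        by (simp add: L_def split_def o_def)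
      also have "\<dots> \<le> (\<Sum>y\<leftarrow>splits (js r). Q z powr (1 / p) * (K * exp (- (1 / 2 - e) * (norm z)\<^sup>2)))"
        unfolding abs_mult
        by (intro sum_list_mono mult_mono WQ K) (use splitsP r in auto)
      also have "\<dots> = real (length (splits (js r))) * (Q z powr (1 / p) * (K * exp (- (1 / 2 - e) * (norm z)\<^sup>2)))"
        by (simp add: sum_list_triv)
      also have "\<dots> \<le> N * (Q z powr (1 / p) * (K * exp (- (1 / 2 - e) * (norm z)\<^sup>2)))"
        using N[OF r] K0 by (intro mult_right_mono) auto
      finally have "\<bar>L r z\<bar> powr p \<le> ((N * K) * Q z powr (1 / p) * exp (- (1 / 2 - e) * (norm z)\<^sup>2)) powr p"
        using p by (intro powr_mono2) (auto simp: mult_ac)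
      also have "\<dots> = (N * K) powr p * Q z * exp (- p * (1 / 2 - e) * (norm z)\<^sup>2)"
      proof -
        have "exp (- (1 / 2 - e) * (norm z)\<^sup>2) powr p = exp (- p * (1 / 2 - e) * (norm z)\<^sup>2)"
          unfolding exp_powr_real by (simp add: algebra_simps)
        then show ?thesis using p N0 K0 Q0[of z] powr_inverse_powr(1)[of p "Q z"]
          by (simp only: powr_mult mult_nonneg_nonneg powr_ge_zero exp_ge_zero)
      qed
      also have "exp (- p * (1 / 2 - e) * (norm z)\<^sup>2) = exp (- (norm z)\<^sup>2 / 2) * exp (p * (- \<delta>' * (norm z)\<^sup>2))"
      proof -
        have "- p * (1 / 2 - e) * (norm z)\<^sup>2 = - (p * (1 / 2 - e)) * (norm z)\<^sup>2" by simp
        also have "\<dots> = - (norm z)\<^sup>2 / 2 + p * (- \<delta>' * (norm z)\<^sup>2)"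
          unfolding e_eq by (simp add: algebra_simps)
        finally have "- p * (1 / 2 - e) * (norm z)\<^sup>2 = - (norm z)\<^sup>2 / 2 + p * (- \<delta>' * (norm z)\<^sup>2)" .
        then show ?thesis by (simp only: exp_add)
      qed
      also have "exp (- (norm z)\<^sup>2 / 2) = (2 * pi) powr (real CARD('d) / 2) * gauss_density z"
        by (simp add: gauss_density_def powr_minus mult.assoc[symmetric] powr_add[symmetric])
      finally have 1: "\<bar>L r z\<bar> powr p \<le> (N * K) powr p * Q z *
         ((2 * pi) powr (real CARD('d) / 2) * gauss_density z * exp (p * (- \<delta>' * (norm z)\<^sup>2)))" .
      have "p * (- \<delta>' * (norm z)\<^sup>2) \<le> p * (C0 - \<delta> * (norm c)\<^sup>2)"
        using p \<rho>[OF x] by (intro mult_left_mono C0) (auto simp: z_def)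
      then have "exp (p * (- \<delta>' * (norm z)\<^sup>2)) \<le> exp (p * C0) * exp (- p * \<delta> * (norm c)\<^sup>2)"
        by (simp add: exp_add[symmetric] algebra_simps)
      then have "(N * K) powr p * Q z * ((2 * pi) powr (real CARD('d) / 2) * gauss_density z * exp (p * (- \<delta>' * (norm z)\<^sup>2)))
        \<le> (N * K) powr p * Q z * ((2 * pi) powr (real CARD('d) / 2) * gauss_density z * (exp (p * C0) * exp (- p * \<delta> * (norm c)\<^sup>2)))"
        using Q0[of z] by (intro mult_left_mono) (auto simp: gauss_density_pos less_imp_le)
      with 1 show ?thesis by (simp add: M_def z_def mult_ac)
    qed

    let ?u = "\<lambda>x. f (x + c) * gauss_density (x + c)"
    have QI: "integrable lebesgue (\<lambda>x. Q (x + c) * gauss_density (x + c))"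
      using lebesgue_integrable_translation[OF Q_int, of c] .
    have Lc_meas: "(\<lambda>x. L r (x + c)) \<in> borel_measurable lebesgue" if "r \<in> P" for r
      using measurable_compose[OF lebesgue_translation(2) L_meas[OF that], of c] .
    have L_int: "integrable lebesgue (\<lambda>x. indicator unit_cube x * \<bar>L r (x + c)\<bar> powr p)" (is ?I)
      and L_le: "(LINT x|lebesgue. indicator unit_cube x * \<bar>L r (x + c)\<bar> powr p) \<le> M * exp (- p * \<delta> * (norm c)\<^sup>2) * S powr p" (is ?L)
      if r: "r \<in> P" for r
    proof -
      have b: "indicator unit_cube x * \<bar>L r (x + c)\<bar> powr p \<le> M * exp (- p * \<delta> * (norm c)\<^sup>2) * (Q (x + c) * gauss_density (x + c))" for x
        using L_bound[OF r, of x] M0 Q0[of "x + c"] by (auto simp: gauss_density_pos less_imp_le split: split_indicator)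
      show ?I
      proof (rule Bochner_Integration.integrable_bound[OF integrable_mult_right[OF QI, of "M * exp (- p * \<delta> * (norm c)\<^sup>2)"]])
        show "(\<lambda>x. indicator unit_cube x * \<bar>L r (x + c)\<bar> powr p) \<in> borel_measurable lebesgue"
          using Lc_meas[OF r] by (intro borel_measurable_times borel_measurable_indicator powr_real_measurable) auto
        show "AE x in lebesgue. norm (indicator unit_cube x * \<bar>L r (x + c)\<bar> powr p)
            \<le> norm (M * exp (- p * \<delta> * (norm c)\<^sup>2) * (Q (x + c) * gauss_density (x + c)))"
        proof (rule AE_I2)
          fix x
          have "0 \<le> indicator unit_cube x * \<bar>L r (x + c)\<bar> powr p" by simp
          with b[of x] show "norm (indicator unit_cube x * \<bar>L r (x + c)\<bar> powr p)
            \<le> norm (M * exp (- p * \<delta> * (norm c)\<^sup>2) * (Q (x + c) * gauss_density (x + c)))"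
            unfolding real_norm_def by linarith
        qed
      qed
      have "(LINT x|lebesgue. indicator unit_cube x * \<bar>L r (x + c)\<bar> powr p)
         \<le> (LINT x|lebesgue. M * exp (- p * \<delta> * (norm c)\<^sup>2) * (Q (x + c) * gauss_density (x + c)))"
        by (rule integral_mono[OF \<open>?I\<close> integrable_mult_right[OF QI] b])
      also have "\<dots> = M * exp (- p * \<delta> * (norm c)\<^sup>2) * (LINT x|lebesgue. Q (x + c) * gauss_density (x + c))"
        by (rule integral_mult_right_zero)
      also have "(LINT x|lebesgue. Q (x + c) * gauss_density (x + c)) = S powr p"
        using lebesgue_integral_translation[OF borel_measurable_integrable[OF Q_int], of c] S by simp
      finally show ?L .
    qed
    have weak_u: "has_weak_deriv (interior unit_cube) r ?u (\<lambda>x. L r (x + c))" if "r \<in> P" for r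
      by (rule has_weak_deriv_translation[OF L[OF that] open_interior])
    have ae: "AE x in lebesgue. x \<in> unit_cube \<longrightarrow> weak_deriv unit_cube r ?u x = L r (x + c)" if "r \<in> P" for r
    proof (rule AE_unit_cube_if_AE_interior, rule has_weak_deriv_unique[OF open_interior _ weak_u[OF that]])
      show "has_weak_deriv (interior unit_cube) r ?u (weak_deriv unit_cube r ?u)"
        unfolding weak_deriv_def
        by (rule someI[of "has_weak_deriv (interior unit_cube) r ?u", OF weak_u[OF that]])
    qed
    have Lp: "weak_deriv unit_cube r ?u \<in> Lp_space p lebesgue unit_cube"
      "Lp_norm p lebesgue unit_cube (weak_deriv unit_cube r ?u) powr p \<le> M * exp (- p * \<delta> * (norm c)\<^sup>2) * S powr p"
      if "r \<in> P" for r
      using Lp_unit_cube_AE[OF ae[OF that] Lc_meas[OF that] L_int[OF that]] L_le[OF that] p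
      by (auto simp: powr_inverse_powr integral_nonneg_AE)
    have fLp: "f \<in> borel_measurable lebesgue" "integrable lebesgue (\<lambda>x. \<bar>f x\<bar> powr p * gauss_density x)"
      using f by (auto simp: sobolev_space_def Lp_space_gauss_iff)
    have u_meas: "?u \<in> borel_measurable lebesgue"
      using measurable_compose[OF lebesgue_translation(2), of "\<lambda>x. f x * gauss_density x" borel c]
        fLp(1) by (auto intro!: borel_measurable_times)
    have u_Lp: "?u \<in> Lp_space p lebesgue unit_cube"
    proof (rule Lp_unit_cube_AE(1)[OF _ u_meas])
      have I: "integrable lebesgue (\<lambda>x. \<bar>f (x + c)\<bar> powr p * gauss_density (x + c))"
        using lebesgue_integrable_translation[OF fLp(2)] .
      show "integrable lebesgue (\<lambda>x. indicator unit_cube x * \<bar>?u x\<bar> powr p)"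
      proof (rule Bochner_Integration.integrable_bound[OF I])
        show "(\<lambda>x. indicator unit_cube x * \<bar>?u x\<bar> powr p) \<in> borel_measurable lebesgue"
          using u_meas by (intro borel_measurable_times[OF borel_measurable_indicator] powr_real_measurable borel_measurable_abs) auto
        show "AE x in lebesgue. norm (indicator unit_cube x * \<bar>?u x\<bar> powr p) \<le> norm (\<bar>f (x + c)\<bar> powr p * gauss_density (x + c))"
        proof (rule AE_I2)
          fix x
          have "gauss_density (x + c) powr p \<le> gauss_density (x + c) powr 1"
            using p by (intro powr_mono') (auto simp: gauss_density_pos less_imp_le gauss_density_le_1)
          then have "\<bar>?u x\<bar> powr p \<le> \<bar>f (x + c)\<bar> powr p * gauss_density (x + c)"
            using gauss_density_pos[of "x + c"] by (simp add: abs_mult powr_mult mult_left_mono)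
          then show "norm (indicator unit_cube x * \<bar>?u x\<bar> powr p) \<le> norm (\<bar>f (x + c)\<bar> powr p * gauss_density (x + c))"
            using gauss_density_pos[of "x + c"] by (auto split: split_indicator)
        qed
      qed
    qed simp
    show "?u \<in> sobolev_space \<alpha> p lebesgue unit_cube"
      unfolding sobolev_space_def using u_Lp weak_u Lp(1) by (auto simp: P_def)
    have "sobolev_norm \<alpha> p lebesgue unit_cube ?u
       \<le> (\<Sum>r\<in>P. M * exp (- p * \<delta> * (norm c)\<^sup>2) * S powr p) powr (1 / p)"
      unfolding sobolev_norm_def P_def[symmetric] using p
      by (intro powr_mono2 sum_mono Lp(2) sum_nonneg) auto
    also have "\<dots> = (real (card P) * M) powr (1 / p) * exp (- \<delta> * (norm c)\<^sup>2) * S"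
    proof -
      have "exp (- p * \<delta> * (norm c)\<^sup>2) powr (1 / p) = exp (- \<delta> * (norm c)\<^sup>2)"
        using p by (simp add: exp_powr_real)
      then show ?thesis
        using p S0 M0 by (simp add: powr_mult powr_inverse_powr mult.assoc[symmetric])
    qed
    finally show "sobolev_norm \<alpha> p lebesgue unit_cube ?u
       \<le> (real (card P) * M) powr (1 / p) * exp (- \<delta> * (norm c)\<^sup>2) * sobolev_norm \<alpha> p gauss_measure UNIV f"
      by (simp add: S_def)
  qed
qed

section \<open>Gaussian sums over the lattice\<close>

definition lattice_box :: "nat \<Rightarrow> (int ^ 'd) set" where
  "lattice_box M = {k. \<forall>i. \<bar>k $ i\<bar> \<le> int M}"

lemma norm_int_vec_square: "(norm (int_vec k))\<^sup>2 = (\<Sum>i\<in>UNIV. (real_of_int (k $ i))\<^sup>2)"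
  by (simp add: norm_vec_def L2_set_def sum_nonneg int_vec_def)

lemma sum_lattice_box:
  "(\<Sum>k\<in>lattice_box M. F k) = (\<Sum>g\<in>(\<Pi>\<^sub>E i\<in>UNIV. {- int M..int M}). F (vec_lambda g))"
  by (rule sum.reindex_bij_witness[of _ vec_lambda vec_nth])
     (auto simp: lattice_box_def PiE_def Pi_def abs_le_iff minus_le_iff vec_lambda_inverse)

lemma finite_lattice_box: "finite (lattice_box M :: (int ^ 'd) set)"
proof -
  have "lattice_box M \<subseteq> vec_lambda ` (\<Pi>\<^sub>E i\<in>UNIV. {- int M..int M} :: ('d \<Rightarrow> int) set)"
  proof
    fix k :: "int ^ 'd" assume "k \<in> lattice_box M"
    then have "vec_nth k \<in> (\<Pi>\<^sub>E i\<in>UNIV. {- int M..int M})"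
      by (auto simp: lattice_box_def PiE_def Pi_def abs_le_iff minus_le_iff)
    then show "k \<in> vec_lambda ` (\<Pi>\<^sub>E i\<in>UNIV. {- int M..int M})" by (metis image_eqI vec_nth_inverse)
  qed
  then show ?thesis by (rule finite_subset) (simp add: finite_PiE)
qed

lemma lattice_box_mono: "M \<le> N \<Longrightarrow> lattice_box M \<subseteq> lattice_box N"
  unfolding lattice_box_def by (auto intro: order_trans)

lemma in_lattice_box:
  fixes k :: "int ^ 'd"
  assumes "norm (int_vec k) \<le> real M"
  shows "k \<in> lattice_box M"
proof -
  have "real_of_int \<bar>k $ i\<bar> \<le> real M" for i
    using component_le_norm_cart[of "int_vec k" i] assms by (simp add: int_vec_def)
  then have "\<bar>k $ i\<bar> \<le> int M" for i by (metis of_int_le_iff of_int_of_nat_eq)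
  then show ?thesis by (simp add: lattice_box_def)
qed

text \<open>Since \<open>j\<^sup>2 \<ge> |j|\<close>, the sum is dominated by two geometric series with ratio \<open>exp (- c)\<close>.\<close>
lemma sum_exp_neg_square_le:
  fixes c :: real
  assumes "c > 0"
  shows "(\<Sum>j\<in>{- int M..int M}. exp (- c * (real_of_int j)\<^sup>2)) \<le> 2 / (1 - exp (- c))"
proof -
  let ?f = "\<lambda>j. exp (- c * (real_of_int j)\<^sup>2)"
  define q where "q = exp (- c)"
  have q: "0 < q" "q < 1" using assms by (auto simp: q_def)
  have f: "?f j \<le> q ^ nat \<bar>j\<bar>" for j
  proof -
    have "\<bar>j\<bar> * 1 \<le> \<bar>j\<bar> * \<bar>j\<bar>"
      using mult_left_mono[of 1 "\<bar>j\<bar>" "\<bar>j\<bar>"] by (cases "j = 0") auto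
    then have "\<bar>j\<bar> \<le> j\<^sup>2" by (simp add: power2_eq_square)
    then have "real_of_int \<bar>j\<bar> \<le> (real_of_int j)\<^sup>2" by (metis of_int_le_iff of_int_power)
    then have "- c * (real_of_int j)\<^sup>2 \<le> real (nat \<bar>j\<bar>) * - c" using assms by simp
    then have "?f j \<le> exp (real (nat \<bar>j\<bar>) * - c)" by simp
    also have "\<dots> = q ^ nat \<bar>j\<bar>" unfolding q_def by (rule exp_of_nat_mult)
    finally show ?thesis .
  qed
  have geo: "(\<Sum>m\<le>M. q ^ m) \<le> 1 / (1 - q)"
    using q by (simp add: sum_gp0 divide_right_mono)
  have "(\<Sum>j\<in>{- int M..int M}. ?f j) \<le> (\<Sum>j\<in>int ` {..M} \<union> (\<lambda>m. - int m) ` {..M}. ?f j)"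
  proof (rule sum_mono2)
    show "{- int M..int M} \<subseteq> int ` {..M} \<union> (\<lambda>m. - int m) ` {..M}"
    proof
      fix j assume "j \<in> {- int M..int M}"
      then show "j \<in> int ` {..M} \<union> (\<lambda>m. - int m) ` {..M}"
        by (cases j) (auto intro!: image_eqI[of _ _ "nat (- j)"])
    qed
  qed auto
  also have "\<dots> \<le> (\<Sum>j\<in>int ` {..M}. ?f j) + (\<Sum>j\<in>(\<lambda>m. - int m) ` {..M}. ?f j)"
    by (subst sum.union_inter[symmetric]) (auto intro!: sum_nonneg)
  also have "\<dots> = (\<Sum>m\<le>M. ?f (int m)) + (\<Sum>m\<le>M. ?f (- int m))"
    by (simp add: sum.reindex inj_on_def)
  also have "\<dots> \<le> (\<Sum>m\<le>M. q ^ m) + (\<Sum>m\<le>M. q ^ m)"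
    using f[of "int _"] f[of "- int _"] by (intro add_mono sum_mono) (metis abs_of_nat nat_int, metis abs_minus_cancel abs_of_nat nat_int)
  also have "\<dots> \<le> 2 / (1 - q)" using geo by simp
  finally show ?thesis by (simp add: q_def)
qed

text \<open>The Gaussian is a tensor product, so its sum over a box of lattice points is a product of sums.\<close>
theorem lattice_gaussian_sum_le:
  fixes c :: real and F :: "(int ^ 'd) set"
  assumes c: "c > 0" and F: "F \<subseteq> lattice_box M"
  shows "(\<Sum>k\<in>F. exp (- c * (norm (int_vec k))\<^sup>2)) \<le> (2 / (1 - exp (- c))) ^ CARD('d)"
proof -
  have "(\<Sum>k\<in>F. exp (- c * (norm (int_vec k))\<^sup>2)) \<le> (\<Sum>k\<in>(lattice_box M :: (int ^ 'd) set). exp (- c * (norm (int_vec k))\<^sup>2))"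
    by (intro sum_mono2 finite_lattice_box F) auto
  also have "\<dots> = (\<Sum>g\<in>(\<Pi>\<^sub>E i\<in>(UNIV :: 'd set). {- int M..int M}). \<Prod>i\<in>UNIV. exp (- c * (real_of_int (g i))\<^sup>2))"
    unfolding sum_lattice_box norm_int_vec_square by (simp add: sum_distrib_left exp_sum)
  also have "\<dots> = (\<Prod>i\<in>(UNIV :: 'd set). \<Sum>j\<in>{- int M..int M}. exp (- c * (real_of_int j)\<^sup>2))"
    by (rule prod_sum_PiE[symmetric]) auto
  also have "\<dots> \<le> (\<Prod>i\<in>(UNIV :: 'd set). 2 / (1 - exp (- c)))"
    by (intro prod_mono conjI sum_exp_neg_square_le[OF c] sum_nonneg) auto
  finally show ?thesis by simp
qed

section \<open>Cutting space into unit cubes\<close>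

text \<open>The half-open cubes \<open>H + k\<close> partition the space, the cube containing \<open>x\<close> being found by rounding its
  coordinates; they differ from the closed ones by null sets. Exhausting the space by boxes of lattice
  points gives the limit by dominated convergence.\<close>
lemma unit_cube_decomposition:
  fixes u :: "real ^ 'd \<Rightarrow> real"
  assumes u: "integrable lebesgue u"
  shows "(\<lambda>M. \<Sum>k\<in>lattice_box M. LINT x|lebesgue_on unit_cube. u (x + int_vec k)) \<longlonglongrightarrow> (LINT x|lebesgue. u x)"
proof -
  define H :: "(real ^ 'd) set" where "H = {x. \<forall>i. - 1 / 2 \<le> x $ i \<and> x $ i < 1 / 2}"
  have [measurable]: "H \<in> sets borel" unfolding H_def by measurable
  then have H: "H \<in> sets lebesgue" by (simp add: sets_completionI_sets)
  define K :: "real ^ 'd \<Rightarrow> int ^ 'd" where "K x = (\<chi> i. \<lfloor>x $ i + 1 / 2\<rfloor>)" for x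
  have HK: "x - int_vec k \<in> H \<longleftrightarrow> k = K x" for x k
  proof -
    have "x - int_vec k \<in> H \<longleftrightarrow> (\<forall>i. \<lfloor>x $ i + 1 / 2\<rfloor> = k $ i)"
    proof -
      have "(- 1 / 2 \<le> x $ i - real_of_int (k $ i) \<and> x $ i - real_of_int (k $ i) < 1 / 2) \<longleftrightarrow> \<lfloor>x $ i + 1 / 2\<rfloor> = k $ i" for i
        unfolding floor_eq_iff by (intro iffI conjI; elim conjE; linarith)
      then show ?thesis by (simp add: H_def int_vec_def)
    qed
    then show ?thesis by (auto simp: K_def vec_eq_iff)
  qed
  have Hu: "integrable lebesgue (\<lambda>x. indicator H (x - int_vec k) * u x)" for k
  proof (rule Bochner_Integration.integrable_bound[OF u])
    have "(\<lambda>x. indicator H (x - int_vec k) :: real) \<in> borel_measurable lebesgue"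
      by (intro measurable_completion) measurable
    then show "(\<lambda>x. indicator H (x - int_vec k) * u x) \<in> borel_measurable lebesgue"
      using u by (intro borel_measurable_times) auto
  qed (auto split: split_indicator)
  have piece: "(LINT x|lebesgue. indicator H (x - int_vec k) * u x) = (LINT x|lebesgue_on unit_cube. u (x + int_vec k))" for k
  proof -
    have uk: "integrable lebesgue (\<lambda>x. u (x + int_vec k))" by (rule lebesgue_integrable_translation[OF u])
    have "(LINT x|lebesgue. indicator H (x - int_vec k) * u x) = (LINT x|lebesgue. indicator H x * u (x + int_vec k))"
      using lebesgue_integral_translation[OF borel_measurable_integrable[OF Hu[of k]], of "int_vec k"] by simp
    also have "\<dots> = (LINT x|lebesgue. indicator unit_cube x * u (x + int_vec k))"
    proof (rule integral_cong_AE)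
      have "box (\<chi> i. - 1 / 2) (\<chi> i. 1 / 2) \<subseteq> H" "H \<subseteq> unit_cube"
        by (auto simp: H_def unit_cube_def mem_box_cart less_imp_le)
      moreover have "AE x in lebesgue. x \<notin> unit_cube - interior (unit_cube :: (real ^ 'd) set)"
        unfolding interior_unit_cube unit_cube_def
        by (intro AE_not_in) (simp add: negligible_frontier_interval flip: negligible_iff_null_sets)
      ultimately show "AE x in lebesgue. indicator H x * u (x + int_vec k) = indicator unit_cube x * u (x + int_vec k)"
        unfolding interior_unit_cube by (elim eventually_mono) (auto split: split_indicator)
    qed (use H uk in \<open>auto intro!: borel_measurable_times borel_measurable_indicator\<close>)
    also have "\<dots> = (LINT x|lebesgue_on unit_cube. u (x + int_vec k))"
      by (subst integral_restrict_space) auto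
    finally show ?thesis .
  qed
  have "(\<lambda>M. LINT x|lebesgue. (\<Sum>k\<in>lattice_box M. indicator H (x - int_vec k) * u x)) \<longlonglongrightarrow> (LINT x|lebesgue. u x)"
  proof (rule integral_dominated_convergence[where w = "\<lambda>x. \<bar>u x\<bar>"])
    have eq: "(\<Sum>k\<in>lattice_box M. indicator H (x - int_vec k) * u x) = (if K x \<in> lattice_box M then u x else 0)" for M x
    proof -
      have "(\<Sum>k\<in>lattice_box M. indicator H (x - int_vec k) * u x) = (\<Sum>k\<in>lattice_box M. if k = K x then u x else 0)"
        by (intro sum.cong refl) (simp add: indicator_def HK)
      then show ?thesis by (simp add: sum.delta' finite_lattice_box)
    qed
    show "AE x in lebesgue. (\<lambda>M. \<Sum>k\<in>lattice_box M. indicator H (x - int_vec k) * u x) \<longlonglongrightarrow> u x"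
    proof (intro AE_I2 tendsto_eventually)
      fix x
      have "K x \<in> lattice_box (nat \<lceil>norm (int_vec (K x))\<rceil>)" by (rule in_lattice_box) linarith
      then have "K x \<in> lattice_box M" if "M \<ge> nat \<lceil>norm (int_vec (K x))\<rceil>" for M
        using lattice_box_mono[OF that] by blast
      then show "\<forall>\<^sub>F M in sequentially. (\<Sum>k\<in>lattice_box M. indicator H (x - int_vec k) * u x) = u x"
        unfolding eq by (intro eventually_sequentiallyI[of "nat \<lceil>norm (int_vec (K x))\<rceil>"]) simp
    qed
    show "AE x in lebesgue. norm (\<Sum>k\<in>lattice_box M. indicator H (x - int_vec k) * u x) \<le> \<bar>u x\<bar>" for M
      unfolding eq by simp
    show "(\<lambda>x. \<Sum>k\<in>lattice_box M. indicator H (x - int_vec k) * u x) \<in> borel_measurable lebesgue" for M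
      by (intro borel_measurable_sum borel_measurable_integrable Hu)
  qed (use u in auto)
  also have "(\<lambda>M. LINT x|lebesgue. (\<Sum>k\<in>lattice_box M. indicator H (x - int_vec k) * u x))
     = (\<lambda>M. \<Sum>k\<in>lattice_box M. LINT x|lebesgue_on unit_cube. u (x + int_vec k))"
    by (simp add: piece Bochner_Integration.integral_sum Hu)
  finally show ?thesis .
qed

section \<open>Integrals and point values\<close>

lemma integrable_gauss_density: "integrable lebesgue (gauss_density :: real ^ 'd \<Rightarrow> real)"
proof -
  have "integrable lborel gauss1"
    using integrable_std_normal_moment[of 0] by (simp add: gauss1_def[abs_def] normal_density_def inverse_eq_divide)
  then have "integrable lborel (gauss_density :: real ^ 'd \<Rightarrow> real)"
    unfolding gauss_density_eq_tensor by (intro integral_tensor_nonneg) (auto simp: gauss1_def)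
  then show ?thesis using integrable_completion[of "gauss_density :: real ^ 'd \<Rightarrow> real" lborel] by simp
qed

lemma Lp_gauss_integrable:
  fixes f :: "real ^ 'd \<Rightarrow> real"
  assumes p: "1 < p" and f: "f \<in> Lp_space p gauss_measure UNIV"
  shows "integrable lebesgue (\<lambda>x. f x * gauss_density x)"
proof (rule Bochner_Integration.integrable_bound)
  have f: "f \<in> borel_measurable lebesgue" "integrable lebesgue (\<lambda>x. \<bar>f x\<bar> powr p * gauss_density x)"
    using f by (auto simp: Lp_space_gauss_iff)
  show "integrable lebesgue (\<lambda>x. gauss_density x + \<bar>f x\<bar> powr p * gauss_density x)"
    by (intro Bochner_Integration.integrable_add integrable_gauss_density f)
  show "(\<lambda>x. f x * gauss_density x) \<in> borel_measurable lebesgue" using f by (intro borel_measurable_times) auto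
  have "\<bar>t\<bar> \<le> 1 + \<bar>t\<bar> powr p" for t :: real
  proof (cases "\<bar>t\<bar> \<le> 1")
    case True
    moreover have "0 \<le> \<bar>t\<bar> powr p" by simp
    ultimately show ?thesis by linarith
  next
    case False
    then have "\<bar>t\<bar> powr 1 \<le> \<bar>t\<bar> powr p" using p by (intro powr_mono) auto
    then show ?thesis using False by simp
  qed
  then have "\<bar>f x\<bar> * gauss_density x \<le> (1 + \<bar>f x\<bar> powr p) * gauss_density x" for x
    by (intro mult_right_mono) (auto simp: gauss_density_pos less_imp_le)
  moreover have "0 \<le> (1 + \<bar>f x\<bar> powr p) * gauss_density x" for x
    by (auto simp: gauss_density_pos less_imp_le)
  ultimately show "AE x in lebesgue. norm (f x * gauss_density x) \<le> norm (gauss_density x + \<bar>f x\<bar> powr p * gauss_density x)"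
    by (intro AE_I2) (simp add: abs_mult gauss_density_pos less_imp_le distrib_right)
qed

text \<open>A pointwise substitute for Hoelder's inequality: integrated over a set of measure one with \<open>A\<close> equal to
  the \<open>L\<^sub>p\<close> norm of \<open>t\<close> it bounds the \<open>L\<^sub>1\<close> norm by \<open>2 A\<close>.\<close>
lemma le_add_powr:
  fixes A t p :: real
  assumes "1 < p" "0 < A" "0 \<le> t"
  shows "t \<le> A + A powr (1 - p) * t powr p"
proof (cases "t \<le> A")
  case True
  then show ?thesis by (simp add: add_increasing2)
next
  case False
  then have "t powr (1 - p) \<le> A powr (1 - p)" using assms by (intro powr_mono2') auto
  then have "t powr (1 - p) * t powr p \<le> A powr (1 - p) * t powr p" by (intro mult_right_mono) auto
  moreover have "t powr (1 - p) * t powr p = t" using False assms by (simp flip: powr_add)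
  ultimately show ?thesis using assms by simp
qed

text \<open>The norm is defined through \<open>weak_deriv\<close>, so the function itself first has to be identified with its weak
  derivative of order zero. The number \<open>A\<close> runs through all values above the norm, which may be zero.\<close>
lemma abs_integral_unit_cube_le:
  fixes u :: "real ^ 'd \<Rightarrow> real"
  assumes p: "1 < p" and u: "u \<in> sobolev_space \<alpha> p lebesgue unit_cube"
  shows "\<bar>LINT x|lebesgue_on unit_cube. u x\<bar> \<le> 2 * sobolev_norm \<alpha> p lebesgue unit_cube u"
proof -
  let ?C = "unit_cube :: (real ^ 'd) set" and ?z = "\<lambda>_ :: 'd. 0 :: nat"
  define v where "v = weak_deriv ?C ?z u"
  define s where "s = sobolev_norm \<alpha> p lebesgue ?C u"
  have s0: "0 \<le> s" by (simp add: s_def sobolev_norm_def)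
  have v: "has_weak_deriv (interior ?C) ?z u v" "v \<in> Lp_space p lebesgue ?C"
    unfolding v_def using sobolev_weak_deriv[OF u, of ?z] by auto
  have "has_weak_deriv (interior ?C) ?z u u"
  proof -
    have nil: "is = []" if "count_list is = ?z" for "is" :: "'d list"
      using that by (metis count_list_0_iff list.set_intros(1) neq_Nil_conv)
    then show ?thesis
      using has_weak_deriv_absolutely_integrable(1)[OF v(1)]
      by (auto simp: has_weak_deriv_iff dest!: nil)
  qed
  then have "AE x in lebesgue. x \<in> ?C \<longrightarrow> u x = v x"
    using v(1) by (intro AE_unit_cube_if_AE_interior has_weak_deriv_unique[OF open_interior])
  then have ae: "AE x in lebesgue_on ?C. u x = v x"
    by (simp add: AE_restrict_space_iff)
  have uL: "u \<in> borel_measurable (lebesgue_on ?C)" "integrable (lebesgue_on ?C) (\<lambda>x. \<bar>u x\<bar> powr p)"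
    using u by (auto simp: sobolev_space_def Lp_space_def)
  have "(LINT x|lebesgue_on ?C. \<bar>u x\<bar> powr p) = (LINT x|lebesgue_on ?C. \<bar>v x\<bar> powr p)"
    using v(2) by (intro integral_cong_AE) (use ae uL in \<open>auto simp: Lp_space_def elim: eventually_mono\<close>)
  also have "\<dots> = Lp_norm p lebesgue ?C v powr p"
    using p by (simp add: Lp_norm_def powr_inverse_powr integral_nonneg_AE)
  also have "\<dots> \<le> (\<Sum>r | \<forall>i. r i \<le> \<alpha>. Lp_norm p lebesgue ?C (weak_deriv ?C r u) powr p)"
    unfolding v_def by (rule member_le_sum[OF _ _ finite_multi_indices]) auto
  also have "\<dots> = s powr p" using p by (simp add: s_def sobolev_norm_powr)
  finally have up: "(LINT x|lebesgue_on ?C. \<bar>u x\<bar> powr p) \<le> s powr p" .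
  have C1: "measure lebesgue ?C = 1"
  proof -
    have "measure lebesgue ?C = measure lborel ?C" unfolding unit_cube_def by simp
    also have "\<dots> = 1" unfolding unit_cube_def by (subst content_cbox_cart) (auto simp: interval_ne_empty_cart)
    finally show ?thesis .
  qed
  interpret C: finite_measure "lebesgue_on ?C"
    unfolding unit_cube_def by (rule finite_measure_lebesgue_on[OF lmeasurable_cbox])
  have "\<bar>LINT x|lebesgue_on ?C. u x\<bar> / 2 \<le> s"
  proof (rule dense_ge)
    fix A assume A: "s < A"
    then have A0: "0 < A" using s0 by linarith
    have iA: "integrable (lebesgue_on ?C) (\<lambda>x. A + A powr (1 - p) * \<bar>u x\<bar> powr p)"
      by (intro Bochner_Integration.integrable_add integrable_mult_right uL(2) C.integrable_const)
    have "\<bar>LINT x|lebesgue_on ?C. u x\<bar> \<le> (LINT x|lebesgue_on ?C. \<bar>u x\<bar>)"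
      by (rule integral_abs_bound)
    also have "\<dots> \<le> (LINT x|lebesgue_on ?C. A + A powr (1 - p) * \<bar>u x\<bar> powr p)"
      by (rule integral_mono'[OF iA]) (use le_add_powr[OF p A0] A0 in auto)
    also have "\<dots> = A + A powr (1 - p) * (LINT x|lebesgue_on ?C. \<bar>u x\<bar> powr p)"
      using uL(2) by (simp add: Bochner_Integration.integral_add measure_restrict_space C1)
    also have "\<dots> \<le> A + A powr (1 - p) * A powr p"
      using up A s0 p by (intro add_left_mono mult_left_mono order_trans[OF up] powr_mono2) auto
    also have "\<dots> = 2 * A" using A0 by (simp flip: powr_add)
    finally show "\<bar>LINT x|lebesgue_on ?C. u x\<bar> / 2 \<le> A" by simp
  qed
  then show ?thesis by (simp add: s_def)
qed

lemma cont_rep_UNIV: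
  fixes f :: "real ^ 'd \<Rightarrow> real"
  assumes \<alpha>: "1 \<le> \<alpha>" and f: "f \<in> sobolev_space \<alpha> p \<mu> UNIV"
  shows "continuous_on UNIV (cont_rep UNIV f)" "AE x in lebesgue. cont_rep UNIV f x = f x"
proof -
  have "\<exists>F. continuous_on UNIV F \<and> (AE x in lebesgue. F x = f x)"
  proof (rule continuous_representative)
    fix r :: "'d \<Rightarrow> nat" assume "\<And>i. r i \<le> 1"
    then have "r i \<le> \<alpha>" for i using \<alpha> order_trans by blast
    then show "\<exists>h. has_weak_deriv UNIV r f h" using sobolev_weak_deriv(1)[OF f] by (metis interior_UNIV)
  qed
  then have "\<exists>F. continuous_on UNIV F \<and> (AE x in lebesgue_on UNIV. F x = f x)"
    by (simp add: AE_restrict_space_iff)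
  from someI_ex[OF this] show "continuous_on UNIV (cont_rep UNIV f)" "AE x in lebesgue. cont_rep UNIV f x = f x"
    by (auto simp: cont_rep_def AE_restrict_space_iff)
qed

text \<open>The closed cube is the closure of its interior, so continuity extends the equality from almost all
  points to the nodes, which may lie on the boundary.\<close>
lemma cont_rep_unit_cube_eq:
  fixes u w :: "real ^ 'd \<Rightarrow> real"
  assumes w: "continuous_on unit_cube w" "AE x in lebesgue. w x = u x" and x: "x \<in> unit_cube"
  shows "cont_rep unit_cube u x = w x"
proof -
  let ?C = "unit_cube :: (real ^ 'd) set"
  have "AE x in lebesgue_on ?C. w x = u x"
    using w(2) by (auto simp: AE_restrict_space_iff elim: eventually_mono)
  then have "\<exists>h. continuous_on ?C h \<and> (AE x in lebesgue_on ?C. h x = u x)" using w by blast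
  from someI_ex[OF this] have v: "continuous_on ?C (cont_rep ?C u)" "AE x in lebesgue_on ?C. cont_rep ?C u x = u x"
    by (auto simp: cont_rep_def)
  have ne: "box (\<chi> i. - 1 / 2) (\<chi> i. 1 / 2) \<noteq> ({} :: (real ^ 'd) set)"
    by (simp add: interval_ne_empty_cart)
  have clos: "closure (interior ?C) = ?C"
    unfolding interior_unit_cube using closure_box[OF ne] by (simp add: unit_cube_def)
  have "cont_rep ?C u y = w y" if "y \<in> interior ?C" for y
  proof (rule continuous_AE_eq_imp_eq[OF open_interior _ _ _ that])
    show "continuous_on (interior ?C) (cont_rep ?C u)" "continuous_on (interior ?C) w"
      using v(1) w(1) interior_subset continuous_on_subset by blast+
    have "AE x in lebesgue. x \<in> ?C \<longrightarrow> cont_rep ?C u x = u x"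
      using v(2) by (simp add: AE_restrict_space_iff)
    then show "AE x in lebesgue. x \<in> interior ?C \<longrightarrow> cont_rep ?C u x = w x"
      using w(2) by eventually_elim (use interior_subset in auto)
  qed
  then have "cont_rep ?C u y - w y = 0" if "y \<in> interior ?C" for y using that by simp
  moreover have "continuous_on (closure (interior ?C)) (\<lambda>x. cont_rep ?C u x - w x)"
    unfolding clos by (rule continuous_on_diff[OF v(1) w(1)])
  ultimately have "cont_rep ?C u x - w x = 0"
    using continuous_constant_on_closure[of "interior ?C" "\<lambda>x. cont_rep ?C u x - w x" 0 x] x clos by blast
  then show ?thesis by simp
qed

section \<open>Error of the assembled quadrature\<close>

text \<open>Since \<open>|k + (sign k)/2| \<ge> |k|\<close>, the second entry of the maximum gives
  \<open>exp (|k|\<^sup>2 / (2p) - |k|\<^sup>2 / (2\<tau>)) \<le> C exp (- \<delta> |k|\<^sup>2)\<close>. Letting \<open>k\<close> grow yields \<open>\<delta> \<le> 1/(2\<tau>) - 1/(2p)\<close>, and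
  \<open>\<tau> > 1\<close> makes the final inequality strict.\<close>
lemma admissible_delta_less:
  assumes adm: "admissible_delta TYPE('d::finite) p \<tau> \<delta>" and p: "1 < p" and \<tau>: "1 < \<tau>"
  shows "\<delta> < (1 - 1 / p) / 2"
proof -
  obtain C where C: "\<And>k :: int ^ 'd. exp ((norm (int_vec k + (1 / 2) *\<^sub>R sign_vec k))\<^sup>2 / (2 * p)
                   - (norm (int_vec k))\<^sup>2 / (2 * \<tau>)) \<le> C * exp (- \<delta> * (norm (int_vec k))\<^sup>2)"
    using adm unfolding admissible_delta_def by (metis max.bounded_iff)
  define \<theta> where "\<theta> = 1 / (2 * p) - 1 / (2 * \<tau>) + \<delta>"
  have "\<theta> \<le> 0"
  proof (rule ccontr)
    assume "\<not> \<theta> \<le> 0"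
    then have \<theta>: "\<theta> > 0" by simp
    obtain m :: nat where m: "C < real m * \<theta>" using reals_Archimedean3[OF \<theta>] by blast
    define k :: "int ^ 'd" where "k = (\<chi> i. int m)"
    define Z where "Z = (norm (int_vec k))\<^sup>2"
    have Zm: "real m \<le> Z"
    proof -
      have "Z = real CARD('d) * (real m)\<^sup>2" by (simp add: Z_def norm_int_vec_square k_def)
      moreover have "real m \<le> (real m)\<^sup>2" by (cases m) (auto simp: power2_eq_square simp del: of_nat_Suc)
      moreover have "(1 :: real) * (real m)\<^sup>2 \<le> real CARD('d) * (real m)\<^sup>2"
        by (intro mult_right_mono) (auto simp: Suc_le_eq)
      ultimately show ?thesis by linarith
    qed
    have "Z \<le> (norm (int_vec k + (1 / 2) *\<^sub>R sign_vec k))\<^sup>2"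
      unfolding Z_def norm_vec_def L2_set_def
      by (auto intro!: sum_mono power_mono simp: int_vec_def sign_vec_def k_def)
    then have "Z / (2 * p) - Z / (2 * \<tau>) \<le> (norm (int_vec k + (1 / 2) *\<^sub>R sign_vec k))\<^sup>2 / (2 * p) - Z / (2 * \<tau>)"
      using p by (intro diff_right_mono divide_right_mono) auto
    then have "exp (Z / (2 * p) - Z / (2 * \<tau>)) \<le> C * exp (- \<delta> * Z)"
      using C[of k] unfolding Z_def by (meson exp_le_cancel_iff order_trans)
    then have "exp (Z / (2 * p) - Z / (2 * \<tau>)) * exp (\<delta> * Z) \<le> C * exp (- \<delta> * Z) * exp (\<delta> * Z)"
      by (intro mult_right_mono) auto
    then have "exp (Z * \<theta>) \<le> C"
      by (simp add: \<theta>_def algebra_simps flip: exp_add)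
    moreover have "1 + Z * \<theta> \<le> exp (Z * \<theta>)" by (rule exp_ge_add_one_self)
    moreover have "real m * \<theta> \<le> Z * \<theta>" using Zm \<theta> by (intro mult_right_mono) auto
    ultimately show False using m by linarith
  qed
  moreover have "1 / (2 * \<tau>) < 1 / 2" using \<tau> by (simp add: field_simps)
  moreover have "(1 - 1 / p) / 2 = 1 / 2 - 1 / (2 * p)" by (simp add: field_simps)
  ultimately show ?thesis unfolding \<theta>_def by linarith
qed

text \<open>The normalising factor \<open>\<rho>\<close> in the sizes of the local quadratures.\<close>
definition size_factor :: "'d::finite itself \<Rightarrow> real \<Rightarrow> real \<Rightarrow> real" where
  "size_factor _ a \<delta> = (1 / 2) ^ CARD('d) * (1 - exp (- \<delta> / (2 * a))) ^ CARD('d)"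

lemma size_factor_bounds:
  assumes "0 < a" "0 < \<delta>"
  shows "0 < size_factor TYPE('d::finite) a \<delta>" "size_factor TYPE('d) a \<delta> \<le> 1"
proof -
  have e: "0 < exp (- \<delta> / (2 * a))" "exp (- \<delta> / (2 * a)) < 1" using assms by auto
  then show "0 < size_factor TYPE('d) a \<delta>" by (simp add: size_factor_def)
  show "size_factor TYPE('d) a \<delta> \<le> 1"
    unfolding size_factor_def using e by (intro mult_le_one power_le_one) auto
qed

lemma local_size_eq:
  fixes k :: "int ^ 'd"
  shows "local_size a \<delta> n k = (if norm (int_vec k) < xi a \<delta> n
     then size_factor TYPE('d) a \<delta> * n * exp (- (\<delta> / (2 * a)) * (norm (int_vec k))\<^sup>2) else 0)"
  by (simp add: local_size_def size_factor_def)

text \<open>The factor \<open>size_factor\<close> is the reciprocal of the bound for the Gaussian sum over the lattice.\<close>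
lemma assembled_size_le:
  assumes a: "0 < a" and \<delta>: "0 < \<delta>" and n: "1 \<le> n"
  shows "real (assembled_size TYPE('d::finite) a \<delta> n) \<le> n"
proof -
  let ?K = "{k :: int ^ 'd. norm (int_vec k) < xi a \<delta> n}"
  let ?c = "\<delta> / (2 * a)"
  have c: "?c > 0" using a \<delta> by simp
  have e: "exp (- ?c) < 1" using c by simp
  have "real (assembled_size TYPE('d) a \<delta> n) \<le> (\<Sum>k\<in>?K. size_factor TYPE('d) a \<delta> * n * exp (- ?c * (norm (int_vec k))\<^sup>2))"
    unfolding assembled_size_def of_nat_sum
  proof (rule sum_mono)
    fix k assume "k \<in> ?K"
    then have *: "local_size a \<delta> n k = size_factor TYPE('d) a \<delta> * n * exp (- ?c * (norm (int_vec k))\<^sup>2)"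
      by (simp add: local_size_eq)
    have "0 \<le> size_factor TYPE('d) a \<delta> * n * exp (- ?c * (norm (int_vec k))\<^sup>2)"
      using size_factor_bounds(1)[OF a \<delta>, where 'd = 'd] n by (intro mult_nonneg_nonneg) auto
    then show "real (nat \<lfloor>local_size a \<delta> n k\<rfloor>) \<le> size_factor TYPE('d) a \<delta> * n * exp (- ?c * (norm (int_vec k))\<^sup>2)"
      unfolding * by (rule of_nat_floor)
  qed
  also have "\<dots> = size_factor TYPE('d) a \<delta> * n * (\<Sum>k\<in>?K. exp (- ?c * (norm (int_vec k))\<^sup>2))"
    by (simp add: sum_distrib_left)
  also have "\<dots> \<le> size_factor TYPE('d) a \<delta> * n * (2 / (1 - exp (- ?c))) ^ CARD('d)"
  proof (rule mult_left_mono)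
    have "?K \<subseteq> lattice_box (nat \<lceil>xi a \<delta> n\<rceil>)" by (auto intro!: in_lattice_box) linarith
    then show "(\<Sum>k\<in>?K. exp (- ?c * (norm (int_vec k))\<^sup>2)) \<le> (2 / (1 - exp (- ?c))) ^ CARD('d)"
      by (rule lattice_gaussian_sum_le[OF c])
    show "0 \<le> size_factor TYPE('d) a \<delta> * n"
      using size_factor_bounds(1)[OF a \<delta>, where 'd = 'd] n by auto
  qed
  also have "\<dots> = n * (((1 / 2) * (1 - exp (- ?c))) * (2 / (1 - exp (- ?c)))) ^ CARD('d)"
    unfolding size_factor_def power_mult_distrib minus_divide_left by (simp only: mult_ac)
  also have "((1 / 2) * (1 - exp (- ?c))) * (2 / (1 - exp (- ?c))) = 1"
  proof -
    have "((1 / 2) * (1 - z)) * (2 / (1 - z)) = 1" if "z < 1" for z :: real using that by simp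
    then show ?thesis using e by blast
  qed
  finally show ?thesis by simp
qed

lemma ell_bounds: "1 \<le> ell t" "1 \<le> s \<Longrightarrow> s \<le> t \<Longrightarrow> ell s \<le> ell t"
  unfolding ell_def by (simp, intro max.mono) auto

text \<open>Here \<open>J\<close> is the integral of the piece at \<open>k\<close>, \<open>q\<close> its quadrature and \<open>s\<close> its norm.
  If \<open>|k| \<ge> \<xi>\<^sub>n\<close> then \<open>q = 0\<close> and \<open>exp (- \<delta> |k|\<^sup>2 / 2) \<le> n\<^bsup>-a\<^esup>\<close>, so half of the decay of \<open>s\<close> supplies the power of
  \<open>n\<close>. If \<open>|k| < \<xi>\<^sub>n\<close> then \<open>t\<^bsup>-a\<^esup> = \<rho>\<^bsup>-a\<^esup> n\<^bsup>-a\<^esup> exp (\<delta> |k|\<^sup>2 / 2)\<close> uses up half of the decay; this factor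
  is at least 1 when \<open>t < 1\<close>, so that it also covers the cubes that receive no node.\<close>
lemma piece_error_bound:
  fixes k :: "int ^ 'd" and a b \<delta> n s C Cq S J q :: real
  defines "t \<equiv> local_size a \<delta> n k" and "\<rho> \<equiv> size_factor TYPE('d) a \<delta>" and "Z \<equiv> (norm (int_vec k))\<^sup>2"
  assumes a: "0 < a" and b: "0 \<le> b" and \<delta>: "0 < \<delta>" and n: "1 \<le> n"
    and nonneg: "0 \<le> s" "0 \<le> C" "0 \<le> Cq" "0 \<le> S"
    and s: "s \<le> C * exp (- \<delta> * Z) * S"
    and J: "\<bar>J\<bar> \<le> 2 * s"
    and big: "1 \<le> t \<Longrightarrow> \<bar>J - q\<bar> \<le> Cq * t powr (- a) * ell t powr b * s"
    and small: "t < 1 \<Longrightarrow> q = 0"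
  shows "\<bar>J - q\<bar> \<le> C * (2 + (Cq + 2) * \<rho> powr (- a)) * n powr (- a) * ell n powr b * S * exp (- (\<delta> / 2) * Z)"
proof -
  have \<rho>: "0 < \<rho>" "\<rho> \<le> 1" unfolding \<rho>_def using size_factor_bounds[OF a \<delta>] by auto
  have ell: "1 \<le> ell n powr b" using b ell_bounds(1)[of n] by (intro ge_one_powr_ge_zero) auto
  let ?R = "C * n powr (- a) * S * exp (- (\<delta> / 2) * Z)"
  have R0: "0 \<le> ?R" using nonneg by simp
  have "\<bar>J - q\<bar> \<le> (2 + (Cq + 2) * \<rho> powr (- a)) * ell n powr b * ?R"
  proof (cases "norm (int_vec k) < xi a \<delta> n")
    case False
    have "t = 0" using False by (simp add: t_def local_size_eq)
    have "0 \<le> 2 * a * inverse \<delta> * ln n" using a \<delta> n by simp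
    then have "2 * a * inverse \<delta> * ln n = (xi a \<delta> n)\<^sup>2" by (simp add: xi_def)
    also have "\<dots> \<le> Z" unfolding Z_def using False by (intro power_mono) (auto simp: xi_def a \<delta> n less_imp_le)
    finally have "a * ln n \<le> \<delta> / 2 * Z" using \<delta> by (simp add: field_simps)
    then have "exp (- \<delta> * Z) \<le> exp (- a * ln n + - (\<delta> / 2) * Z)" by simp
    also have "\<dots> = n powr (- a) * exp (- (\<delta> / 2) * Z)" using n unfolding powr_def exp_add by simp
    finally have "C * exp (- \<delta> * Z) * S \<le> C * (n powr (- a) * exp (- (\<delta> / 2) * Z)) * S"
      using nonneg by (intro mult_right_mono mult_left_mono) auto
    then have "\<bar>J - q\<bar> \<le> 2 * 1 * ?R" using J s small \<open>t = 0\<close> by (simp add: mult_ac)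
    also have "\<dots> \<le> (2 + (Cq + 2) * \<rho> powr (- a)) * ell n powr b * ?R"
      using ell nonneg R0 by (intro mult_right_mono mult_mono) auto
    finally show ?thesis .
  next
    case True
    have t: "t = \<rho> * n * exp (- (\<delta> / (2 * a)) * Z)"
      using True by (simp add: t_def local_size_eq \<rho>_def Z_def)
    have t0: "0 < t" using \<rho> n by (simp add: t)
    have tn: "t \<le> n"
    proof -
      have "exp (- (\<delta> / (2 * a)) * Z) \<le> 1" using a \<delta> by (simp add: Z_def)
      then have "\<rho> * exp (- (\<delta> / (2 * a)) * Z) \<le> 1" using \<rho> by (intro mult_le_one) auto
      then have "n * (\<rho> * exp (- (\<delta> / (2 * a)) * Z)) \<le> n * 1" using n by (intro mult_left_mono) auto
      then show ?thesis by (simp add: t mult_ac)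
    qed
    have tpow: "t powr (- a) = \<rho> powr (- a) * n powr (- a) * exp (\<delta> / 2 * Z)"
    proof -
      have "exp (- (\<delta> / (2 * a)) * Z) powr (- a) = exp (\<delta> / 2 * Z)" using a by (simp add: exp_powr_real)
      then show ?thesis using \<rho> n by (simp add: t powr_mult)
    qed
    have "\<bar>J - q\<bar> \<le> (Cq + 2) * t powr (- a) * ell n powr b * s"
    proof (cases "1 \<le> t")
      case True
      have "\<bar>J - q\<bar> \<le> Cq * t powr (- a) * ell t powr b * s" by (rule big[OF True])
      also have "\<dots> \<le> (Cq + 2) * t powr (- a) * ell n powr b * s"
        using nonneg b ell_bounds(2)[OF True tn] ell_bounds(1)[of t]
        by (intro mult_right_mono mult_mono powr_mono2) auto
      finally show ?thesis .
    next
      case False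
      have "1 \<le> t powr (- a)"
        using powr_mono2'[of "- a" t 1] t0 False a by simp
      then have "2 * 1 * 1 * s \<le> (Cq + 2) * t powr (- a) * ell n powr b * s"
        using nonneg ell by (intro mult_right_mono mult_mono) auto
      then show ?thesis using small False J by simp
    qed
    also have "\<dots> \<le> (Cq + 2) * t powr (- a) * ell n powr b * (C * exp (- \<delta> * Z) * S)"
      using nonneg s by (intro mult_left_mono) auto
    also have "\<dots> = (Cq + 2) * \<rho> powr (- a) * ell n powr b * (C * n powr (- a) * S * (exp (\<delta> / 2 * Z) * exp (- \<delta> * Z)))"
      by (simp add: tpow mult_ac)
    also have "exp (\<delta> / 2 * Z) * exp (- \<delta> * Z) = exp (- (\<delta> / 2) * Z)" by (simp flip: exp_add)
    also have "(Cq + 2) * \<rho> powr (- a) * ell n powr b * ?R \<le> (2 + (Cq + 2) * \<rho> powr (- a)) * ell n powr b * ?R"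
      using R0 ell by (intro mult_right_mono) auto
    finally show ?thesis .
  qed
  then show ?thesis by (simp add: mult_ac)
qed

text \<open>The piece errors are summed over the boxes of lattice points with \<open>|k\<^sub>i| \<le> M\<close>. Once such a box contains
  all \<open>k\<close> with \<open>|k| < \<xi>\<^sub>n\<close>, the sum of the local quadratures over it is the assembled quadrature, since the
  others are empty; the sum of the integrals converges to the integral over the space as \<open>M\<close> grows.\<close>
theorem theorem2p1:
  fixes \<alpha> :: nat and p a b \<tau> \<delta> :: real
    and wt :: "nat \<Rightarrow> nat \<Rightarrow> real" and nd :: "nat \<Rightarrow> nat \<Rightarrow> real ^ 'd"
  assumes "1 \<le> \<alpha>" and "1 < p" and "0 < a" and "0 \<le> b"
    and "1 < \<tau>" and "\<tau> < p"
    and "0 < \<delta>" and "admissible_delta TYPE('d) p \<tau> \<delta>"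
    and nodes: "\<And>N j. 1 \<le> j \<Longrightarrow> j \<le> N \<Longrightarrow> nd N j \<in> unit_cube"
    and quad: "\<exists>C. \<forall>m \<ge> 1. \<forall>f \<in> sobolev_space \<alpha> p lebesgue unit_cube.
        \<bar>(LINT x|lebesgue_on unit_cube. f x) - quadrature wt nd m (cont_rep unit_cube f)\<bar>
          \<le> C * m powr (- a) * ell m powr b * sobolev_norm \<alpha> p lebesgue unit_cube f"
  shows "(\<forall>n \<ge> 1. real (assembled_size TYPE('d) a \<delta> n) \<le> n) \<and>
    (\<exists>C' > 0. \<forall>n \<ge> 1. \<forall>f \<in> sobolev_space \<alpha> p gauss_measure UNIV.
        \<bar>(LINT x|gauss_measure. f x) - assembled_quadrature wt nd a \<delta> n (cont_rep UNIV f)\<bar>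
          \<le> C' * n powr (- a) * ell n powr b * sobolev_norm \<alpha> p gauss_measure UNIV f)"
proof (intro conjI allI impI)
  show "real (assembled_size TYPE('d) a \<delta> n) \<le> n" if "1 \<le> n" for n
    by (rule assembled_size_le) (use assms that in auto)
next
  have \<delta>p: "\<delta> < (1 - 1 / p) / 2" using admissible_delta_less assms by blast
  obtain C where C: "C \<ge> 0" and all_pieces: "\<forall>f \<in> sobolev_space \<alpha> p gauss_measure UNIV. \<forall>c :: real ^ 'd.
     (\<lambda>x. f (x + c) * gauss_density (x + c)) \<in> sobolev_space \<alpha> p lebesgue unit_cube \<and>
     sobolev_norm \<alpha> p lebesgue unit_cube (\<lambda>x. f (x + c) * gauss_density (x + c))
       \<le> C * exp (- \<delta> * (norm c)\<^sup>2) * sobolev_norm \<alpha> p gauss_measure UNIV f"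
    using sobolev_gauss_piece[OF \<open>1 < p\<close> \<open>0 < \<delta>\<close> \<delta>p, where 'd = 'd and \<alpha> = \<alpha>] by (elim exE conjE)
  note piece = all_pieces[rule_format, THEN conjunct1] all_pieces[rule_format, THEN conjunct2]
  obtain Cq where all_quad: "\<forall>m \<ge> 1. \<forall>f \<in> sobolev_space \<alpha> p lebesgue unit_cube.
        \<bar>(LINT x|lebesgue_on unit_cube. f x) - quadrature wt nd m (cont_rep unit_cube f)\<bar>
          \<le> Cq * m powr (- a) * ell m powr b * sobolev_norm \<alpha> p lebesgue unit_cube f"
    using quad by (elim exE)
  note Cq = all_quad[rule_format]
  define B where "B = (2 / (1 - exp (- (\<delta> / 2)))) ^ CARD('d)"
  have B0: "0 \<le> B" using \<open>0 < \<delta>\<close> by (simp add: B_def)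
  define D where "D = C * (2 + (max 0 Cq + 2) * size_factor TYPE('d) a \<delta> powr (- a))"
  have D0: "0 \<le> D" using C by (simp add: D_def)
  have norm0: "0 \<le> sobolev_norm \<alpha> p \<mu> \<Omega> u" for \<mu> \<Omega> and u :: "real ^ 'd \<Rightarrow> real" by (simp add: sobolev_norm_def)
  show "\<exists>C' > 0. \<forall>n \<ge> 1. \<forall>f \<in> sobolev_space \<alpha> p gauss_measure UNIV.
        \<bar>(LINT x|gauss_measure. f x) - assembled_quadrature wt nd a \<delta> n (cont_rep UNIV f)\<bar>
          \<le> C' * n powr (- a) * ell n powr b * sobolev_norm \<alpha> p gauss_measure UNIV f"
  \<comment> \<open>the summand 1 makes the constant positive even if \<open>C = 0\<close>\<close>
  proof (intro exI[of _ "D * B + 1"] conjI allI impI ballI)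
    show "0 < D * B + 1" using D0 B0 by (simp add: add_nonneg_pos)
    fix n :: real and f :: "real ^ 'd \<Rightarrow> real"
    assume n: "1 \<le> n" and f: "f \<in> sobolev_space \<alpha> p gauss_measure UNIV"
    have fLp: "f \<in> Lp_space p gauss_measure UNIV" using f unfolding sobolev_space_def by blast
    define S where "S = sobolev_norm \<alpha> p gauss_measure UNIV f"
    define F where "F = cont_rep UNIV f"
    have F: "continuous_on UNIV F" "AE x in lebesgue. F x = f x"
      unfolding F_def by (rule cont_rep_UNIV[OF \<open>1 \<le> \<alpha>\<close> f])+
    define u where "u = (\<lambda>x. f x * gauss_density x)"
    have u: "integrable lebesgue u"
      unfolding u_def by (rule Lp_gauss_integrable[OF \<open>1 < p\<close> fLp])
    have int_f: "(LINT x|gauss_measure. f x) = (LINT x|lebesgue. u x)"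
      unfolding u_def using fLp by (intro gauss_measure_integral) (simp add: Lp_space_gauss_iff)
    define J where "J k = (LINT x|lebesgue_on unit_cube. u (x + int_vec k))" for k :: "int ^ 'd"
    define q where "q k = quadrature wt nd (local_size a \<delta> n k)
          (\<lambda>x. F (x + int_vec k) * gauss_density (x + int_vec k))" for k :: "int ^ 'd"
    define E where "E = D * n powr (- a) * ell n powr b * S"
    have E0: "0 \<le> E" unfolding E_def S_def using D0 norm0 by simp
    have err: "\<bar>J k - q k\<bar> \<le> E * exp (- (\<delta> / 2) * (norm (int_vec k))\<^sup>2)" for k
    proof -
      let ?u = "\<lambda>x. f (x + int_vec k) * gauss_density (x + int_vec k)"
      let ?w = "\<lambda>x. F (x + int_vec k) * gauss_density (x + int_vec k)"
      let ?s = "sobolev_norm \<alpha> p lebesgue unit_cube ?u" and ?t = "local_size a \<delta> n k"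
      have uk: "?u \<in> sobolev_space \<alpha> p lebesgue unit_cube" by (rule piece(1)[OF f])
      have w: "continuous_on unit_cube ?w"
      proof -
        have "continuous_on UNIV (\<lambda>x. F (x + int_vec k))" "continuous_on UNIV (\<lambda>x. gauss_density (x + int_vec k))"
          by (rule continuous_on_compose2[OF F(1)] continuous_on_compose2[OF smooth_continuous_on[OF smooth_gauss_density, of UNIV]];
              simp add: continuous_on_add continuous_on_id continuous_on_const)+
        then have "continuous_on UNIV ?w" by (rule continuous_on_mult)
        then show ?thesis by (rule continuous_on_subset) simp
      qed
      have wu: "AE x in lebesgue. ?w x = ?u x"
        using AE_lebesgue_translation[OF F(2), of "int_vec k"] by eventually_elim simp
      have q_eq: "q k = quadrature wt nd ?t (cont_rep unit_cube ?u)"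
        unfolding q_def quadrature_def
        by (intro sum.cong refl arg_cong2[where f = "(*)"] cont_rep_unit_cube_eq[OF w wu, symmetric] nodes) auto
      have "\<bar>J k - q k\<bar> \<le> C * (2 + (max 0 Cq + 2) * size_factor TYPE('d) a \<delta> powr (- a)) * n powr (- a) * ell n powr b * S
          * exp (- (\<delta> / 2) * (norm (int_vec k))\<^sup>2)"
      proof (rule piece_error_bound[where s = ?s])
        show "?s \<le> C * exp (- \<delta> * (norm (int_vec k))\<^sup>2) * S" unfolding S_def by (rule piece(2)[OF f])
        show "\<bar>J k\<bar> \<le> 2 * ?s" unfolding J_def u_def by (rule abs_integral_unit_cube_le[OF \<open>1 < p\<close> uk])
        show "\<bar>J k - q k\<bar> \<le> max 0 Cq * ?t powr (- a) * ell ?t powr b * ?s" if "1 \<le> ?t"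
        proof -
          have "\<bar>J k - q k\<bar> \<le> Cq * ?t powr (- a) * ell ?t powr b * ?s"
            unfolding J_def u_def q_eq by (rule Cq[OF that uk])
          also have "\<dots> \<le> max 0 Cq * ?t powr (- a) * ell ?t powr b * ?s"
            by (intro mult_right_mono norm0) auto
          finally show ?thesis .
        qed
        show "q k = 0" if "?t < 1"
        proof -
          have "\<lfloor>?t\<rfloor> \<le> 0" using that by (simp add: floor_le_iff)
          then show ?thesis by (simp add: q_def quadrature_def)
        qed
      qed (use \<open>0 < a\<close> \<open>0 \<le> b\<close> \<open>0 < \<delta>\<close> n C in \<open>simp_all add: S_def norm0\<close>)
      then show ?thesis by (simp add: E_def D_def)
    qed
    define A where "A = assembled_quadrature wt nd a \<delta> n F"
    have A: "A = (\<Sum>k\<in>lattice_box M. q k)" if "nat \<lceil>xi a \<delta> n\<rceil> \<le> M" for M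
    proof -
      have sub: "{k :: int ^ 'd. norm (int_vec k) < xi a \<delta> n} \<subseteq> lattice_box M"
        using that by (auto intro!: in_lattice_box)
      have "q k = 0" if "\<not> norm (int_vec k) < xi a \<delta> n" for k
        using that by (simp add: q_def local_size_eq quadrature_def)
      then show ?thesis
        unfolding A_def assembled_quadrature_def q_def[symmetric]
        by (intro sum.mono_neutral_left[OF finite_lattice_box sub] ballI) simp
    qed
    have bound: "\<bar>(\<Sum>k\<in>lattice_box M. J k) - A\<bar> \<le> E * B" if "nat \<lceil>xi a \<delta> n\<rceil> \<le> M" for M
    proof -
      have "\<bar>(\<Sum>k\<in>lattice_box M. J k) - A\<bar> = \<bar>\<Sum>k\<in>lattice_box M. J k - q k\<bar>"
        by (simp add: A[OF that] sum_subtractf)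
      also have "\<dots> \<le> (\<Sum>k\<in>lattice_box M. E * exp (- (\<delta> / 2) * (norm (int_vec k :: real ^ 'd))\<^sup>2))"
        by (rule order_trans[OF sum_abs sum_mono]) (rule err)
      also have "\<dots> \<le> E * B"
        unfolding sum_distrib_left[symmetric] B_def
        using \<open>0 < \<delta>\<close> by (intro mult_left_mono[OF lattice_gaussian_sum_le[OF _ order_refl] E0]) simp
      finally show ?thesis .
    qed
    have "(\<lambda>M. \<bar>(\<Sum>k\<in>lattice_box M. J k) - A\<bar>) \<longlonglongrightarrow> \<bar>(LINT x|lebesgue. u x) - A\<bar>"
      unfolding J_def by (intro tendsto_intros unit_cube_decomposition u)
    then have "\<bar>(LINT x|lebesgue. u x) - A\<bar> \<le> E * B"
      by (rule LIMSEQ_le_const2) (use bound in blast)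
    also have "E * B = (D * B) * n powr (- a) * ell n powr b * S" by (simp add: E_def)
    also have "\<dots> \<le> (D * B + 1) * n powr (- a) * ell n powr b * S"
      using norm0 by (intro mult_right_mono) (auto simp: S_def)
    finally show "\<bar>(LINT x|gauss_measure. f x) - assembled_quadrature wt nd a \<delta> n (cont_rep UNIV f)\<bar>
          \<le> (D * B + 1) * n powr (- a) * ell n powr b * sobolev_norm \<alpha> p gauss_measure UNIV f"
      by (simp add: int_f A_def F_def S_def)
  qed
qed

end
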